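(* For any $n\ge2$ and any bounded measurable function $f=f(R^n)$ of $R^n=(R_s(\sigma^\ell,\sigma^{\ell'}))_{s\in\mathcal S,\ \ell,\ell'\le n}$, we have $\lim_{N\to\infty}\mathbb E_x\,\Delta(f,n,w,p)=0$ for all $p\ge1$ and $w\in\mathcal W$, where $\Delta(f,n,w,p)$ is defined in the context.
   Context: Setting: $\mathcal S$ a finite set; $\{1,\dots,N\}=\bigcup_{s}I_s$ disjoint, $N_s=|I_s|$, $N_s/N\to\lambda_s\in(0,1)$ (write $\lambda_s$ also for $N_s/N$); $H_N(\sigma)=N^{-1/2}\sum_{i,j=1}^Ng_{ij}\sigma_i\sigma_j$ on $\Sigma_N=\{-1,1\}^N$ with $(g_{ij})$ independent centered Gaussian, $\mathbb E g_{ij}^2=\Delta^2_{st}$ for $i\in I_s,j\in I_t$, $\Delta^2$ symmetric. $R_s(\sigma^1,\sigma^2)=N_s^{-1}\sum_{i\in I_s}\sigma^1_i\sigma^2_i$. Let $\mathcal W$ be a countable dense subset of $[0,1]^{|\mathcal S|}$ and $j:\mathcal W\to\mathbb N$ one-to-one. For $w=(w_s)\in\mathcal W$, set $s_i(w)=\sqrt{w_s}$ for $i\in I_s$, and $h_{N,w,p}(\sigma)=N^{-p/2}\sum_{i_1,\dots,i_p=1}^N g^{w,p}_{i_1\dots i_p}\sigma_{i_1}s_{i_1}(w)\cdots\sigma_{i_p}s_{i_p}(w)$ with $g^{w,p}_{i_1\dots i_p}$ i.i.d. standard Gaussian (independent over all $p\ge1$, $w$, indices, and of $(g_{ij})$).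 Let $x=(x_{w,p})_{p\ge1,w\in\mathcal W}$ be i.i.d. uniform on $[1,2]$, $h_N(\sigma)=\sum_{w\in\mathcal W}\sum_{p\ge1}2^{-j(w)-p}x_{w,p}h_{N,w,p}(\sigma)$, and $H^{\rm pert}_N(\sigma)=H_N(\sigma)+s_Nh_N(\sigma)$ with $s_N=N^\gamma$ for a fixed $1/4<\gamma<1/2$. Let $G_N(\sigma)=\exp H^{\rm pert}_N(\sigma)/\sum_{\sigma'}\exp H^{\rm pert}_N(\sigma')$, $\langle\cdot\rangle$ the average with respect to $G_N^{\otimes\infty}$ over replicas $(\sigma^\ell)_{\ell\ge1}$, $\mathbb E$ the expectation conditional on $x$, and $\mathbb E_x$ the expectation in $x$. Let $R_w(\sigma^1,\sigma^2)=\sum_s\lambda_sw_sR_s(\sigma^1,\sigma^2)$ and $$\Delta(f,n,w,p)=\Bigl|\mathbb E\langle fR_w(\sigma^1,\sigma^{n+1})^p\rangle-\frac1n\mathbb E\langle f\rangle\,\mathbb E\langle R_w(\sigma^1,\sigma^2)^p\rangle-\frac1n\sum_{\ell=2}^n\mathbb E\langle fR_w(\sigma^1,\sigma^\ell)^p\rangle\Bigr|.$$ *)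

theory Defs
  imports "HOL-Probability.Probability"
begin

definition cfgs :: "nat \<Rightarrow> (nat \<Rightarrow> real) set" where
  "cfgs N = PiE {..<N} (\<lambda>_. {-1, 1})"

definition blk :: "(nat \<Rightarrow> nat \<Rightarrow> 's) \<Rightarrow> nat \<Rightarrow> 's \<Rightarrow> nat set" where
  "blk lab N s = {i. i < N \<and> lab N i = s}"

definition overlap_s :: "(nat \<Rightarrow> nat \<Rightarrow> 's) \<Rightarrow> nat \<Rightarrow> 's \<Rightarrow> (nat \<Rightarrow> real) \<Rightarrow> (nat \<Rightarrow> real) \<Rightarrow> real" where
  "overlap_s lab N s \<sigma> \<tau> = (\<Sum>i\<in>blk lab N s. \<sigma> i * \<tau> i) / real (card (blk lab N s))"

definition overlap_w :: "(nat \<Rightarrow> nat \<Rightarrow> 's::finite) \<Rightarrow> nat \<Rightarrow> ('s \<Rightarrow> real) \<Rightarrow> (nat \<Rightarrow> real) \<Rightarrow> (nat \<Rightarrow> real) \<Rightarrow> real" where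
  "overlap_w lab N w \<sigma> \<tau> =
     (\<Sum>s\<in>UNIV. (real (card (blk lab N s)) / real N) * w s * overlap_s lab N s \<sigma> \<tau>)"

text \<open>Index set of the Gaussian disorder at size N: Inl (i,j) for g_ij, Inr (w,p,[i_1..i_p]) for g^{w,p}.\<close>
definition disorder_idx :: "('s \<Rightarrow> real) set \<Rightarrow> nat \<Rightarrow> ((nat \<times> nat) + (('s \<Rightarrow> real) \<times> nat \<times> nat list)) set" where
  "disorder_idx W N = Inl ` ({..<N} \<times> {..<N}) \<union>
     Inr ` {(w, p, is). w \<in> W \<and> 1 \<le> p \<and> length is = p \<and> set is \<subseteq> {..<N}}"

definition disorder_space :: "('s \<Rightarrow> real) set \<Rightarrow> nat \<Rightarrow> ((nat \<times> nat) + (('s \<Rightarrow> real) \<times> nat \<times> nat list) \<Rightarrow> real) measure" where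
  "disorder_space W N = PiM (disorder_idx W N) (\<lambda>_. density lborel std_normal_density)"

text \<open>H_N with g_ij = sqrt(Delta2 s t) * z_ij, z_ij standard Gaussian.\<close>
definition H_SK :: "('s \<Rightarrow> 's \<Rightarrow> real) \<Rightarrow> (nat \<Rightarrow> nat \<Rightarrow> 's) \<Rightarrow> nat
    \<Rightarrow> ((nat \<times> nat) + (('s \<Rightarrow> real) \<times> nat \<times> nat list) \<Rightarrow> real) \<Rightarrow> (nat \<Rightarrow> real) \<Rightarrow> real" where
  "H_SK Delta2 lab N g \<sigma> = (1 / sqrt (real N)) *
     (\<Sum>i<N. \<Sum>j<N. sqrt (Delta2 (lab N i) (lab N j)) * g (Inl (i, j)) * \<sigma> i * \<sigma> j)"

definition h_wp :: "(nat \<Rightarrow> nat \<Rightarrow> 's) \<Rightarrow> nat \<Rightarrow> ('s \<Rightarrow> real) \<Rightarrow> nat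
    \<Rightarrow> ((nat \<times> nat) + (('s \<Rightarrow> real) \<times> nat \<times> nat list) \<Rightarrow> real) \<Rightarrow> (nat \<Rightarrow> real) \<Rightarrow> real" where
  "h_wp lab N w p g \<sigma> = (1 / sqrt (real N) ^ p) *
     (\<Sum>is\<in>{is. length is = p \<and> set is \<subseteq> {..<N}}.
        g (Inr (w, p, is)) * (\<Prod>k<p. \<sigma> (is ! k) * sqrt (w (lab N (is ! k)))))"

definition h_pert :: "('s \<Rightarrow> real) set \<Rightarrow> (('s \<Rightarrow> real) \<Rightarrow> nat) \<Rightarrow> (nat \<Rightarrow> nat \<Rightarrow> 's) \<Rightarrow> nat
    \<Rightarrow> (('s \<Rightarrow> real) \<times> nat \<Rightarrow> real)
    \<Rightarrow> ((nat \<times> nat) + (('s \<Rightarrow> real) \<times> nat \<times> nat list) \<Rightarrow> real) \<Rightarrow> (nat \<Rightarrow> real) \<Rightarrow> real" where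
  "h_pert W j lab N x g \<sigma> =
     (\<Sum>\<^sub>\<infinity>(w, p)\<in>W \<times> {1..}. 2 powr (- real (j w) - real p) * x (w, p) * h_wp lab N w p g \<sigma>)"

definition H_pert where
  "H_pert Delta2 W j gamma lab N x g \<sigma> =
     H_SK Delta2 lab N g \<sigma> + real N powr gamma * h_pert W j lab N x g \<sigma>"

definition gibbs where
  "gibbs Delta2 W j gamma lab N x g \<sigma> =
     exp (H_pert Delta2 W j gamma lab N x g \<sigma>) /
     (\<Sum>\<sigma>'\<in>cfgs N. exp (H_pert Delta2 W j gamma lab N x g \<sigma>'))"

definition gibbs_avg :: "((nat \<Rightarrow> real) \<Rightarrow> real) \<Rightarrow> nat \<Rightarrow> nat \<Rightarrow> ((nat \<Rightarrow> nat \<Rightarrow> real) \<Rightarrow> real) \<Rightarrow> real" where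
  "gibbs_avg G N k F = (\<Sum>\<tau>\<in>PiE {1..k} (\<lambda>_. cfgs N). (\<Prod>l\<in>{1..k}. G (\<tau> l)) * F \<tau>)"

definition Egibbs where
  "Egibbs Delta2 W j gamma lab N x k F =
     (\<integral>g. gibbs_avg (gibbs Delta2 W j gamma lab N x g) N k F \<partial>disorder_space W N)"

definition overlap_array :: "(nat \<Rightarrow> nat \<Rightarrow> 's) \<Rightarrow> nat \<Rightarrow> nat \<Rightarrow> (nat \<Rightarrow> nat \<Rightarrow> real) \<Rightarrow> ('s \<times> nat \<times> nat \<Rightarrow> real)" where
  "overlap_array lab N n \<tau> =
     restrict (\<lambda>(s, l, l'). overlap_s lab N s (\<tau> l) (\<tau> l')) (UNIV \<times> {1..n} \<times> {1..n})"

definition Delta_q where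
  "Delta_q Delta2 W j gamma lab N f n w p x =
     (let E = Egibbs Delta2 W j gamma lab N x (n + 1);
          fR = (\<lambda>\<tau>. f (overlap_array lab N n \<tau>))
      in \<bar>E (\<lambda>\<tau>. fR \<tau> * overlap_w lab N w (\<tau> 1) (\<tau> (n + 1)) ^ p)
          - (1 / real n) * E fR * E (\<lambda>\<tau>. overlap_w lab N w (\<tau> 1) (\<tau> 2) ^ p)
          - (1 / real n) * (\<Sum>l\<in>{2..n}. E (\<lambda>\<tau>. fR \<tau> * overlap_w lab N w (\<tau> 1) (\<tau> l) ^ p))\<bar>)"

definition x_space :: "('s \<Rightarrow> real) set \<Rightarrow> (('s \<Rightarrow> real) \<times> nat \<Rightarrow> real) measure" where
  "x_space W = PiM (W \<times> {1..}) (\<lambda>_. uniform_measure lborel {1..2})"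

end

theory Submission
  imports Defs
begin

text \<open>Fix \<open>e = (w, p)\<close> and write \<open>u = x e\<close>, \<open>h = h_{N,w,p}\<close>, \<open>s = N^gamma\<close>. Gaussian integration by
  parts gives \<open>Delta(f,n,w,p) = |E<f h> - E<f> E<h>| / (n u s 2^{-j(w)-p})\<close>, so it suffices that
  \<open>E_x E<|h - E<h>|>\<close> is \<open>o(s)\<close>. The free energy \<open>log sum exp H\<close> is convex in \<open>u\<close>, its first
  derivative is proportional to \<open><h>\<close> and its second to the thermal variance of \<open>h\<close>. The expected first
  derivative is \<open>O(s^2)\<close>, so integrating the second one over \<open>u\<close> bounds the thermal fluctuations.
  The coordinatewise Lipschitz constants of the free energy have square sum \<open>O(N)\<close>, so its fluctuations
  are \<open>O(sqrt N)\<close>, and convexity transfers this to \<open><h>\<close>: the disorder fluctuations of the derivative are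
  \<open>O(y s^2 + sqrt N / y)\<close> for every step \<open>y\<close>. With \<open>y = N^{1/4 - gamma}\<close> this is \<open>o(s^2)\<close>
  because \<open>gamma > 1/4\<close>.\<close>

section \<open>Finite Gibbs averages\<close>

text \<open>Two infinities shape the proof. The perturbation is a series over all
  \<open>(w, p)\<close>, and \<open>infsum\<close> takes the value 0 where it diverges, so
  \<open>H_pert\<close> is affine in one coupling, or linear in the disorder, only almost surely.
  Calculus is therefore done with \<open>rest_ham e x g + u * spin_ham e g\<close>, which at every
  point is affine in \<open>u\<close> and in each Gaussian of type \<open>e\<close>; it agrees with
  \<open>H_pert\<close> almost surely and hence has the same expectations. Concentration comes from
  an induction over finitely many Gaussians. Its bound does not depend on how many terms of the
  series are kept, because every partial sum of the weights \<open>coef\<close> is at most 4, so the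
  truncation can be removed in L1.

  Only the coupling of the fixed pair is averaged: the others stay frozen, with bounds uniform in
  them. The fixed weight of that pair costs only a constant factor.\<close>

definition gav :: "'c set \<Rightarrow> ('c \<Rightarrow> real) \<Rightarrow> ('c \<Rightarrow> real) \<Rightarrow> real" where
  "gav S H b = (\<Sum>\<sigma>\<in>S. exp (H \<sigma>) * b \<sigma>) / (\<Sum>\<sigma>\<in>S. exp (H \<sigma>))"

definition lse :: "'c set \<Rightarrow> ('c \<Rightarrow> real) \<Rightarrow> real" where
  "lse S H = ln (\<Sum>\<sigma>\<in>S. exp (H \<sigma>))"

lemma sum_exp_pos:
  fixes H :: "'c \<Rightarrow> real"
  assumes "finite S" "S \<noteq> {}"
  shows "0 < (\<Sum>\<sigma>\<in>S. exp (H \<sigma>))"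
  using assms by (intro sum_pos) auto

lemma gav_add: "gav S H (\<lambda>\<sigma>. b \<sigma> + c \<sigma>) = gav S H b + gav S H c"
  by (simp add: gav_def algebra_simps sum.distrib add_divide_distrib)

lemma gav_diff: "gav S H (\<lambda>\<sigma>. b \<sigma> - c \<sigma>) = gav S H b - gav S H c"
  by (simp add: gav_def algebra_simps sum_subtractf diff_divide_distrib)

lemma gav_cmult: "gav S H (\<lambda>\<sigma>. k * b \<sigma>) = k * gav S H b"
  by (simp add: gav_def sum_distrib_left mult.left_commute)

lemma gav_sum: "gav S H (\<lambda>\<sigma>. \<Sum>i\<in>I. b i \<sigma>) = (\<Sum>i\<in>I. gav S H (b i))"
  unfolding gav_def sum_distrib_left sum_divide_distrib[symmetric]
  by (subst sum.swap) simp

lemma gav_const: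
  assumes "finite S" "S \<noteq> {}"
  shows "gav S H (\<lambda>_. k) = k"
  using sum_exp_pos[OF assms, of H] by (simp add: gav_def sum_distrib_right[symmetric])

lemma gav_cong: "(\<And>\<sigma>. \<sigma> \<in> S \<Longrightarrow> H \<sigma> = H' \<sigma>) \<Longrightarrow> (\<And>\<sigma>. \<sigma> \<in> S \<Longrightarrow> b \<sigma> = b' \<sigma>) \<Longrightarrow> gav S H b = gav S H' b'"
  by (simp add: gav_def)

lemma gav_mono:
  assumes "\<And>\<sigma>. \<sigma> \<in> S \<Longrightarrow> b \<sigma> \<le> c \<sigma>"
  shows "gav S H b \<le> gav S H c"
  unfolding gav_def
  by (intro divide_right_mono sum_mono mult_left_mono sum_nonneg) (auto simp: assms)

lemma gav_abs_le: "\<bar>gav S H b\<bar> \<le> gav S H (\<lambda>\<sigma>. \<bar>b \<sigma>\<bar>)"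
  using gav_mono[of S b "\<lambda>\<sigma>. \<bar>b \<sigma>\<bar>" H] gav_mono[of S "\<lambda>\<sigma>. - 1 * \<bar>b \<sigma>\<bar>" b H]
  unfolding gav_cmult by (simp add: abs_le_iff minus_le_iff abs_ge_minus_self)

lemma gav_bounded:
  assumes "finite S" "S \<noteq> {}" "\<And>\<sigma>. \<sigma> \<in> S \<Longrightarrow> \<bar>b \<sigma>\<bar> \<le> C"
  shows "\<bar>gav S H b\<bar> \<le> C"
  using gav_abs_le[of S H b] gav_mono[of S "\<lambda>\<sigma>. \<bar>b \<sigma>\<bar>" "\<lambda>_. C" H] assms gav_const[of S H C]
  by fastforce

text \<open>Its right-hand side does not involve \<open>H\<close>. It thus gives an integrable
  dominating function, uniform in the coupling, when \<open>H\<close> and \<open>b\<close> are both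
  random.\<close>

lemma gav_le_sum:
  assumes "finite S" "S \<noteq> {}" "\<And>\<sigma>. \<sigma> \<in> S \<Longrightarrow> 0 \<le> b \<sigma>"
  shows "gav S H b \<le> (\<Sum>\<sigma>\<in>S. b \<sigma>)"
proof -
  have "gav S H b \<le> gav S H (\<lambda>_. \<Sum>\<sigma>\<in>S. b \<sigma>)"
    using assms by (intro gav_mono member_le_sum) auto
  then show ?thesis using gav_const[OF assms(1,2)] by simp
qed

lemma gav_nonneg: "(\<And>\<sigma>. \<sigma> \<in> S \<Longrightarrow> 0 \<le> b \<sigma>) \<Longrightarrow> 0 \<le> gav S H b"
  using gav_mono[of S "\<lambda>_. 0" b H] by (simp add: gav_def)

text \<open>The derivative of a Gibbs average is a covariance. It is used with \<open>t\<close> a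
  coupling, where it gives the second derivative of the free energy, and with \<open>t\<close> a
  single Gaussian, where it gives the derivative in the integration by parts.\<close>

lemma DERIV_gav:
  assumes "finite S" "S \<noteq> {}"
  shows "((\<lambda>t. gav S (\<lambda>\<sigma>. H \<sigma> + t * a \<sigma>) b) has_real_derivative
           (gav S (\<lambda>\<sigma>. H \<sigma> + t * a \<sigma>) (\<lambda>\<sigma>. b \<sigma> * a \<sigma>)
            - gav S (\<lambda>\<sigma>. H \<sigma> + t * a \<sigma>) b * gav S (\<lambda>\<sigma>. H \<sigma> + t * a \<sigma>) a)) (at t within U)"
proof -
  let ?e = "\<lambda>t \<sigma>. exp (H \<sigma> + t * a \<sigma>)"
  have Z: "(\<Sum>\<sigma>\<in>S. ?e t \<sigma>) > 0" by (rule sum_exp_pos[OF assms])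
  have *: "((\<lambda>t. (\<Sum>\<sigma>\<in>S. ?e t \<sigma> * b \<sigma>) / (\<Sum>\<sigma>\<in>S. ?e t \<sigma>)) has_real_derivative
     ((\<Sum>\<sigma>\<in>S. ?e t \<sigma> * a \<sigma> * b \<sigma>) * (\<Sum>\<sigma>\<in>S. ?e t \<sigma>) - (\<Sum>\<sigma>\<in>S. ?e t \<sigma> * b \<sigma>) * (\<Sum>\<sigma>\<in>S. ?e t \<sigma> * a \<sigma>))
      / ((\<Sum>\<sigma>\<in>S. ?e t \<sigma>) * (\<Sum>\<sigma>\<in>S. ?e t \<sigma>))) (at t within U)"
    using Z by (intro DERIV_divide DERIV_sum) (auto intro!: derivative_eq_intros)
  show ?thesis unfolding gav_def
    using Z by (intro DERIV_cong[OF *]) (simp add: field_simps mult.assoc mult.left_commute)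
qed

lemma DERIV_lse:
  assumes "finite S" "S \<noteq> {}"
  shows "((\<lambda>t. lse S (\<lambda>\<sigma>. H \<sigma> + t * a \<sigma>)) has_real_derivative
           gav S (\<lambda>\<sigma>. H \<sigma> + t * a \<sigma>) a) (at t within U)"
proof -
  have Z: "(\<Sum>\<sigma>\<in>S. exp (H \<sigma> + t * a \<sigma>)) > 0" by (rule sum_exp_pos[OF assms])
  have *: "((\<lambda>t. \<Sum>\<sigma>\<in>S. exp (H \<sigma> + t * a \<sigma>)) has_real_derivative (\<Sum>\<sigma>\<in>S. exp (H \<sigma> + t * a \<sigma>) * a \<sigma>)) (at t within U)"
    by (auto intro!: derivative_eq_intros DERIV_sum)
  show ?thesis unfolding gav_def lse_def
    using DERIV_ln_divide[OF Z] by (intro DERIV_cong[OF DERIV_chain2[OF _ *]]) auto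
qed

text \<open>Termwise \<open>exp (H \<sigma>) \<le> exp (H' \<sigma>) * exp d\<close>; take
  logarithms and exchange the roles. This one bound gives the coordinatewise Lipschitz constants,
  the integrability of the free energy and the control of the truncation error.\<close>

lemma lse_Lipschitz:
  assumes "finite S" "S \<noteq> {}" "\<And>\<sigma>. \<sigma> \<in> S \<Longrightarrow> \<bar>H \<sigma> - H' \<sigma>\<bar> \<le> d"
  shows "\<bar>lse S H - lse S H'\<bar> \<le> d"
proof -
  have *: "lse S H \<le> lse S H' + d" if "\<And>\<sigma>. \<sigma> \<in> S \<Longrightarrow> \<bar>H \<sigma> - H' \<sigma>\<bar> \<le> d" for H H' :: "'a \<Rightarrow> real"
  proof -
    have "(\<Sum>\<sigma>\<in>S. exp (H \<sigma>)) \<le> (\<Sum>\<sigma>\<in>S. exp (H' \<sigma>) * exp d)"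
      using that by (intro sum_mono) (auto simp: exp_add[symmetric] abs_le_iff algebra_simps)
    then have "(\<Sum>\<sigma>\<in>S. exp (H \<sigma>)) \<le> (\<Sum>\<sigma>\<in>S. exp (H' \<sigma>)) * exp d"
      by (simp add: sum_distrib_right)
    then have "lse S H \<le> ln ((\<Sum>\<sigma>\<in>S. exp (H' \<sigma>)) * exp d)"
      unfolding lse_def using sum_exp_pos[OF assms(1,2)] by (subst ln_le_cancel_iff) auto
    also have "\<dots> = lse S H' + d"
      unfolding lse_def using sum_exp_pos[OF assms(1,2), of H'] by (subst ln_mult_pos) auto
    finally show ?thesis .
  qed
  show ?thesis using *[of H H'] *[of H' H] assms(3) by (auto simp: abs_le_iff abs_minus_commute)
qed

lemma measurable_gav[measurable (raw)]:
  assumes "\<And>\<sigma>. \<sigma> \<in> S \<Longrightarrow> (\<lambda>x. H x \<sigma>) \<in> borel_measurable M" "\<And>\<sigma>. \<sigma> \<in> S \<Longrightarrow> (\<lambda>x. b x \<sigma>) \<in> borel_measurable M"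
  shows "(\<lambda>x. gav S (H x) (b x)) \<in> borel_measurable M"
  unfolding gav_def using assms by measurable

lemma measurable_lse[measurable (raw)]:
  assumes "\<And>\<sigma>. \<sigma> \<in> S \<Longrightarrow> (\<lambda>x. H x \<sigma>) \<in> borel_measurable M"
  shows "(\<lambda>x. lse S (H x)) \<in> borel_measurable M"
  unfolding lse_def using assms by measurable

section \<open>Gaussian product measures\<close>

text \<open>Both laws are compared on cylinders, where the product measure factorises. The index set
  may be infinite, as the disorder and the couplings require.\<close>

lemma distr_PiM_resample:
  assumes M: "\<And>i. i \<in> I \<Longrightarrow> prob_space (M i)" and k: "k \<in> I"
  shows "distr (PiM I M \<Otimes>\<^sub>M M k) (PiM I M) (\<lambda>(g, t). g(k := t)) = PiM I M"
proof (rule measure_eqI_PiM_infinite[symmetric, OF refl])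
  interpret P: prob_space "PiM I M" using M by (rule prob_space_PiM)
  interpret K: prob_space "M k" using M k by auto
  have ins: "insert k I = I" using k by auto
  have meas[measurable]: "(\<lambda>(g, t). g(k := t)) \<in> measurable (PiM I M \<Otimes>\<^sub>M M k) (PiM I M)"
    using measurable_add_dim[of k I M] unfolding ins .
  show "finite_measure (PiM I M)" by unfold_locales
  fix J A assume J: "finite J" "J \<subseteq> I" and A: "\<And>i. i \<in> J \<Longrightarrow> A i \<in> sets (M i)"
  \<comment> \<open>If the cylinder does not constrain coordinate \<open>k\<close>, the fresh copy
    is free and contributes a factor 1.\<close>
  let ?X = "prod_emb I M J (Pi\<^sub>E J A)" and ?A = "if k \<in> J then A k else space (M k)"
  let ?Y = "prod_emb I M (J - {k}) (Pi\<^sub>E (J - {k}) A)"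
  have "PiM I M ?X = (\<Prod>i\<in>J. M i (A i))"
    using M J A by (intro emeasure_PiM_emb) auto
  also have "\<dots> = (\<Prod>i\<in>J-{k}. M i (A i)) * M k ?A"
    using prod.insert_remove[of J "\<lambda>i. M i (A i)" k] J K.emeasure_space_1
    by (cases "k \<in> J") (auto simp: insert_absorb mult.commute)
  also have "(\<Prod>i\<in>J-{k}. M i (A i)) = PiM I M ?Y"
    using M J A by (intro emeasure_PiM_emb[symmetric]) auto
  also have "PiM I M ?Y * M k ?A = (PiM I M \<Otimes>\<^sub>M M k) (?Y \<times> ?A)"
    using J A by (intro K.emeasure_pair_measure_Times[symmetric] sets_PiM_I) auto
  also have "?Y \<times> ?A = (\<lambda>(g, t). g(k := t)) -` ?X \<inter> space (PiM I M \<Otimes>\<^sub>M M k)"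
  proof -
    have "g(k := t) \<in> ?X \<longleftrightarrow> g \<in> ?Y \<and> t \<in> ?A"
      if "g \<in> space (PiM I M)" "t \<in> space (M k)" for g t
      using that k J by (auto simp: prod_emb_iff space_PiM PiE_iff extensional_def fun_upd_def)
    moreover have "?Y \<subseteq> space (PiM I M)"
      by (auto simp: prod_emb_def space_PiM)
    moreover have "?A \<subseteq> space (M k)"
      using A[of k, THEN sets.sets_into_space] by auto
    ultimately have "(g, t) \<in> ?Y \<times> ?A \<longleftrightarrow> (g, t) \<in> (\<lambda>(g, t). g(k := t)) -` ?X \<inter> space (PiM I M \<Otimes>\<^sub>M M k)" for g t
      unfolding space_pair_measure mem_Times_iff vimage_def Int_iff mem_Collect_eq prod.case fst_conv snd_conv by blast
    then show ?thesis by (intro set_eqI) (metis surj_pair)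
  qed
  finally show "PiM I M ?X = distr (PiM I M \<Otimes>\<^sub>M M k) (PiM I M) (\<lambda>(g, t). g(k := t)) ?X"
    using J A by (simp add: emeasure_distr)
qed simp

text \<open>Fubini for one coordinate of an arbitrary product. The coordinate will be a Gaussian,
  for the variance bound and the integration by parts, or the coupling
  \<open>x (w, p)\<close>.\<close>

lemma PiM_resample:
  fixes \<Phi> :: "('i \<Rightarrow> 'a) \<Rightarrow> real"
  assumes M: "\<And>i. i \<in> I \<Longrightarrow> prob_space (M i)" and k: "k \<in> I" and \<Phi>: "integrable (PiM I M) \<Phi>"
  shows "integrable (PiM I M) (\<lambda>g. \<integral>t. \<Phi> (g(k := t)) \<partial>M k)"
    and "(\<integral>g. \<Phi> g \<partial>PiM I M) = (\<integral>g. \<integral>t. \<Phi> (g(k := t)) \<partial>M k \<partial>PiM I M)"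
    and "AE g in PiM I M. integrable (M k) (\<lambda>t. \<Phi> (g(k := t)))"
proof -
  interpret P: prob_space "PiM I M" using M by (rule prob_space_PiM)
  interpret K: prob_space "M k" using M k by auto
  interpret PK: pair_prob_space "PiM I M" "M k" ..
  have ins: "insert k I = I" using k by auto
  have meas[measurable]: "(\<lambda>(g, t). g(k := t)) \<in> measurable (PiM I M \<Otimes>\<^sub>M M k) (PiM I M)"
    using measurable_add_dim[of k I M] unfolding ins .
  have D: "distr (PiM I M \<Otimes>\<^sub>M M k) (PiM I M) (\<lambda>(g, t). g(k := t)) = PiM I M"
    using M k by (rule distr_PiM_resample)
  have 1: "integrable (PiM I M \<Otimes>\<^sub>M M k) (\<lambda>z. \<Phi> ((\<lambda>(g, t). g(k := t)) z))"
    using \<Phi> by (subst integrable_distr_eq[symmetric, where N="PiM I M"]) (auto simp: D)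
  have 2: "integrable (PiM I M \<Otimes>\<^sub>M M k) (case_prod (\<lambda>g t. \<Phi> (g(k := t))))"
    using 1 by (simp add: case_prod_unfold)
  show "integrable (PiM I M) (\<lambda>g. \<integral>t. \<Phi> (g(k := t)) \<partial>M k)"
    using PK.integrable_fst[OF 2] .
  show "AE g in PiM I M. integrable (M k) (\<lambda>t. \<Phi> (g(k := t)))"
    using PK.AE_integrable_fst[OF 2] .
  have "(\<integral>g. \<Phi> g \<partial>PiM I M) = (\<integral>g. \<Phi> g \<partial>distr (PiM I M \<Otimes>\<^sub>M M k) (PiM I M) (\<lambda>(g, t). g(k := t)))"
    by (simp add: D)
  also have "\<dots> = (\<integral>z. \<Phi> ((\<lambda>(g, t). g(k := t)) z) \<partial>(PiM I M \<Otimes>\<^sub>M M k))"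
    using \<Phi> by (subst integral_distr) auto
  also have "\<dots> = (\<integral>g. \<integral>t. \<Phi> (g(k := t)) \<partial>M k \<partial>PiM I M)"
    using PK.integral_fst[OF 2] by (simp add: case_prod_unfold)
  finally show "(\<integral>g. \<Phi> g \<partial>PiM I M) = (\<integral>g. \<integral>t. \<Phi> (g(k := t)) \<partial>M k \<partial>PiM I M)" .
qed

section \<open>The one-dimensional Gaussian law\<close>

abbreviation gauss :: "real measure" where
  "gauss \<equiv> density lborel std_normal_density"

lemma prob_space_gauss: "prob_space gauss"
  by (rule prob_space_normal_density) simp

lemma integrable_gauss_iff:
  fixes q :: "real \<Rightarrow> real"
  assumes [measurable]: "q \<in> borel_measurable borel"
  shows "integrable gauss q \<longleftrightarrow> integrable lborel (\<lambda>t. std_normal_density t * q t)"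
  by (subst integrable_density) (auto simp: normal_density_nonneg)

lemma integral_gauss_eq:
  fixes q :: "real \<Rightarrow> real"
  assumes [measurable]: "q \<in> borel_measurable borel"
  shows "(\<integral>t. q t \<partial>gauss) = (\<integral>t. std_normal_density t * q t \<partial>lborel)"
  by (subst integral_density) (auto simp: normal_density_nonneg)

lemma integrable_gauss_power: "integrable gauss (\<lambda>t. t ^ k)"
  using integrable_std_normal_moment[of k] by (subst integrable_gauss_iff) auto

lemma integrable_gauss_id [simp]: "integrable gauss (\<lambda>t. t)"
  using integrable_gauss_power[of 1] by simp

lemma integral_gauss_id [simp]: "(\<integral>t. t \<partial>gauss) = 0"
  using integral_std_normal_moment_odd[of 0] by (simp add: integral_gauss_eq)

lemma integral_gauss_square [simp]: "(\<integral>t. t\<^sup>2 \<partial>gauss) = 1"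
  using integral_std_normal_moment_even[of 1] by (simp add: integral_gauss_eq)

lemma std_normal_density_tendsto_0: "(std_normal_density \<longlongrightarrow> 0) at_top" "(std_normal_density \<longlongrightarrow> 0) at_bot"
proof -
  have sq: "filterlim (\<lambda>t::real. t\<^sup>2) at_top at_top"
    by (intro filterlim_pow_at_top filterlim_ident) auto
  have "((\<lambda>t::real. exp (- (t\<^sup>2 / 2))) \<longlongrightarrow> 0) at_top"
    by (rule filterlim_compose[OF exp_at_bot], rule filterlim_compose[OF filterlim_uminus_at_bot_at_top])
       (use filterlim_tendsto_pos_mult_at_top[OF tendsto_const[of "1/2"] _ sq] in simp)
  then have *: "((\<lambda>t::real. 1 / sqrt (2 * pi) * exp (- (t\<^sup>2 / 2))) \<longlongrightarrow> 0) at_top"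
    by (rule tendsto_mult_right_zero)
  then show "(std_normal_density \<longlongrightarrow> 0) at_top"
    by (simp add: std_normal_density_def[abs_def])
  show "(std_normal_density \<longlongrightarrow> 0) at_bot"
    using * by (subst filterlim_at_bot_mirror) (simp add: std_normal_density_def)
qed

text \<open>The density has derivative \<open>- t\<close> times itself, so the integrand
  \<open>?f\<close> below is the derivative of density times \<open>q\<close>. Its integral over the
  line is a boundary term, which vanishes because \<open>q\<close> is bounded.\<close>

lemma gauss_integration_by_parts:
  fixes q q' :: "real \<Rightarrow> real"
  assumes q: "\<And>t. (q has_real_derivative q' t) (at t)" and cont: "\<And>t. isCont q' t"
    and bd: "\<And>t. \<bar>q t\<bar> \<le> C" "\<And>t. \<bar>q' t\<bar> \<le> C'"
  shows "(\<integral>t. t * q t \<partial>gauss) = (\<integral>t. q' t \<partial>gauss)"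
proof -
  have [measurable]: "q \<in> borel_measurable borel"
    by (intro borel_measurable_continuous_onI DERIV_continuous_on[of UNIV q q'] q)
  have [measurable]: "q' \<in> borel_measurable borel"
    using cont by (intro borel_measurable_continuous_onI) (simp add: continuous_at_imp_continuous_on)
  interpret G: prob_space gauss by (rule prob_space_gauss)
  have i1: "integrable gauss q'"
    by (rule G.integrable_const_bound[where B=C']) (auto simp: bd)
  have i2: "integrable gauss (\<lambda>t. t * q t)"
  proof (rule Bochner_Integration.integrable_bound)
    show "integrable gauss (\<lambda>t. C * t)" by simp
    show "AE t in gauss. norm (t * q t) \<le> norm (C * t)"
      using bd(1) by (intro AE_I2) (auto simp: abs_mult mult.commute intro!: mult_left_mono intro: order_trans[OF bd(1) abs_ge_self])
  qed auto
  let ?d = std_normal_density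
  let ?f = "\<lambda>t. ?d t * q' t - ?d t * (t * q t)"
  have int: "integrable lborel ?f"
    using i1 i2 by (auto simp: integrable_gauss_iff)
  have "LBINT t=-\<infinity>..\<infinity>. ?f t = 0 - 0"
  proof (rule interval_integral_FTC_integrable[where F="\<lambda>t. ?d t * q t"])
    fix t :: real
    have "((\<lambda>t. ?d t * q t) has_real_derivative ?f t) (at t)"
      unfolding std_normal_density_def
      by (rule derivative_eq_intros q refl | simp add: field_simps)+
    then show "((\<lambda>t. ?d t * q t) has_vector_derivative ?f t) (at t)"
      by (simp add: has_real_derivative_iff_has_vector_derivative)
    have "isCont q t" using q DERIV_isCont by blast
    then show "isCont ?f t"
      unfolding std_normal_density_def using cont[of t] by (intro continuous_intros) auto
  next
    show "set_integrable lborel (einterval (- \<infinity>) \<infinity>) ?f"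
      using int by (simp add: set_integrable_def)
  next
    have *: "((\<lambda>t. ?d t * q t) \<longlongrightarrow> 0) F" if "(?d \<longlongrightarrow> 0) F" for F
    proof (rule Lim_null_comparison)
      show "((\<lambda>t. ?d t * C) \<longlongrightarrow> 0) F" using that by (rule tendsto_mult_left_zero)
      show "\<forall>\<^sub>F t in F. norm (?d t * q t) \<le> ?d t * C"
        by (intro always_eventually allI) (auto simp: abs_mult normal_density_nonneg intro!: mult_left_mono bd)
    qed
    show "(((\<lambda>t. ?d t * q t) \<circ> real_of_ereal) \<longlongrightarrow> 0) (at_right (- \<infinity>))"
      unfolding ereal_tendsto_simps1 by (intro * std_normal_density_tendsto_0)
    show "(((\<lambda>t. ?d t * q t) \<circ> real_of_ereal) \<longlongrightarrow> 0) (at_left \<infinity>)"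
      unfolding ereal_tendsto_simps1 by (intro * std_normal_density_tendsto_0)
  qed simp
  then have "(\<integral>t. ?f t \<partial>lborel) = 0"
    by (simp add: interval_lebesgue_integral_def set_lebesgue_integral_def)
  then show ?thesis
    using i1 i2 by (simp add: integral_gauss_eq integrable_gauss_iff)
qed

lemma PiM_gauss_coordinate:
  assumes "i \<in> I"
  shows "integrable (PiM I (\<lambda>_. gauss)) (\<lambda>g. g i ^ k)"
    and "(\<integral>g. g i \<partial>PiM I (\<lambda>_. gauss)) = 0"
proof -
  have D: "distr (PiM I (\<lambda>_. gauss)) gauss (\<lambda>g. g i) = gauss"
    using assms by (intro distr_PiM_component prob_space_gauss)
  have m [measurable]: "(\<lambda>g. g i) \<in> measurable (PiM I (\<lambda>_. gauss)) gauss"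
    using assms by simp
  show "integrable (PiM I (\<lambda>_. gauss)) (\<lambda>g. g i ^ k)"
    using integrable_distr[OF m, of "\<lambda>t. t ^ k"]
    by (simp add: D integrable_gauss_power)
  show "(\<integral>g. g i \<partial>PiM I (\<lambda>_. gauss)) = 0"
    using integral_distr[OF m, of "\<lambda>t. t"] by (simp add: D)
qed

lemma measurable_fun_upd_gauss [measurable]:
  assumes "i \<in> I"
  shows "(\<lambda>(g, t). g(i := t)) \<in> measurable (PiM I (\<lambda>_. gauss) \<Otimes>\<^sub>M gauss) (PiM I (\<lambda>_. gauss))"
  using measurable_add_dim[of i I "\<lambda>_. gauss"] assms by (simp add: insert_absorb)

text \<open>Induction on \<open>J\<close>: averaging over one coordinate \<open>i\<close> keeps the Lipschitz bounds in the others and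
  costs at most \<open>(a i)\<^sup>2\<close> of variance, since \<open>F\<close> is within \<open>a i * \<bar>t\<bar>\<close> of its value at coordinate \<open>0\<close>.\<close>

lemma gauss_variance_le:
  fixes F :: "('i \<Rightarrow> real) \<Rightarrow> real" and I :: "'i set"
  defines "P \<equiv> PiM I (\<lambda>_. gauss)"
  assumes "finite J" "J \<subseteq> I" "F \<in> borel_measurable P"
    and "\<And>g h. g \<in> space P \<Longrightarrow> h \<in> space P \<Longrightarrow> (\<And>i. i \<in> J \<Longrightarrow> g i = h i) \<Longrightarrow> F g = F h"
    and "\<And>g i t. i \<in> J \<Longrightarrow> g \<in> space P \<Longrightarrow> \<bar>F (g(i := t)) - F g\<bar> \<le> a i * \<bar>t - g i\<bar>"
  shows "integrable P F \<and> integrable P (\<lambda>g. (F g)\<^sup>2) \<and> (\<integral>g. (F g - (\<integral>h. F h \<partial>P))\<^sup>2 \<partial>P) \<le> (\<Sum>i\<in>J. (a i)\<^sup>2)"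
  using assms(2-)
proof (induction J arbitrary: F rule: finite_induct)
  interpret P: prob_space P unfolding P_def by (intro prob_space_PiM prob_space_gauss)
  case empty
  obtain g0 where g0: "g0 \<in> space P" using P.not_empty by blast
  have F: "F g = F g0" if "g \<in> space P" for g using empty(3)[OF that g0] by simp
  have "integrable P F \<longleftrightarrow> integrable P (\<lambda>_. F g0)" "(\<integral>h. F h \<partial>P) = (\<integral>h. F g0 \<partial>P)"
    "integrable P (\<lambda>g. (F g)\<^sup>2) \<longleftrightarrow> integrable P (\<lambda>_. (F g0)\<^sup>2)"
    by (rule Bochner_Integration.integrable_cong Bochner_Integration.integral_cong, simp, simp only: F)+
  moreover have "(\<integral>g. (F g - F g0)\<^sup>2 \<partial>P) = (\<integral>g. 0 \<partial>P)"
    using F by (intro Bochner_Integration.integral_cong) auto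
  ultimately show ?case by (simp add: P.prob_space)
next
  interpret P: prob_space P unfolding P_def by (intro prob_space_PiM prob_space_gauss)
  interpret G: prob_space gauss by (rule prob_space_gauss)
  case (insert i J)
  note [measurable] = insert.prems(2)
  have iI: "i \<in> I" and JI: "J \<subseteq> I" using insert.prems(1) by auto
  have upd: "g(k := t) \<in> space P" if "g \<in> space P" "k \<in> I" for g k t
    using that by (auto simp: P_def space_PiM PiE_iff extensional_def)
  have updm [measurable]: "(\<lambda>(g, t). g(i := t)) \<in> measurable (P \<Otimes>\<^sub>M gauss) P"
    unfolding P_def by (rule measurable_fun_upd_gauss[OF iI])
  note lip = insert.prems(4) and dep = insert.prems(3)
  have Ft: "(\<lambda>t. F (g(i := t))) \<in> borel_measurable gauss" if "g \<in> space P" for g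
    using measurable_compose[OF measurable_Pair1'[OF that] measurable_compose[OF updm insert.prems(2)]] by (simp add: fun_upd_def)
  have G1: "measure gauss UNIV = 1" using G.prob_space by simp
  obtain g0 where "g0 \<in> space P" using P.not_empty by blast
  \<comment> \<open>A unit step in coordinate \<open>i\<close> makes the Lipschitz bound itself
    force the sign.\<close>
  then have ai: "a i \<ge> 0" using lip[of i g0 "g0 i + 1"] by simp
  have int2: "integrable gauss (\<lambda>t. (F (g(i := t)) - F g)\<^sup>2)" if "g \<in> space P" for g
  proof (rule Bochner_Integration.integrable_bound)
    show "integrable gauss (\<lambda>t. (a i * (t - g i))\<^sup>2)"
      using integrable_gauss_power[of 2] by (auto simp: power_mult_distrib power2_diff)
    show "AE t in gauss. norm ((F (g(i := t)) - F g)\<^sup>2) \<le> norm ((a i * (t - g i))\<^sup>2)"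
    proof (intro AE_I2)
      fix t
      have "\<bar>F (g(i := t)) - F g\<bar>\<^sup>2 \<le> (a i * \<bar>t - g i\<bar>)\<^sup>2"
        by (intro power_mono lip that) simp_all
      then show "norm ((F (g(i := t)) - F g)\<^sup>2) \<le> norm ((a i * (t - g i))\<^sup>2)"
        by (simp add: power_mult_distrib)
    qed
  qed (use Ft[OF that] in auto)
  have int1: "integrable gauss (\<lambda>t. F (g(i := t)) - F g)" if "g \<in> space P" for g
    by (rule G.square_integrable_imp_integrable[OF _ int2[OF that]]) (use Ft[OF that] in auto)
  have int: "integrable gauss (\<lambda>t. F (g(i := t)))" if "g \<in> space P" for g
    using Bochner_Integration.integrable_add[OF int1[OF that], of "\<lambda>_. F g"] by simp
  define Fb where "Fb g = (\<integral>t. F (g(i := t)) \<partial>gauss)" for g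
  have Fbm: "Fb \<in> borel_measurable P"
    unfolding Fb_def by measurable
  note [measurable] = Fbm
  have Fbd: "Fb g = Fb h" if "g \<in> space P" "h \<in> space P" "\<And>k. k \<in> J \<Longrightarrow> g k = h k" for g h
  proof -
    have "F (g(i := t)) = F (h(i := t))" for t
      using that iI by (intro dep upd) auto
    then show ?thesis by (simp add: Fb_def)
  qed
  have Fbl: "\<bar>Fb (g(k := s)) - Fb g\<bar> \<le> a k * \<bar>s - g k\<bar>" if "k \<in> J" "g \<in> space P" for g k s
  proof -
    have ki: "k \<noteq> i" "k \<in> I" using that insert.hyps JI by auto
    have gs: "g(k := s) \<in> space P" using that ki upd by auto
    have "Fb (g(k := s)) - Fb g = (\<integral>t. F ((g(k := s))(i := t)) - F (g(i := t)) \<partial>gauss)"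
      unfolding Fb_def using int[OF gs] int[OF that(2)] by simp
    also have "\<bar>\<dots>\<bar> \<le> (\<integral>t. \<bar>F ((g(k := s))(i := t)) - F (g(i := t))\<bar> \<partial>gauss)"
      using integral_abs_bound by blast
    also have "\<dots> \<le> (\<integral>t. a k * \<bar>s - g k\<bar> \<partial>gauss)"
    proof (rule integral_mono)
      fix t
      have "(g(k := s))(i := t) = (g(i := t))(k := s)" using ki by (simp add: fun_upd_twist)
      moreover have "\<bar>F ((g(i := t))(k := s)) - F (g(i := t))\<bar> \<le> a k * \<bar>s - (g(i := t)) k\<bar>"
        using that iI by (intro lip upd) auto
      ultimately show "\<bar>F ((g(k := s))(i := t)) - F (g(i := t))\<bar> \<le> a k * \<bar>s - g k\<bar>"
        using ki by simp
    qed (use int[OF gs] int[OF that(2)] in auto)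
    finally show ?thesis by (simp add: G1)
  qed
  have "integrable P Fb \<and> integrable P (\<lambda>g. (Fb g)\<^sup>2) \<and>
    (\<integral>g. (Fb g - (\<integral>h. Fb h \<partial>P))\<^sup>2 \<partial>P) \<le> (\<Sum>i\<in>J. (a i)\<^sup>2)"
  proof (rule insert.IH[OF JI Fbm])
    show "Fb g = Fb h" if "g \<in> space P" "h \<in> space P" "\<And>k. k \<in> J \<Longrightarrow> g k = h k" for g h
      using that by (rule Fbd)
    show "\<bar>Fb (g(k := s)) - Fb g\<bar> \<le> a k * \<bar>s - g k\<bar>" if "k \<in> J" "g \<in> space P" for g k s
      using that by (rule Fbl)
  qed
  note IH = this[THEN conjunct1] this[THEN conjunct2, THEN conjunct1] this[THEN conjunct2, THEN conjunct2]
  define m1 where "m1 = (\<integral>t. \<bar>t\<bar> \<partial>gauss)"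
  \<comment> \<open>Integrability of \<open>F\<close> is not assumed: \<open>Fb\<close> is square
    integrable by induction, and the difference is dominated by a function of
    \<open>\<bar>g i\<bar>\<close> with finite second moment.\<close>
  have diff: "\<bar>F g - Fb g\<bar> \<le> a i * (m1 + \<bar>g i\<bar>)" if "g \<in> space P" for g
  proof -
    have "F g - Fb g = - (\<integral>t. F (g(i := t)) - F g \<partial>gauss)"
      unfolding Fb_def by (subst Bochner_Integration.integral_diff[OF int[OF that]]) (simp_all add: G1)
    also have "\<bar>\<dots>\<bar> \<le> (\<integral>t. \<bar>F (g(i := t)) - F g\<bar> \<partial>gauss)"
      unfolding abs_minus_cancel by (rule integral_abs_bound)
    also have "\<dots> \<le> (\<integral>t. a i * (\<bar>t\<bar> + \<bar>g i\<bar>) \<partial>gauss)"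
    proof (rule integral_mono)
      fix t
      have "\<bar>F (g(i := t)) - F g\<bar> \<le> a i * \<bar>t - g i\<bar>" by (intro lip that) simp
      also have "\<dots> \<le> a i * (\<bar>t\<bar> + \<bar>g i\<bar>)" using ai by (intro mult_left_mono) auto
      finally show "\<bar>F (g(i := t)) - F g\<bar> \<le> a i * (\<bar>t\<bar> + \<bar>g i\<bar>)" .
    qed (use int1[OF that] in auto)
    also have "\<dots> = a i * (m1 + \<bar>g i\<bar>)"
      by (simp add: m1_def G1)
    finally show ?thesis .
  qed
  have gi2: "integrable P (\<lambda>g. (g i)\<^sup>2)"
    unfolding P_def by (rule PiM_gauss_coordinate[OF iI])
  have F2: "integrable P (\<lambda>g. (F g)\<^sup>2)"
  proof (rule Bochner_Integration.integrable_bound)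
    show "integrable P (\<lambda>g. 2 * (Fb g)\<^sup>2 + 4 * (a i)\<^sup>2 * (m1\<^sup>2 + (g i)\<^sup>2))"
      using IH(2) gi2 by auto
    show "AE g in P. norm ((F g)\<^sup>2) \<le> norm (2 * (Fb g)\<^sup>2 + 4 * (a i)\<^sup>2 * (m1\<^sup>2 + (g i)\<^sup>2))"
    proof (intro AE_I2)
      fix g assume g: "g \<in> space P"
      have "(F g - Fb g)\<^sup>2 \<le> (a i * (m1 + \<bar>g i\<bar>))\<^sup>2"
        using power_mono[OF diff[OF g], of 2] by simp
      moreover have "(m1 + \<bar>g i\<bar>)\<^sup>2 \<le> 2 * (m1\<^sup>2 + (g i)\<^sup>2)"
        using sum_squares_bound[of m1 "\<bar>g i\<bar>"] by (simp add: power2_sum)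
      then have "(a i * (m1 + \<bar>g i\<bar>))\<^sup>2 \<le> (a i)\<^sup>2 * (2 * (m1\<^sup>2 + (g i)\<^sup>2))"
        unfolding power_mult_distrib by (intro mult_left_mono) auto
      moreover have "(F g)\<^sup>2 \<le> 2 * (Fb g)\<^sup>2 + 2 * (F g - Fb g)\<^sup>2"
        using zero_le_power2[of "2 * Fb g - F g"] by (simp add: power2_eq_square algebra_simps)
      ultimately have "(F g)\<^sup>2 \<le> 2 * (Fb g)\<^sup>2 + 4 * (a i)\<^sup>2 * (m1\<^sup>2 + (g i)\<^sup>2)"
        by linarith
      then show "norm ((F g)\<^sup>2) \<le> norm (2 * (Fb g)\<^sup>2 + 4 * (a i)\<^sup>2 * (m1\<^sup>2 + (g i)\<^sup>2))"
        by simp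
    qed
  qed auto
  have F1: "integrable P F"
    by (rule P.square_integrable_imp_integrable[OF _ F2]) auto
  define m where "m = (\<integral>g. F g \<partial>P)"
  have mb: "m = (\<integral>g. Fb g \<partial>P)"
    unfolding m_def Fb_def P_def
    by (rule PiM_resample(2)) (use iI F1 prob_space_gauss in \<open>auto simp: P_def\<close>)
  have c: "integrable P (\<lambda>g. (F g - m)\<^sup>2)"
    using F1 F2 by (simp add: power2_diff)
  have inner: "(\<integral>t. (F (g(i := t)) - m)\<^sup>2 \<partial>gauss) \<le> (a i)\<^sup>2 + (Fb g - m)\<^sup>2" if g: "g \<in> space P" for g
  proof -
    let ?g = "g(i := 0)"
    define c where "c = F ?g"
    define r where "r t = F (?g(i := t)) - c" for t
    have g0: "?g \<in> space P" using upd g iI by auto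
    have r1: "integrable gauss r" and r2: "integrable gauss (\<lambda>t. (r t)\<^sup>2)"
      unfolding r_def c_def by (rule int1[OF g0] int2[OF g0])+
    have e: "F (g(i := t)) = r t + c" for t by (simp add: r_def)
    have "(\<integral>t. (r t)\<^sup>2 \<partial>gauss) \<le> (\<integral>t. (a i)\<^sup>2 * t\<^sup>2 \<partial>gauss)"
    proof (rule integral_mono)
      fix t
      have "\<bar>r t\<bar>\<^sup>2 \<le> (a i * \<bar>t\<bar>)\<^sup>2"
        unfolding r_def c_def by (intro power_mono order_trans[OF lip] g0) simp_all
      then show "(r t)\<^sup>2 \<le> (a i)\<^sup>2 * t\<^sup>2" by (simp add: power_mult_distrib)
    qed (use r2 integrable_gauss_power[of 2] in auto)
    then have rr: "(\<integral>t. (r t)\<^sup>2 \<partial>gauss) \<le> (a i)\<^sup>2" by simp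
    have "(\<integral>t. (F (g(i := t)) - m)\<^sup>2 \<partial>gauss) = (\<integral>t. (r t)\<^sup>2 + 2 * (c - m) * r t + (c - m)\<^sup>2 \<partial>gauss)"
      unfolding e by (simp add: power2_eq_square algebra_simps)
    also have "\<dots> = (\<integral>t. (r t)\<^sup>2 \<partial>gauss) + 2 * (c - m) * (\<integral>t. r t \<partial>gauss) + (c - m)\<^sup>2"
      using r1 r2 by (simp add: G1)
    \<comment> \<open>Completing the square requires the squared mean of \<open>r\<close>; adding it
      only increases the right-hand side.\<close>
    also have "\<dots> \<le> (a i)\<^sup>2 + ((\<integral>t. r t \<partial>gauss) + c - m)\<^sup>2"
    proof -
      have "((\<integral>t. r t \<partial>gauss) + c - m)\<^sup>2 = (\<integral>t. r t \<partial>gauss)\<^sup>2 + 2 * (c - m) * (\<integral>t. r t \<partial>gauss) + (c - m)\<^sup>2"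
        by (simp add: power2_eq_square algebra_simps)
      then show ?thesis using rr zero_le_power2[of "\<integral>t. r t \<partial>gauss"] by linarith
    qed
    also have "(\<integral>t. r t \<partial>gauss) + c = Fb g"
      unfolding Fb_def e using r1 by (simp add: G1)
    finally show ?thesis .
  qed
  have "(\<integral>g. (F g - m)\<^sup>2 \<partial>P) = (\<integral>g. \<integral>t. (F (g(i := t)) - m)\<^sup>2 \<partial>gauss \<partial>P)"
    unfolding P_def by (rule PiM_resample(2)) (use iI c prob_space_gauss in \<open>auto simp: P_def\<close>)
  also have "\<dots> \<le> (\<integral>g. (a i)\<^sup>2 + (Fb g - m)\<^sup>2 \<partial>P)"
  proof (rule integral_mono)
    show "integrable P (\<lambda>g. \<integral>t. (F (g(i := t)) - m)\<^sup>2 \<partial>gauss)"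
      unfolding P_def by (rule PiM_resample(1)) (use iI c prob_space_gauss in \<open>auto simp: P_def\<close>)
    show "integrable P (\<lambda>g. (a i)\<^sup>2 + (Fb g - m)\<^sup>2)"
      using IH(1,2) by (simp add: power2_diff)
  qed (rule inner)
  also have "\<dots> = (a i)\<^sup>2 + (\<integral>g. (Fb g - m)\<^sup>2 \<partial>P)"
    using IH(1,2) by (subst Bochner_Integration.integral_add) (simp_all add: power2_diff P.prob_space)
  also have "\<dots> \<le> (\<Sum>k\<in>insert i J. (a k)\<^sup>2)"
    using IH(3) insert.hyps by (simp add: mb)
  finally show ?case using F1 F2 by (simp add: m_def)
qed

section \<open>Convexity in the coupling\<close>

abbreviation unif12 :: "real measure" where
  "unif12 \<equiv> uniform_measure lborel {1..2}"

lemma prob_space_unif12: "prob_space unif12"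
  by (rule prob_space_uniform_measure) auto

lemma AE_unif12: "AE u in unif12. u \<in> {1..2}"
  by (rule AE_uniform_measureI) auto

lemma integral_unif12_FTC:
  fixes f F :: "real \<Rightarrow> real"
  assumes "\<And>u. (F has_real_derivative f u) (at u)" "\<And>u. isCont f u"
  shows "(\<integral>u. f u \<partial>unif12) = F 2 - F 1"
proof -
  have [measurable]: "f \<in> borel_measurable borel"
    using assms(2) by (intro borel_measurable_continuous_onI) (simp add: continuous_at_imp_continuous_on)
  have "unif12 = density lborel (\<lambda>u. ennreal (indicator {1..2} u))"
    unfolding uniform_measure_def
    by (intro arg_cong2[where f=density] refl ext) (auto simp: indicator_def)
  then have "(\<integral>u. f u \<partial>unif12) = (\<integral>u. indicator {1..2} u *\<^sub>R f u \<partial>lborel)"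
    by (simp only:) (subst integral_density, auto)
  also have "\<dots> = F 2 - F 1"
    using assms by (intro integral_FTC_atLeastAtMost)
      (auto intro: continuous_at_imp_continuous_on DERIV_subset[of _ _ _ UNIV]
        simp: has_real_derivative_iff_has_vector_derivative[symmetric])
  finally show ?thesis .
qed

text \<open>The dominating function \<open>C\<close> is uniform in \<open>u\<close>, so the
  integrals can be exchanged and the fundamental theorem of calculus applied for each fixed
  \<open>g\<close>. It turns averages over the coupling of the first and second derivatives of the
  free energy into boundary values.\<close>

lemma integral_unif12_expectation:
  fixes f F :: "real \<Rightarrow> 'a \<Rightarrow> real"
  assumes "prob_space M" "(\<lambda>(u, g). f u g) \<in> borel_measurable (borel \<Otimes>\<^sub>M M)"
    and F: "\<And>u g. g \<in> space M \<Longrightarrow> ((\<lambda>u. F u g) has_real_derivative f u g) (at u)"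
    and c: "\<And>u g. g \<in> space M \<Longrightarrow> isCont (\<lambda>u. f u g) u"
    and C: "integrable M C" "\<And>u g. g \<in> space M \<Longrightarrow> \<bar>f u g\<bar> \<le> C g"
  shows "integrable unif12 (\<lambda>u. \<integral>g. f u g \<partial>M)"
    and "(\<integral>u. \<integral>g. f u g \<partial>M \<partial>unif12) = (\<integral>g. F 2 g - F 1 g \<partial>M)"
proof -
  interpret M: prob_space M by fact
  interpret U: prob_space unif12 by (rule prob_space_unif12)
  interpret UM: pair_prob_space unif12 M ..
  have s: "sets (unif12 \<Otimes>\<^sub>M M) = sets (borel \<Otimes>\<^sub>M M)" by (intro sets_pair_measure_cong) auto
  have m [measurable]: "(\<lambda>(u, g). f u g) \<in> borel_measurable (unif12 \<Otimes>\<^sub>M M)"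
    using assms(2) by (simp add: measurable_cong_sets[OF s refl])
  have Cm [measurable]: "C \<in> borel_measurable M" using C(1) by auto
  have Ci: "integrable (unif12 \<Otimes>\<^sub>M M) (\<lambda>z. C (snd z))"
  proof -
    have "integrable (unif12 \<Otimes>\<^sub>M M) (\<lambda>(u, g). C g)"
      using C(1) by (intro UM.Fubini_integrable) (auto simp: case_prod_unfold)
    then show ?thesis by (simp add: case_prod_unfold)
  qed
  have int: "integrable (unif12 \<Otimes>\<^sub>M M) (\<lambda>(u, g). f u g)"
    using C(2) by (intro Bochner_Integration.integrable_bound[OF Ci] m AE_I2)
      (auto simp: space_pair_measure intro: order_trans[OF _ abs_ge_self])
  show "integrable unif12 (\<lambda>u. \<integral>g. f u g \<partial>M)"
    using UM.integrable_fst[OF int] .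
  have "(\<integral>u. \<integral>g. f u g \<partial>M \<partial>unif12) = (\<integral>g. \<integral>u. f u g \<partial>unif12 \<partial>M)"
    using UM.Fubini_integral[OF int] by simp
  also have "\<dots> = (\<integral>g. F 2 g - F 1 g \<partial>M)"
    using F c by (intro Bochner_Integration.integral_cong refl integral_unif12_FTC) auto
  finally show "(\<integral>u. \<integral>g. f u g \<partial>M \<partial>unif12) = (\<integral>g. F 2 g - F 1 g \<partial>M)" .
qed

lemma gav_variance_nonneg:
  assumes "finite S" "S \<noteq> {}"
  shows "gav S H (\<lambda>\<sigma>. b \<sigma> * b \<sigma>) - gav S H b * gav S H b = gav S H (\<lambda>\<sigma>. (b \<sigma> - gav S H b)\<^sup>2)"
    and "0 \<le> gav S H (\<lambda>\<sigma>. b \<sigma> * b \<sigma>) - gav S H b * gav S H b"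
proof -
  define d where "d = gav S H b"
  have "gav S H (\<lambda>\<sigma>. (b \<sigma> - d)\<^sup>2) = gav S H (\<lambda>\<sigma>. (b \<sigma> * b \<sigma> - (2 * d) * b \<sigma>) + d * d)"
    by (simp add: power2_eq_square algebra_simps)
  also have "\<dots> = gav S H (\<lambda>\<sigma>. b \<sigma> * b \<sigma>) - d * d"
    unfolding gav_add gav_diff gav_cmult using gav_const[OF assms] by (simp add: d_def)
  finally show *: "gav S H (\<lambda>\<sigma>. b \<sigma> * b \<sigma>) - gav S H b * gav S H b = gav S H (\<lambda>\<sigma>. (b \<sigma> - gav S H b)\<^sup>2)"
    by (simp add: d_def)
  show "0 \<le> gav S H (\<lambda>\<sigma>. b \<sigma> * b \<sigma>) - gav S H b * gav S H b"
    unfolding * by (rule gav_nonneg) simp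
qed

text \<open>The free energy \<open>P\<close> is convex in the coupling \<open>u\<close>, so a difference quotient of \<open>P\<close> traps its
  derivative \<open>D\<close>; this converts concentration of \<open>P\<close> into concentration of \<open>D\<close>. The second
  derivative of \<open>P\<close> is the thermal variance \<open>V\<close>, whose integral over \<open>u\<close> telescopes.\<close>

lemma perturbation_concentration:
  fixes A B :: "'a \<Rightarrow> 'c \<Rightarrow> real"
  assumes M: "prob_space M" and S: "finite S" "S \<noteq> {}"
    and Am: "\<And>\<sigma>. \<sigma> \<in> S \<Longrightarrow> (\<lambda>g. A g \<sigma>) \<in> borel_measurable M" and Ai: "\<And>\<sigma>. \<sigma> \<in> S \<Longrightarrow> integrable M (\<lambda>g. A g \<sigma>)"
    and Bm: "\<And>\<sigma>. \<sigma> \<in> S \<Longrightarrow> (\<lambda>g. B g \<sigma>) \<in> borel_measurable M" and B2: "\<And>\<sigma>. \<sigma> \<in> S \<Longrightarrow> integrable M (\<lambda>g. (B g \<sigma>)\<^sup>2)"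
    and v: "\<And>u. 0 \<le> u \<Longrightarrow> u \<le> 3 \<Longrightarrow>
      (\<integral>g. \<bar>lse S (\<lambda>\<sigma>. A g \<sigma> + u * B g \<sigma>) - (\<integral>g. lse S (\<lambda>\<sigma>. A g \<sigma> + u * B g \<sigma>) \<partial>M)\<bar> \<partial>M) \<le> v"
    and K: "\<And>u. 0 \<le> u \<Longrightarrow> u \<le> 3 \<Longrightarrow> \<bar>\<integral>g. gav S (\<lambda>\<sigma>. A g \<sigma> + u * B g \<sigma>) (B g) \<partial>M\<bar> \<le> K"
    and y: "0 < y" "y \<le> 1" and r: "0 < r"
  shows "\<exists>b. integrable unif12 b \<and> (\<integral>u. b u \<partial>unif12) \<le> K / r + r / 2 + 4 * y * K + 3 * v / y \<and>
    (\<forall>u\<in>{1..2}. (\<integral>g. gav S (\<lambda>\<sigma>. A g \<sigma> + u * B g \<sigma>)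
        (\<lambda>\<sigma>. \<bar>B g \<sigma> - (\<integral>g. gav S (\<lambda>\<sigma>. A g \<sigma> + u * B g \<sigma>) (B g) \<partial>M)\<bar>) \<partial>M) \<le> b u)"
proof -
  interpret M: prob_space M by (rule M)
  note [measurable] = Am Bm
  have Bi: "integrable M (\<lambda>g. B g \<sigma>)" if "\<sigma> \<in> S" for \<sigma>
    by (rule M.square_integrable_imp_integrable[OF Bm[OF that] B2[OF that]])
  define P where "P u g = lse S (\<lambda>\<sigma>. A g \<sigma> + u * B g \<sigma>)" for u g
  define D where "D u g = gav S (\<lambda>\<sigma>. A g \<sigma> + u * B g \<sigma>) (B g)" for u g
  define V where "V u g = gav S (\<lambda>\<sigma>. A g \<sigma> + u * B g \<sigma>) (\<lambda>\<sigma>. B g \<sigma> * B g \<sigma>) - D u g * D u g" for u g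
  define \<psi> where "\<psi> u = (\<integral>g. P u g \<partial>M)" for u
  define m where "m u = (\<integral>g. D u g \<partial>M)" for u
  define \<delta> where "\<delta> u g = P u g - \<psi> u" for u g
  have PD: "((\<lambda>u. P u g) has_real_derivative D u g) (at u within X)" for u g X
    unfolding P_def D_def by (rule DERIV_lse[OF S])
  have DV: "((\<lambda>u. D u g) has_real_derivative V u g) (at u within X)" for u g X
    unfolding D_def V_def by (rule DERIV_gav[OF S])
  have V0: "0 \<le> V u g" for u g
    unfolding V_def D_def by (rule gav_variance_nonneg[OF S])
  have Dcont: "isCont (\<lambda>u. D u g) u" for u g using DV DERIV_isCont by blast
  have Vcont: "isCont (\<lambda>u. V u g) u" for u g
    unfolding V_def using Dcont[of u g] DERIV_isCont[OF DERIV_gav[OF S]]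
    by (intro continuous_intros)
  have Dmono: "D u g \<le> D u' g" if "u \<le> u'" for u u' g
    using that DV V0 by (intro DERIV_nonneg_imp_nondecreasing[of u u' "\<lambda>u. D u g"]) blast+
  \<comment> \<open>Convexity: by the mean value theorem the increment over the step is
    \<open>h\<close> times some \<open>D z g\<close>, and \<open>D\<close> is nondecreasing because
    its derivative is a variance.\<close>
  have secant: "D u g * h \<le> P (u + h) g - P u g \<and> P (u + h) g - P u g \<le> D (u + h) g * h" if h: "0 < h" for u h g
  proof -
    obtain z where "u < z" "z < u + h" "P (u + h) g - P u g = (u + h - u) * D z g"
      using MVT2[of u "u + h" "\<lambda>u. P u g" "\<lambda>u. D u g"] PD h by auto
    then show ?thesis using Dmono[of u z g] Dmono[of z "u + h" g] h by (auto simp: mult.commute)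
  qed
  \<comment> \<open>\<open>SB\<close> and \<open>SB2\<close> dominate \<open>D u\<close> and
    \<open>V u\<close> simultaneously for all \<open>u\<close>, as the exchange of integrals
    demands.\<close>
  define SB where "SB g = (\<Sum>\<sigma>\<in>S. \<bar>B g \<sigma>\<bar>)" for g
  define SB2 where "SB2 g = (\<Sum>\<sigma>\<in>S. (B g \<sigma>)\<^sup>2)" for g
  have SBi: "integrable M SB" "integrable M SB2"
    unfolding SB_def SB2_def using Bi B2 by auto
  have Db: "\<bar>D u g\<bar> \<le> SB g" for u g
    unfolding D_def SB_def by (intro order_trans[OF gav_abs_le] gav_le_sum S) simp
  have Vb: "\<bar>V u g\<bar> \<le> SB2 g" for u g
  proof -
    have "V u g \<le> gav S (\<lambda>\<sigma>. A g \<sigma> + u * B g \<sigma>) (\<lambda>\<sigma>. B g \<sigma> * B g \<sigma>)"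
      unfolding V_def by simp
    also have "\<dots> \<le> SB2 g"
      unfolding SB2_def power2_eq_square by (intro gav_le_sum S) simp
    finally show ?thesis using V0[of u g] by simp
  qed
  have Dm [measurable]: "(\<lambda>g. D u g) \<in> borel_measurable M" for u
    unfolding D_def by measurable
  have Pm [measurable]: "(\<lambda>g. P u g) \<in> borel_measurable M" for u
    unfolding P_def by measurable
  have Vm [measurable]: "(\<lambda>g. V u g) \<in> borel_measurable M" for u
    unfolding V_def by measurable
  have Di: "integrable M (D u)" for u
    by (rule Bochner_Integration.integrable_bound[OF SBi(1)])
       (auto intro!: order_trans[OF Db abs_ge_self])
  have Vi: "integrable M (V u)" for u
    by (rule Bochner_Integration.integrable_bound[OF SBi(2)])
       (auto intro!: order_trans[OF Vb abs_ge_self])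
  have Pi: "integrable M (P u)" for u
  proof (rule Bochner_Integration.integrable_bound)
    show "integrable M (\<lambda>g. \<bar>lse S (\<lambda>_. 0)\<bar> + (\<Sum>\<sigma>\<in>S. \<bar>A g \<sigma> + u * B g \<sigma>\<bar>))"
      using Ai Bi by auto
    have "\<bar>P u g\<bar> \<le> \<bar>lse S (\<lambda>_. 0)\<bar> + (\<Sum>\<sigma>\<in>S. \<bar>A g \<sigma> + u * B g \<sigma>\<bar>)" for g
    proof -
      have "\<bar>P u g - lse S (\<lambda>_. 0)\<bar> \<le> (\<Sum>\<sigma>\<in>S. \<bar>A g \<sigma> + u * B g \<sigma>\<bar>)"
        unfolding P_def using S by (intro lse_Lipschitz) (auto intro: member_le_sum[of _ S "\<lambda>\<sigma>. \<bar>A g \<sigma> + u * B g \<sigma>\<bar>"])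
      then show ?thesis by linarith
    qed
    then show "AE g in M. norm (P u g) \<le> norm (\<bar>lse S (\<lambda>_. 0)\<bar> + (\<Sum>\<sigma>\<in>S. \<bar>A g \<sigma> + u * B g \<sigma>\<bar>))"
      by (auto intro!: AE_I2 order_trans[OF _ abs_ge_self])
  qed auto
  have \<psi>: "m u * h \<le> \<psi> (u + h) - \<psi> u \<and> \<psi> (u + h) - \<psi> u \<le> m (u + h) * h" if "0 < h" for u h
  proof -
    have "(\<integral>g. D u g * h \<partial>M) \<le> (\<integral>g. P (u + h) g - P u g \<partial>M)"
      using Di Pi secant[OF that] by (intro integral_mono) auto
    moreover have "(\<integral>g. P (u + h) g - P u g \<partial>M) \<le> (\<integral>g. D (u + h) g * h \<partial>M)"
      using Di Pi secant[OF that] by (intro integral_mono) auto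
    ultimately show ?thesis using Di Pi by (simp add: m_def \<psi>_def)
  qed
  have \<delta>i: "integrable M (\<delta> u)" for u unfolding \<delta>_def using Pi by auto
  \<comment> \<open>The range from 0 to 3 contains \<open>u - y\<close>, \<open>u\<close> and
    \<open>u + y\<close> whenever \<open>u \<in> {1..2}\<close>, since
    \<open>y \<le> 1\<close>.\<close>
  have \<delta>v: "(\<integral>g. \<bar>\<delta> u g\<bar> \<partial>M) \<le> v" if "0 \<le> u" "u \<le> 3" for u
    using v[OF that] by (simp add: \<delta>_def \<psi>_def P_def)
  \<comment> \<open>The secants of \<open>P\<close> are those of its mean \<open>\<psi>\<close> plus
    an error in \<open>\<delta>\<close>. The mean secants lie between \<open>m (u - y)\<close> and
    \<open>m (u + y)\<close>; each of the three values of \<open>\<delta>\<close> costs at most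
    \<open>v / y\<close> in expectation.\<close>
  have disorder: "(\<integral>g. \<bar>D u g - m u\<bar> \<partial>M) \<le> m (u + y) - m (u - y) + 3 * v / y" if u: "u \<in> {1..2}" for u
  proof -
    have pw: "\<bar>D u g - m u\<bar> \<le> m (u + y) - m (u - y) + (\<bar>\<delta> (u + y) g\<bar> + \<bar>\<delta> u g\<bar> + \<bar>\<delta> (u - y) g\<bar>) / y" for g
    proof -
      have m1: "m (u - y) \<le> m u" "m u \<le> m (u + y)"
        unfolding m_def using Di Dmono y by (auto intro!: integral_mono)
      have "D u g * y \<le> (\<psi> (u + y) - \<psi> u) + (\<delta> (u + y) g - \<delta> u g)"
        using secant[OF y(1), of u g] by (simp add: \<delta>_def)
      also have "\<dots> \<le> m (u + y) * y + (\<delta> (u + y) g - \<delta> u g)"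
        using \<psi>[OF y(1), of u] by simp
      finally have 1: "(D u g - m u) * y \<le> (m (u + y) - m (u - y)) * y + (\<bar>\<delta> (u + y) g\<bar> + \<bar>\<delta> u g\<bar> + \<bar>\<delta> (u - y) g\<bar>)"
        using mult_right_mono[OF m1(1), of y] y unfolding left_diff_distrib by linarith
      have "D u g * y \<ge> (\<psi> u - \<psi> (u - y)) + (\<delta> u g - \<delta> (u - y) g)"
        using secant[OF y(1), of "u - y" g] by (simp add: \<delta>_def)
      moreover have "\<psi> u - \<psi> (u - y) \<ge> m (u - y) * y"
        using \<psi>[OF y(1), of "u - y"] by simp
      ultimately have 2: "- (D u g - m u) * y \<le> (m (u + y) - m (u - y)) * y + (\<bar>\<delta> (u + y) g\<bar> + \<bar>\<delta> u g\<bar> + \<bar>\<delta> (u - y) g\<bar>)"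
        using mult_right_mono[OF m1(2), of y] y unfolding left_diff_distrib minus_mult_left[symmetric] by linarith
      have "\<bar>D u g - m u\<bar> * y \<le> (m (u + y) - m (u - y)) * y + (\<bar>\<delta> (u + y) g\<bar> + \<bar>\<delta> u g\<bar> + \<bar>\<delta> (u - y) g\<bar>)"
        using 1 2 by (auto simp: abs_if)
      then show ?thesis using y by (simp add: field_simps)
    qed
    have "(\<integral>g. \<bar>D u g - m u\<bar> \<partial>M) \<le> (\<integral>g. m (u + y) - m (u - y) + (\<bar>\<delta> (u + y) g\<bar> + \<bar>\<delta> u g\<bar> + \<bar>\<delta> (u - y) g\<bar>) / y \<partial>M)"
      using Di \<delta>i pw by (intro integral_mono) auto
    also have "\<dots> = m (u + y) - m (u - y) +
        ((\<integral>g. \<bar>\<delta> (u + y) g\<bar> \<partial>M) + (\<integral>g. \<bar>\<delta> u g\<bar> \<partial>M) + (\<integral>g. \<bar>\<delta> (u - y) g\<bar> \<partial>M)) / y"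
      using \<delta>i by (simp add: M.prob_space)
    also have "\<dots> \<le> m (u + y) - m (u - y) + (v + v + v) / y"
      using u y by (intro add_left_mono divide_right_mono add_mono \<delta>v) auto
    finally show ?thesis by simp
  qed
  \<comment> \<open>The weighted inequality between \<open>\<bar>z\<bar>\<close> and
    \<open>z\<^sup>2\<close> keeps the bound linear in the variance \<open>V\<close>, so that
    integration over \<open>u\<close> still telescopes. The weight \<open>r\<close> stays free and
    is chosen later.\<close>
  have thermal: "gav S (\<lambda>\<sigma>. A g \<sigma> + u * B g \<sigma>) (\<lambda>\<sigma>. \<bar>B g \<sigma> - m u\<bar>) \<le> V u g / (2 * r) + r / 2 + \<bar>D u g - m u\<bar>" for u g
  proof -
    have amgm: "\<bar>z\<bar> \<le> 1 / (2 * r) * z\<^sup>2 + r / 2" for z :: real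
      using sum_squares_bound[of "\<bar>z\<bar>" r] r by (simp add: field_simps power2_eq_square)
    have "gav S (\<lambda>\<sigma>. A g \<sigma> + u * B g \<sigma>) (\<lambda>\<sigma>. \<bar>B g \<sigma> - m u\<bar>)
        \<le> gav S (\<lambda>\<sigma>. A g \<sigma> + u * B g \<sigma>) (\<lambda>\<sigma>. 1 / (2 * r) * (B g \<sigma> - D u g)\<^sup>2 + (r / 2 + \<bar>D u g - m u\<bar>))"
    proof (rule gav_mono)
      fix \<sigma>
      show "\<bar>B g \<sigma> - m u\<bar> \<le> 1 / (2 * r) * (B g \<sigma> - D u g)\<^sup>2 + (r / 2 + \<bar>D u g - m u\<bar>)"
        using amgm[of "B g \<sigma> - D u g"] by linarith
    qed
    also have "\<dots> = 1 / (2 * r) * V u g + (r / 2 + \<bar>D u g - m u\<bar>)"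
      unfolding gav_add gav_cmult using gav_const[OF S] gav_variance_nonneg(1)[OF S]
      by (simp add: V_def D_def)
    finally show ?thesis by simp
  qed
  define b where "b u = (\<integral>g. V u g \<partial>M) / (2 * r) + r / 2 + (m (u + y) - m (u - y) + 3 * v / y)" for u
  have le_b: "(\<integral>g. gav S (\<lambda>\<sigma>. A g \<sigma> + u * B g \<sigma>) (\<lambda>\<sigma>. \<bar>B g \<sigma> - m u\<bar>) \<partial>M) \<le> b u" if "u \<in> {1..2}" for u
  proof -
    \<comment> \<open>Comparison against a nonnegative integrable upper bound, so integrability of
      the left integrand need not be shown.\<close>
    have "(\<integral>g. gav S (\<lambda>\<sigma>. A g \<sigma> + u * B g \<sigma>) (\<lambda>\<sigma>. \<bar>B g \<sigma> - m u\<bar>) \<partial>M)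
      \<le> (\<integral>g. V u g / (2 * r) + r / 2 + \<bar>D u g - m u\<bar> \<partial>M)"
      using Vi Di by (intro integral_mono_AE' AE_I2 thermal)
        (auto intro!: add_nonneg_nonneg divide_nonneg_nonneg simp: V0 r less_imp_le)
    also have "\<dots> = (\<integral>g. V u g \<partial>M) / (2 * r) + r / 2 + (\<integral>g. \<bar>D u g - m u\<bar> \<partial>M)"
      using Vi Di by (simp add: M.prob_space)
    also have "\<dots> \<le> b u" using disorder[OF that] by (simp add: b_def)
    finally show ?thesis .
  qed
  have pairB [measurable]: "(\<lambda>z. A (snd z) \<sigma>) \<in> borel_measurable (borel \<Otimes>\<^sub>M M)"
      "(\<lambda>z. B (snd z) \<sigma>) \<in> borel_measurable (borel \<Otimes>\<^sub>M M)" if "\<sigma> \<in> S" for \<sigma>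
    using measurable_compose[OF measurable_snd Am[OF that]] measurable_compose[OF measurable_snd Bm[OF that]] by auto
  have jD: "(\<lambda>(u, g). D (u + h) g) \<in> borel_measurable (borel \<Otimes>\<^sub>M M)" for h
    unfolding D_def case_prod_unfold by measurable
  have jV: "(\<lambda>(u, g). V u g) \<in> borel_measurable (borel \<Otimes>\<^sub>M M)"
    using jD[of 0] unfolding V_def D_def case_prod_unfold by measurable
  have IV: "integrable unif12 (\<lambda>u. \<integral>g. V u g \<partial>M)" "(\<integral>u. \<integral>g. V u g \<partial>M \<partial>unif12) = (\<integral>g. D 2 g - D 1 g \<partial>M)"
    by (rule integral_unif12_expectation[OF M jV DV Vcont SBi(2) Vb])+
  have PD': "((\<lambda>u. P (u + h) g) has_real_derivative D (u + h) g) (at u)" for u h g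
    by (rule iffD1[OF DERIV_shift[where f="\<lambda>u. P u g"] PD])
  have Dcont': "isCont (\<lambda>u. D (u + h) g) u" for u h g
    by (rule isCont_o2[where g="\<lambda>u. D u g" and f="\<lambda>u. u + h"]) (intro continuous_intros Dcont)+
  have Im: "integrable unif12 (\<lambda>u. m (u + h))"
     "(\<integral>u. m (u + h) \<partial>unif12) = (\<integral>g. P (2 + h) g - P (1 + h) g \<partial>M)" for h
    unfolding m_def by (rule integral_unif12_expectation[OF M jD PD' Dcont' SBi(1) Db])+
  have Im': "integrable unif12 (\<lambda>u. m (u - y))"
     "(\<integral>u. m (u - y) \<partial>unif12) = (\<integral>g. P (2 - y) g - P (1 - y) g \<partial>M)"
    using Im[of "- y"] by simp_all
  interpret U: prob_space unif12 by (rule prob_space_unif12)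
  have U1: "measure unif12 UNIV = 1" using U.prob_space by simp
  have bi: "integrable unif12 b"
    unfolding b_def using IV(1) Im(1)[of y] Im'(1) by auto
  have "(\<integral>u. b u \<partial>unif12) = (m 2 - m 1) / (2 * r) + r / 2 + ((\<psi> (2 + y) - \<psi> (1 + y)) - (\<psi> (2 - y) - \<psi> (1 - y)) + 3 * v / y)"
    unfolding b_def using IV Im[of y] Im' Di Pi by (simp add: U1 m_def \<psi>_def)
  \<comment> \<open>The four values of \<open>\<psi>\<close> regroup into increments over
    \<open>2 - y\<close> to \<open>2 + y\<close> and over \<open>1 - y\<close> to
    \<open>1 + y\<close>. Each interval has length \<open>2 * y\<close>, and the slopes of
    \<open>\<psi>\<close> there are controlled by \<open>K\<close>.\<close>
  also have "\<dots> \<le> (K + K) / (2 * r) + r / 2 + ((K * (2 * y) + K * (2 * y)) + 3 * v / y)"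
  proof -
    have "\<psi> (2 + y) - \<psi> (2 - y) \<le> m (2 + y) * (2 * y)" using \<psi>[of "2 * y" "2 - y"] y by (simp add: add.commute)
    also have "\<dots> \<le> K * (2 * y)" using K[of "2 + y"] y by (intro mult_right_mono) (auto simp: m_def D_def)
    finally have 1: "\<psi> (2 + y) - \<psi> (2 - y) \<le> K * (2 * y)" .
    have "\<psi> (1 - y) - \<psi> (1 + y) \<le> - m (1 - y) * (2 * y)" using \<psi>[of "2 * y" "1 - y"] y by (simp add: add.commute)
    also have "\<dots> \<le> K * (2 * y)" using K[of "1 - y"] y by (intro mult_right_mono) (auto simp: m_def D_def)
    finally have 2: "\<psi> (1 - y) - \<psi> (1 + y) \<le> K * (2 * y)" .
    have 3: "m 2 - m 1 \<le> K + K" using K[of 2] K[of 1] by (auto simp: m_def D_def)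
    show ?thesis using 1 2 divide_right_mono[OF 3, of "2 * r"] r by simp
  qed
  also have "\<dots> = K / r + r / 2 + 4 * y * K + 3 * v / y" by simp
  finally have "(\<integral>u. b u \<partial>unif12) \<le> K / r + r / 2 + 4 * y * K + 3 * v / y" .
  then show ?thesis using bi le_b unfolding m_def D_def by blast
qed

section \<open>Linear forms and random series\<close>

text \<open>A linear form is Lipschitz in coordinate \<open>k\<close> with constant
  \<open>\<bar>c k\<bar>\<close> and has mean 0, so the variance bound for Lipschitz functions is a
  bound on its second moment.\<close>

lemma gauss_linear_form:
  fixes I :: "'i set" and c :: "'i \<Rightarrow> real"
  defines "P \<equiv> PiM I (\<lambda>_. gauss)"
  assumes J: "finite J" "J \<subseteq> I"
  shows "integrable P (\<lambda>g. \<Sum>k\<in>J. c k * g k)"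
    and "integrable P (\<lambda>g. (\<Sum>k\<in>J. c k * g k)\<^sup>2)"
    and "(\<integral>g. (\<Sum>k\<in>J. c k * g k)\<^sup>2 \<partial>P) \<le> (\<Sum>k\<in>J. (c k)\<^sup>2)"
proof -
  define F where "F g = (\<Sum>k\<in>J. c k * g k)" for g :: "'i \<Rightarrow> real"
  have co: "integrable P (\<lambda>g. g k)" "(\<integral>g. g k \<partial>P) = 0" if "k \<in> J" for k
    using PiM_gauss_coordinate[of k I] PiM_gauss_coordinate(1)[of k I 1] that J unfolding P_def by auto
  have Fi: "integrable P F" unfolding F_def using co by auto
  have F0: "(\<integral>g. F g \<partial>P) = 0" unfolding F_def using co by simp
  have "F \<in> borel_measurable P" using Fi by auto
  then have "integrable P F \<and> integrable P (\<lambda>g. (F g)\<^sup>2) \<and> (\<integral>g. (F g - (\<integral>h. F h \<partial>P))\<^sup>2 \<partial>P) \<le> (\<Sum>k\<in>J. \<bar>c k\<bar>\<^sup>2)"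
    unfolding P_def
  proof (intro gauss_variance_le J)
    show "F g = F h" if "\<And>i. i \<in> J \<Longrightarrow> g i = h i" for g h
      unfolding F_def using that by (intro sum.cong) auto
    show "\<bar>F (g(i := t)) - F g\<bar> \<le> \<bar>c i\<bar> * \<bar>t - g i\<bar>" if "i \<in> J" for g i t
    proof -
      have "F (g(i := t)) - F g = c i * (t - g i)"
        unfolding F_def using J(1) that by (simp add: sum.remove[of J i] algebra_simps)
      then show ?thesis by (simp add: abs_mult)
    qed
  qed
  then show "integrable P (\<lambda>g. \<Sum>k\<in>J. c k * g k)" "integrable P (\<lambda>g. (\<Sum>k\<in>J. c k * g k)\<^sup>2)"
    "(\<integral>g. (\<Sum>k\<in>J. c k * g k)\<^sup>2 \<partial>P) \<le> (\<Sum>k\<in>J. (c k)\<^sup>2)"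
    unfolding F0 unfolding F_def by (simp_all only: power2_abs diff_0_right)
qed

text \<open>Moving coordinate \<open>k\<close> changes every exponent by at most \<open>a k\<close>
  times the displacement, and \<open>lse\<close> does not amplify this. The variance is therefore at
  most the sum of the squares of the \<open>a k\<close>, whatever the number of coordinates.\<close>

lemma lse_linear_concentration:
  fixes I J :: "'i set" and S :: "'c set" and c :: "'i \<Rightarrow> 'c \<Rightarrow> real"
  defines "P \<equiv> PiM I (\<lambda>_. gauss)"
  defines "\<phi> \<equiv> (\<lambda>g. lse S (\<lambda>\<sigma>. \<Sum>k\<in>J. c k \<sigma> * g k))"
  assumes J: "finite J" "J \<subseteq> I" and S: "finite S" "S \<noteq> {}"
    and c: "\<And>k \<sigma>. k \<in> J \<Longrightarrow> \<sigma> \<in> S \<Longrightarrow> \<bar>c k \<sigma>\<bar> \<le> a k"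
    and q: "0 < q" "(\<Sum>k\<in>J. (a k)\<^sup>2) \<le> q\<^sup>2"
  shows "integrable P \<phi>" and "(\<integral>g. \<bar>\<phi> g - (\<integral>g. \<phi> g \<partial>P)\<bar> \<partial>P) \<le> q"
proof -
  interpret P: prob_space P unfolding P_def by (intro prob_space_PiM prob_space_gauss)
  have [measurable]: "(\<lambda>g. g k) \<in> borel_measurable P" if "k \<in> J" for k
    using PiM_gauss_coordinate(1)[of k I 1] that J unfolding P_def by auto
  have [measurable]: "\<phi> \<in> borel_measurable P"
    unfolding \<phi>_def by (intro measurable_lse borel_measurable_sum borel_measurable_times borel_measurable_const) measurable
  have "integrable P \<phi> \<and> integrable P (\<lambda>g. (\<phi> g)\<^sup>2) \<and> (\<integral>g. (\<phi> g - (\<integral>h. \<phi> h \<partial>P))\<^sup>2 \<partial>P) \<le> (\<Sum>k\<in>J. (a k)\<^sup>2)"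
    unfolding P_def
  proof (intro gauss_variance_le J)
    show "\<phi> \<in> borel_measurable (PiM I (\<lambda>_. gauss))" unfolding P_def[symmetric] by measurable
    show "\<phi> g = \<phi> h" if "\<And>i. i \<in> J \<Longrightarrow> g i = h i" for g h
      unfolding \<phi>_def using that by (simp cong: sum.cong)
    show "\<bar>\<phi> (g(i := t)) - \<phi> g\<bar> \<le> a i * \<bar>t - g i\<bar>" if i: "i \<in> J" for g i t
      unfolding \<phi>_def
    proof (rule lse_Lipschitz[OF S])
      fix \<sigma> assume \<sigma>: "\<sigma> \<in> S"
      have "(\<Sum>k\<in>J. c k \<sigma> * (g(i := t)) k) - (\<Sum>k\<in>J. c k \<sigma> * g k) = c i \<sigma> * (t - g i)"
        using J(1) i by (simp add: sum.remove[of J i] algebra_simps)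
      then show "\<bar>(\<Sum>k\<in>J. c k \<sigma> * (g(i := t)) k) - (\<Sum>k\<in>J. c k \<sigma> * g k)\<bar> \<le> a i * \<bar>t - g i\<bar>"
        using c[OF i \<sigma>] by (simp add: abs_mult mult_right_mono)
    qed
  qed
  then have 1: "integrable P \<phi>" and 2: "integrable P (\<lambda>g. (\<phi> g)\<^sup>2)"
    and 3: "(\<integral>g. (\<phi> g - (\<integral>h. \<phi> h \<partial>P))\<^sup>2 \<partial>P) \<le> (\<Sum>k\<in>J. (a k)\<^sup>2)" by blast+
  show "integrable P \<phi>" by (rule 1)
  define m where "m = (\<integral>h. \<phi> h \<partial>P)"
  have i2: "integrable P (\<lambda>g. (\<phi> g - m)\<^sup>2)"
    using 1 2 by (simp add: power2_diff)
  \<comment> \<open>The weight \<open>q\<close> makes both halves equal to \<open>q / 2\<close> once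
    the variance is bounded by \<open>q\<^sup>2\<close>.\<close>
  have "(\<integral>g. \<bar>\<phi> g - m\<bar> \<partial>P) \<le> (\<integral>g. (\<phi> g - m)\<^sup>2 / (2 * q) + q / 2 \<partial>P)"
  proof (rule integral_mono)
    show "\<bar>\<phi> g - m\<bar> \<le> (\<phi> g - m)\<^sup>2 / (2 * q) + q / 2" for g
      using sum_squares_bound[of "\<bar>\<phi> g - m\<bar>" q] q(1) by (simp add: field_simps power2_eq_square)
  qed (use 1 i2 in auto)
  also have "\<dots> = (\<integral>g. (\<phi> g - m)\<^sup>2 \<partial>P) / (2 * q) + q / 2"
    using i2 by (simp add: P.prob_space)
  also have "\<dots> \<le> q\<^sup>2 / (2 * q) + q / 2"
    using 3 q unfolding m_def by (intro add_right_mono divide_right_mono) auto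
  also have "\<dots> = q" using q(1) by (simp add: power2_eq_square)
  finally show "(\<integral>g. \<bar>\<phi> g - (\<integral>g. \<phi> g \<partial>P)\<bar> \<partial>P) \<le> q" unfolding m_def .
qed

section \<open>Unconditional series as integrals against counting measure\<close>

lemma summable_on_real_iff_integrable:
  fixes f :: "'a \<Rightarrow> real"
  shows "f summable_on A \<longleftrightarrow> integrable (count_space A) f"
  unfolding abs_summable_on_def[symmetric] abs_summable_equivalent[symmetric]
  by (rule summable_on_iff_abs_summable_on_real)

text \<open>No summability is assumed: for a divergent series both sides take their default value 0.
  Measurability of \<open>infsum\<close> in a parameter can thus be inherited from the
  integral.\<close>

lemma infsum_eq_integral_count_space:
  fixes f :: "'a \<Rightarrow> real"
  shows "infsum f A = (\<integral>x. f x \<partial>count_space A)"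
proof (cases "f summable_on A")
  case True
  then show ?thesis
    using infsetsum_infsum[of f A]
    by (simp only: summable_on_real_iff_integrable infsetsum_def abs_summable_on_def)
next
  case False
  then show ?thesis
    by (simp add: infsum_not_exists summable_on_real_iff_integrable not_integrable_integral_eq)
qed

lemma measurable_pair_count_space:
  assumes "countable A" "\<And>e. e \<in> A \<Longrightarrow> f e \<in> measurable M N"
  shows "(\<lambda>(g, e). f e g) \<in> measurable (M \<Otimes>\<^sub>M count_space A) N"
proof -
  have "(\<lambda>z. f (fst z) (snd z)) \<in> measurable (count_space A \<Otimes>\<^sub>M M) N"
    using assms by (intro measurable_pair_measure_countable1) auto
  from measurable_compose[OF measurable_pair_swap'[of M "count_space A"] this]
  show ?thesis by (simp add: case_prod_unfold)
qed

lemma measurable_infsum: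
  fixes f :: "'e \<Rightarrow> 'a \<Rightarrow> real"
  assumes "countable A" "\<And>e. e \<in> A \<Longrightarrow> f e \<in> borel_measurable M"
  shows "(\<lambda>g. infsum (\<lambda>e. f e g) A) \<in> borel_measurable M"
proof -
  interpret sigma_finite_measure "count_space A"
    using assms(1) by (rule sigma_finite_measure_count_space_countable)
  show ?thesis
    unfolding infsum_eq_integral_count_space
    using measurable_pair_count_space[OF assms] by (rule borel_measurable_lebesgue_integral)
qed

text \<open>Tonelli for the product with counting measure: a finite sum of L1 norms gives absolute
  convergence almost everywhere and an integrable limit.\<close>

lemma random_series:
  fixes f :: "'e \<Rightarrow> 'a \<Rightarrow> real"
  assumes A: "countable A" and i: "\<And>e. e \<in> A \<Longrightarrow> integrable M (f e)"
    and y: "\<And>e. e \<in> A \<Longrightarrow> (\<integral>g. \<bar>f e g\<bar> \<partial>M) \<le> y e" "y summable_on A"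
  shows "AE g in M. (\<lambda>e. f e g) summable_on A"
    and "integrable M (\<lambda>g. infsum (\<lambda>e. f e g) A)"
    and "(\<integral>g. \<bar>infsum (\<lambda>e. f e g) A\<bar> \<partial>M) \<le> infsum y A"
proof -
  have m [measurable]: "f e \<in> borel_measurable M" if "e \<in> A" for e using i[OF that] by auto
  have y0: "0 \<le> y e" if "e \<in> A" for e
    using y(1)[OF that] by (rule order_trans[rotated]) simp
  have ya: "integrable (count_space A) y"
    using y(2) by (simp only: summable_on_real_iff_integrable)
  have "(\<integral>\<^sup>+g. \<integral>\<^sup>+e. ennreal \<bar>f e g\<bar> \<partial>count_space A \<partial>M) = (\<integral>\<^sup>+e. \<integral>\<^sup>+g. ennreal \<bar>f e g\<bar> \<partial>M \<partial>count_space A)"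
    by (rule nn_integral_count_space_nn_integral[OF A]) (use m in auto)
  also have "\<dots> \<le> (\<integral>\<^sup>+e. ennreal (y e) \<partial>count_space A)"
  proof (rule nn_integral_mono)
    fix e assume "e \<in> space (count_space A)"
    then have e: "e \<in> A" by simp
    have "(\<integral>\<^sup>+g. ennreal \<bar>f e g\<bar> \<partial>M) = ennreal (\<integral>g. \<bar>f e g\<bar> \<partial>M)"
      using i[OF e] by (intro nn_integral_eq_integral) auto
    then show "(\<integral>\<^sup>+g. ennreal \<bar>f e g\<bar> \<partial>M) \<le> ennreal (y e)"
      using y(1)[OF e] by (simp add: ennreal_leI)
  qed
  also have "\<dots> = ennreal (infsum y A)"
    unfolding infsum_eq_integral_count_space using ya y0
    by (intro nn_integral_eq_integral) (auto simp: AE_count_space)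
  finally have bound: "(\<integral>\<^sup>+g. \<integral>\<^sup>+e. ennreal \<bar>f e g\<bar> \<partial>count_space A \<partial>M) \<le> ennreal (infsum y A)" .
  have nm: "(\<lambda>g. \<integral>\<^sup>+e. ennreal \<bar>f e g\<bar> \<partial>count_space A) \<in> borel_measurable M"
    using A m by (intro sigma_finite_measure.borel_measurable_nn_integral
        sigma_finite_measure_count_space_countable
        measurable_pair_count_space[where f="\<lambda>e g. ennreal \<bar>f e g\<bar>"]) auto
  \<comment> \<open>Where the series diverges the left-hand side is 0, so the bound holds at every
    \<open>g\<close>.\<close>
  have pw: "ennreal \<bar>infsum (\<lambda>e. f e g) A\<bar> \<le> (\<integral>\<^sup>+e. ennreal \<bar>f e g\<bar> \<partial>count_space A)" for g
  proof (cases "integrable (count_space A) (\<lambda>e. f e g)")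
    case True
    then show ?thesis using integral_norm_bound_ennreal[OF True]
      by (simp add: infsum_eq_integral_count_space)
  next
    case False
    then show ?thesis by (simp add: infsum_eq_integral_count_space not_integrable_integral_eq)
  qed
  have fin: "AE g in M. (\<integral>\<^sup>+e. ennreal \<bar>f e g\<bar> \<partial>count_space A) \<noteq> \<infinity>"
    using bound by (intro nn_integral_PInf_AE nm) (auto simp: top_unique)
  then show "AE g in M. (\<lambda>e. f e g) summable_on A"
  proof eventually_elim
    case (elim g)
    then have "integrable (count_space A) (\<lambda>e. f e g)"
      by (auto simp: integrable_iff_bounded less_top)
    then show ?case
      by (simp only: summable_on_real_iff_integrable)
  qed
  have im: "(\<lambda>g. infsum (\<lambda>e. f e g) A) \<in> borel_measurable M"
    using A m by (rule measurable_infsum)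
  have nb: "(\<integral>\<^sup>+g. ennreal \<bar>infsum (\<lambda>e. f e g) A\<bar> \<partial>M) \<le> ennreal (infsum y A)"
    using nn_integral_mono[of M "\<lambda>g. ennreal \<bar>infsum (\<lambda>e. f e g) A\<bar>", OF pw] bound by (rule order_trans)
  show ii: "integrable M (\<lambda>g. infsum (\<lambda>e. f e g) A)"
    unfolding integrable_iff_bounded using im nb by (auto simp: top_unique less_top intro: le_less_trans)
  have "ennreal (\<integral>g. \<bar>infsum (\<lambda>e. f e g) A\<bar> \<partial>M) \<le> ennreal (infsum y A)"
    using nb ii by (subst nn_integral_eq_integral[symmetric]) auto
  then show "(\<integral>g. \<bar>infsum (\<lambda>e. f e g) A\<bar> \<partial>M) \<le> infsum y A"
    using y0 by (subst (asm) ennreal_le_iff) (auto intro: infsum_nonneg)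
qed

section \<open>Combinatorics of the \<open>p\<close>-spin covariance\<close>

lemma lists_length_Suc_eq:
  "{is. length is = Suc p \<and> set is \<subseteq> X} = (\<lambda>(i, is). i # is) ` (X \<times> {is. length is = p \<and> set is \<subseteq> X})"
  by (auto simp: image_iff length_Suc_conv)

lemma sum_prod_lists:
  fixes q :: "'a \<Rightarrow> 'b::comm_semiring_1"
  shows "(\<Sum>is\<in>{is. length is = p \<and> set is \<subseteq> X}. \<Prod>k<p. q (is ! k)) = (\<Sum>i\<in>X. q i) ^ p"
proof (induction p)
  case (Suc p)
  have "(\<Sum>is\<in>{is. length is = Suc p \<and> set is \<subseteq> X}. \<Prod>k<Suc p. q (is ! k)) =
    (\<Sum>(i, is)\<in>X \<times> {is. length is = p \<and> set is \<subseteq> X}. q i * (\<Prod>k<p. q (is ! k)))"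
    unfolding lists_length_Suc_eq
    by (subst sum.reindex) (auto simp: inj_on_def prod.lessThan_Suc_shift case_prod_unfold simp del: prod.lessThan_Suc)
  also have "\<dots> = (\<Sum>i\<in>X. q i) ^ Suc p"
    by (simp add: sum.cartesian_product[symmetric] sum_distrib_left[symmetric] sum_distrib_right[symmetric] Suc)
  finally show ?case .
next
  case 0
  have "{is. length is = 0 \<and> set is \<subseteq> X} = {[]}" by auto
  then show ?case by simp
qed

text \<open>The block size in the weight cancels the normalisation of the block overlap, leaving one
  sum over sites. An empty block contributes 0 on both sides.\<close>

lemma overlap_w_eq:
  fixes lab :: "nat \<Rightarrow> nat \<Rightarrow> 's::finite"
  shows "overlap_w lab N w \<sigma> \<tau> = (\<Sum>i<N. w (lab N i) * \<sigma> i * \<tau> i) / real N"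
proof -
  have fin: "finite (blk lab N s)" for s by (simp add: blk_def)
  have "(real (card (blk lab N s)) / real N) * w s * overlap_s lab N s \<sigma> \<tau>
      = (\<Sum>i\<in>{i\<in>{..<N}. lab N i = s}. w (lab N i) * \<sigma> i * \<tau> i / real N)" for s
  proof (cases "blk lab N s = {}")
    case True
    then have e: "{i\<in>{..<N}. lab N i = s} = {}" by (simp add: blk_def)
    show ?thesis unfolding e using True by simp
  next
    case False
    then have "card (blk lab N s) \<noteq> 0" using fin by simp
    then have "(real (card (blk lab N s)) / real N) * w s * overlap_s lab N s \<sigma> \<tau> = (\<Sum>i\<in>blk lab N s. \<sigma> i * \<tau> i) * w s / real N"
      by (simp add: overlap_s_def)
    also have "\<dots> = (\<Sum>i\<in>blk lab N s. w (lab N i) * \<sigma> i * \<tau> i / real N)"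
      unfolding sum_distrib_right sum_divide_distrib by (intro sum.cong) (auto simp: blk_def)
    finally show ?thesis by (simp add: blk_def)
  qed
  then have "overlap_w lab N w \<sigma> \<tau> = (\<Sum>s\<in>UNIV. \<Sum>i\<in>{i\<in>{..<N}. lab N i = s}. w (lab N i) * \<sigma> i * \<tau> i / real N)"
    by (simp add: overlap_w_def)
  also have "\<dots> = (\<Sum>i<N. w (lab N i) * \<sigma> i * \<tau> i / real N)"
    by (rule sum.group) auto
  finally show ?thesis by (simp add: sum_divide_distrib)
qed

section \<open>The perturbed model\<close>

abbreviation multi_idx :: "nat \<Rightarrow> nat \<Rightarrow> nat list set" where
  "multi_idx N p \<equiv> {is. length is = p \<and> set is \<subseteq> {..<N}}"

lemma finite_multi_idx: "finite (multi_idx N p)"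
  using finite_lists_length_eq[of "{..<N}" p] by (simp add: conj_commute)

lemma card_multi_idx: "card (multi_idx N p) = N ^ p"
  using card_lists_length_eq[of "{..<N}" p] by (simp add: conj_commute)

text \<open>The coefficient of a single Gaussian in \<open>h_wp\<close>. Isolating it exhibits
  \<open>h_wp\<close> as a linear form in the disorder.\<close>

definition chain :: "(nat \<Rightarrow> 's) \<Rightarrow> nat \<Rightarrow> ('s \<Rightarrow> real) \<Rightarrow> nat \<Rightarrow> nat list \<Rightarrow> (nat \<Rightarrow> real) \<Rightarrow> real" where
  "chain l N w p is \<sigma> = (\<Prod>k<p. \<sigma> (is ! k) * sqrt (w (l (is ! k)))) / sqrt (real N) ^ p"

lemma h_wp_eq: "h_wp lab N w p g \<sigma> = (\<Sum>is\<in>multi_idx N p. chain (lab N) N w p is \<sigma> * g (Inr (w, p, is)))"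
  by (simp add: h_wp_def chain_def sum_distrib_left sum_divide_distrib mult.commute)

lemma cfgs_abs:
  assumes "\<sigma> \<in> cfgs N" "i < N"
  shows "\<bar>\<sigma> i\<bar> = 1"
proof -
  have "\<sigma> i \<in> {-1, 1}"
    using assms unfolding cfgs_def PiE_iff by simp
  then show ?thesis by (elim insertE) simp_all
qed

lemma cfgs_square: "\<sigma> \<in> cfgs N \<Longrightarrow> i < N \<Longrightarrow> \<sigma> i * \<sigma> i = 1"
  using cfgs_abs[of \<sigma> N i] abs_mult_self_eq[of "\<sigma> i"] by simp

lemma finite_cfgs: "finite (cfgs N)"
  unfolding cfgs_def by (intro finite_PiE) auto

lemma cfgs_nonempty: "cfgs N \<noteq> {}"
  by (simp add: cfgs_def PiE_eq_empty_iff)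

text \<open>There are \<open>N ^ p\<close> index lists, so the squares of these coefficients sum to
  at most 1: every \<open>p\<close>-spin term has variance at most 1, uniformly in \<open>N\<close>
  and \<open>p\<close>.\<close>

lemma chain_abs_le:
  assumes "\<sigma> \<in> cfgs N" "is \<in> multi_idx N p" "\<And>s. 0 \<le> w s \<and> w s \<le> 1"
  shows "\<bar>chain l N w p is \<sigma>\<bar> \<le> 1 / sqrt (real N) ^ p"
proof -
  have "\<bar>\<Prod>k<p. \<sigma> (is ! k) * sqrt (w (l (is ! k)))\<bar> \<le> (\<Prod>k<p. 1)"
    unfolding abs_prod
  proof (rule prod_mono)
    fix k assume "k \<in> {..<p}"
    then have "is ! k \<in> set is" using assms(2) by auto
    then have "is ! k < N" using assms(2) by blast
    then show "0 \<le> \<bar>\<sigma> (is ! k) * sqrt (w (l (is ! k)))\<bar> \<and> \<bar>\<sigma> (is ! k) * sqrt (w (l (is ! k)))\<bar> \<le> 1"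
      using assms cfgs_abs[of \<sigma> N "is ! k"] by (simp add: abs_mult)
  qed
  then show ?thesis by (simp add: chain_def divide_right_mono)
qed

text \<open>The left-hand side is the covariance of \<open>h_wp lab N w p g\<close> at \<open>\<sigma>\<close> and \<open>\<tau>\<close>.\<close>

lemma sum_chain_chain:
  assumes "\<And>s. 0 \<le> w s"
  shows "(\<Sum>is\<in>multi_idx N p. chain (lab N) N w p is \<sigma> * chain (lab N) N w p is \<tau>) = overlap_w lab N w \<sigma> \<tau> ^ p"
proof -
  have ac: "(a * r) * (b * r) = (r * r) * a * b" for a b r :: real
    by simp
  have "chain (lab N) N w p is \<sigma> * chain (lab N) N w p is \<tau> = (\<Prod>k<p. w (lab N (is ! k)) * \<sigma> (is ! k) * \<tau> (is ! k)) / real N ^ p" for "is"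
  proof -
    have "chain (lab N) N w p is \<sigma> * chain (lab N) N w p is \<tau>
      = (\<Prod>k<p. (\<sigma> (is ! k) * sqrt (w (lab N (is ! k)))) * (\<tau> (is ! k) * sqrt (w (lab N (is ! k))))) / (sqrt (real N) * sqrt (real N)) ^ p"
      by (simp only: chain_def prod.distrib power_mult_distrib times_divide_times_eq)
    also have "(\<lambda>k. (\<sigma> (is ! k) * sqrt (w (lab N (is ! k)))) * (\<tau> (is ! k) * sqrt (w (lab N (is ! k))))) =
        (\<lambda>k. w (lab N (is ! k)) * \<sigma> (is ! k) * \<tau> (is ! k))"
    proof
      fix k
      have "sqrt (w (lab N (is ! k))) * sqrt (w (lab N (is ! k))) = w (lab N (is ! k))"
        using assms by simp
      then show "(\<sigma> (is ! k) * sqrt (w (lab N (is ! k)))) * (\<tau> (is ! k) * sqrt (w (lab N (is ! k)))) = w (lab N (is ! k)) * \<sigma> (is ! k) * \<tau> (is ! k)"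
        using ac[of "\<sigma> (is ! k)" "sqrt (w (lab N (is ! k)))" "\<tau> (is ! k)"] by (simp only:)
    qed
    finally show ?thesis by simp
  qed
  then have "(\<Sum>is\<in>multi_idx N p. chain (lab N) N w p is \<sigma> * chain (lab N) N w p is \<tau>)
    = (\<Sum>is\<in>multi_idx N p. \<Prod>k<p. w (lab N (is ! k)) * \<sigma> (is ! k) * \<tau> (is ! k)) / real N ^ p"
    by (simp add: sum_divide_distrib)
  also have "\<dots> = overlap_w lab N w \<sigma> \<tau> ^ p"
    unfolding sum_prod_lists[where q="\<lambda>i. w (lab N i) * \<sigma> i * \<tau> i"] overlap_w_eq by (simp add: power_divide)
  finally show ?thesis .
qed

text \<open>One size \<open>N\<close> is fixed: all estimates are explicit finite-volume bounds, and
  the limit is taken only in the theorem.\<close>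

locale perturbed_sk =
  fixes Delta2 :: "'s::finite \<Rightarrow> 's \<Rightarrow> real" and W :: "('s \<Rightarrow> real) set" and j :: "('s \<Rightarrow> real) \<Rightarrow> nat"
    and gamma :: real and lab :: "nat \<Rightarrow> nat \<Rightarrow> 's" and N :: nat
  assumes Delta2_nonneg: "\<And>s t. 0 \<le> Delta2 s t"
    and W_countable: "countable W"
    and W_sub: "\<And>v s. v \<in> W \<Longrightarrow> 0 \<le> v s \<and> v s \<le> 1"
    and j_inj: "inj_on j W"
    and gamma_le: "gamma \<le> 1/2"
    and N_pos: "0 < N"
begin

abbreviation "P \<equiv> disorder_space W N"
abbreviation "Idx \<equiv> W \<times> {1::nat..}"
abbreviation "sN \<equiv> real N powr gamma"

definition coef :: "('s \<Rightarrow> real) \<times> nat \<Rightarrow> real" where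
  "coef e = 2 powr (- real (j (fst e)) - real (snd e))"

definition pert_term where
  "pert_term x g \<sigma> e = coef e * x e * h_wp lab N (fst e) (snd e) g \<sigma>"

lemma h_pert_eq: "h_pert W j lab N x g \<sigma> = infsum (pert_term x g \<sigma>) Idx"
  by (simp add: h_pert_def pert_term_def[abs_def] coef_def case_prod_unfold)

lemma P_eq: "P = PiM (disorder_idx W N) (\<lambda>_. gauss)"
  by (simp add: disorder_space_def)

lemma prob_space_P: "prob_space P"
  unfolding P_eq by (intro prob_space_PiM prob_space_gauss)

sublocale P: prob_space P by (rule prob_space_P)

lemma sN_pos: "0 < sN" using N_pos by simp

text \<open>This keeps the share of the perturbation in the sum of squared Lipschitz constants of
  order \<open>N\<close>, as for the unperturbed Hamiltonian.\<close>

lemma sN_square_le: "sN\<^sup>2 \<le> real N"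
proof -
  have "sN\<^sup>2 = real N powr (2 * gamma)"
    using N_pos by (simp add: powr_powr[symmetric] powr_realpow mult.commute[of 2] flip: powr_numeral)
  also have "\<dots> \<le> real N powr 1" using gamma_le N_pos by (intro powr_mono) auto
  finally show ?thesis by simp
qed

lemma coef_pos: "0 < coef e" by (simp add: coef_def)

lemma coef_eq: "coef e = (1/2) ^ j (fst e) * (1/2) ^ snd e"
  by (simp add: coef_def powr_diff powr_minus powr_realpow power_one_over divide_simps)

lemma coef_le_1: "coef e \<le> 1"
  unfolding coef_eq by (intro mult_le_one power_le_one) auto

text \<open>Injectivity of \<open>j\<close> embeds \<open>F\<close> into a grid of pairs of
  naturals, where the weights form a product of two geometric series. Each sums to at most 2 when
  started at exponent 0, whence the 4.\<close>

lemma sum_coef_le: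
  assumes "finite F" "F \<subseteq> Idx"
  shows "sum coef F \<le> 4"
proof -
  define \<iota> where "\<iota> e = (j (fst e), snd e)" for e :: "('s \<Rightarrow> real) \<times> nat"
  define h where "h ab = (1/2::real) ^ fst ab * (1/2) ^ snd ab" for ab :: "nat \<times> nat"
  have inj: "inj_on \<iota> F"
  proof (rule inj_onI)
    fix e e' assume "e \<in> F" "e' \<in> F" and eq: "\<iota> e = \<iota> e'"
    then have "fst e \<in> W" "fst e' \<in> W" using assms(2) by auto
    then show "e = e'" using eq inj_onD[OF j_inj, of "fst e" "fst e'"] by (simp add: \<iota>_def prod_eq_iff)
  qed
  obtain m where m: "\<iota> ` F \<subseteq> {..<m} \<times> {..<m}"
  proof -
    have "finite (fst ` \<iota> ` F \<union> snd ` \<iota> ` F)" using assms(1) by blast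
    then obtain m where "\<forall>i\<in>fst ` \<iota> ` F \<union> snd ` \<iota> ` F. i < m"
      using finite_nat_set_iff_bounded by blast
    then have "\<iota> ` F \<subseteq> {..<m} \<times> {..<m}" by (intro subsetI) (auto simp: mem_Times_iff)
    then show ?thesis by (rule that)
  qed
  have g: "(\<Sum>i<m. (1/2::real) ^ i) \<le> 2"
    by (induction m) (auto simp: sum_gp_strict)
  have "sum coef F = (\<Sum>ab\<in>\<iota> ` F. h ab)"
    unfolding sum.reindex[OF inj] by (simp add: coef_eq h_def \<iota>_def)
  also have "\<dots> \<le> (\<Sum>ab\<in>{..<m} \<times> {..<m}. h ab)"
    using m by (intro sum_mono2) (auto simp: h_def)
  also have "\<dots> = (\<Sum>i<m. (1/2::real) ^ i) * (\<Sum>i<m. (1/2::real) ^ i)"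
    by (simp add: sum_product sum.cartesian_product h_def case_prod_unfold)
  also have "\<dots> \<le> 2 * 2" by (intro mult_mono g sum_nonneg) auto
  finally show ?thesis by simp
qed

lemma coef_summable: "coef summable_on X" if "X \<subseteq> Idx"
  using that sum_coef_le coef_pos
  by (intro nonneg_bdd_above_summable_on bdd_aboveI[of _ 4]) (auto intro: less_imp_le)

lemma countable_Idx: "countable Idx"
  using W_countable by (intro countable_SIGMA) auto

lemma disorder_idx_memI:
  "i < N \<Longrightarrow> k < N \<Longrightarrow> Inl (i, k) \<in> disorder_idx W N"
  "(w, p) \<in> Idx \<Longrightarrow> is \<in> multi_idx N p \<Longrightarrow> Inr (w, p, is) \<in> disorder_idx W N"
  by (auto simp: disorder_idx_def)

lemma coordinate_integrable: "k \<in> disorder_idx W N \<Longrightarrow> integrable P (\<lambda>g. g k)"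
  using PiM_gauss_coordinate(1)[of k "disorder_idx W N" 1] by (simp add: P_eq)

lemma coordinate_measurable [measurable]: "k \<in> disorder_idx W N \<Longrightarrow> (\<lambda>g. g k) \<in> borel_measurable P"
  using coordinate_integrable by auto

lemma h_wp_moments:
  assumes e: "e \<in> Idx" and \<sigma>: "\<sigma> \<in> cfgs N"
  shows "integrable P (\<lambda>g. h_wp lab N (fst e) (snd e) g \<sigma>)"
    and "integrable P (\<lambda>g. (h_wp lab N (fst e) (snd e) g \<sigma>)\<^sup>2)"
    and "(\<integral>g. \<bar>h_wp lab N (fst e) (snd e) g \<sigma>\<bar> \<partial>P) \<le> 1"
proof -
  obtain w p where e_eq: "e = (w, p)" by (cases e)
  let ?J = "(\<lambda>is. Inr (w, p, is)) ` multi_idx N p"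
  define c where "c k = (case k of Inl _ \<Rightarrow> 0 | Inr (_, _, is) \<Rightarrow> chain (lab N) N w p is \<sigma>)"
    for k :: "(nat \<times> nat) + (('s \<Rightarrow> real) \<times> nat \<times> nat list)"
  have h: "h_wp lab N (fst e) (snd e) g \<sigma> = (\<Sum>k\<in>?J. c k * g k)" for g
    by (subst sum.reindex) (auto simp: h_wp_eq c_def e_eq inj_on_def)
  have J: "finite ?J" "?J \<subseteq> disorder_idx W N"
    using e disorder_idx_memI(2) by (auto simp: e_eq finite_multi_idx)
  note lin = gauss_linear_form[OF J, where c=c, folded P_eq h]
  show 1: "integrable P (\<lambda>g. h_wp lab N (fst e) (snd e) g \<sigma>)"
    and 2: "integrable P (\<lambda>g. (h_wp lab N (fst e) (snd e) g \<sigma>)\<^sup>2)"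
    by (rule lin)+
  have "(\<Sum>k\<in>?J. (c k)\<^sup>2) = (\<Sum>is\<in>multi_idx N p. (chain (lab N) N w p is \<sigma>)\<^sup>2)"
    by (subst sum.reindex) (auto simp: c_def inj_on_def)
  also have "\<dots> \<le> (\<Sum>is\<in>multi_idx N p. (1 / sqrt (real N) ^ p)\<^sup>2)"
    using e W_sub \<sigma> unfolding e_eq
    by (intro sum_mono) (metis (no_types, lifting) SigmaD1 chain_abs_le power2_abs abs_ge_zero power_mono)
  also have "\<dots> = 1"
    using N_pos by (simp add: card_multi_idx power_divide power2_eq_square power_mult_distrib[symmetric])
  finally have v: "(\<integral>g. (h_wp lab N (fst e) (snd e) g \<sigma>)\<^sup>2 \<partial>P) \<le> 1"
    using lin(3) by linarith
  have "(\<integral>g. \<bar>h_wp lab N (fst e) (snd e) g \<sigma>\<bar> \<partial>P) \<le> (\<integral>g. ((h_wp lab N (fst e) (snd e) g \<sigma>)\<^sup>2 + 1) / 2 \<partial>P)"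
  proof (rule integral_mono)
    show "\<bar>h_wp lab N (fst e) (snd e) g \<sigma>\<bar> \<le> ((h_wp lab N (fst e) (snd e) g \<sigma>)\<^sup>2 + 1) / 2" for g
      using sum_squares_bound[of "\<bar>h_wp lab N (fst e) (snd e) g \<sigma>\<bar>" 1] by simp
  qed (use 1 2 in auto)
  also have "\<dots> \<le> 1" using v 2 by (simp add: P.prob_space)
  finally show "(\<integral>g. \<bar>h_wp lab N (fst e) (snd e) g \<sigma>\<bar> \<partial>P) \<le> 1" .
qed

lemma H_SK_integrable: "integrable P (\<lambda>g. H_SK Delta2 lab N g \<sigma>)"
  unfolding H_SK_def using disorder_idx_memI(1)
  by (intro integrable_mult_right integrable_mult_left Bochner_Integration.integrable_sum coordinate_integrable) auto

lemma pert_term_moments: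
  assumes x: "\<And>e. e \<in> Idx \<Longrightarrow> \<bar>x e\<bar> \<le> 3" and e: "e \<in> Idx" and \<sigma>: "\<sigma> \<in> cfgs N"
  shows "integrable P (\<lambda>g. pert_term x g \<sigma> e)"
    and "(\<integral>g. \<bar>pert_term x g \<sigma> e\<bar> \<partial>P) \<le> 3 * coef e"
proof -
  show "integrable P (\<lambda>g. pert_term x g \<sigma> e)"
    unfolding pert_term_def using h_wp_moments(1)[OF e \<sigma>] by simp
  have "(\<integral>g. \<bar>pert_term x g \<sigma> e\<bar> \<partial>P) = coef e * \<bar>x e\<bar> * (\<integral>g. \<bar>h_wp lab N (fst e) (snd e) g \<sigma>\<bar> \<partial>P)"
    unfolding pert_term_def abs_mult using coef_pos[of e] by simp
  also have "\<dots> \<le> coef e * 3 * 1"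
    using x[OF e] h_wp_moments(3)[OF e \<sigma>] coef_pos[of e]
    by (intro mult_mono) (auto intro!: mult_nonneg_nonneg less_imp_le)
  finally show "(\<integral>g. \<bar>pert_term x g \<sigma> e\<bar> \<partial>P) \<le> 3 * coef e" by simp
qed

text \<open>The index set is left free for three uses: the whole series, the tail beyond a finite
  truncation, and the series with one term taken out.\<close>

lemma pert_series:
  assumes x: "\<And>e. e \<in> Idx \<Longrightarrow> \<bar>x e\<bar> \<le> 3" and X: "X \<subseteq> Idx" and \<sigma>: "\<sigma> \<in> cfgs N"
  shows "AE g in P. pert_term x g \<sigma> summable_on X"
    and "integrable P (\<lambda>g. infsum (pert_term x g \<sigma>) X)"
    and "(\<integral>g. \<bar>infsum (pert_term x g \<sigma>) X\<bar> \<partial>P) \<le> 3 * infsum coef X"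
proof -
  have c: "countable X" using countable_Idx X countable_subset by blast
  have s: "(\<lambda>e. 3 * coef e) summable_on X" by (intro summable_on_cmult_right coef_summable X)
  have i: "integrable P (\<lambda>g. pert_term x g \<sigma> e)" if "e \<in> X" for e
    using pert_term_moments(1)[where x=x] x \<sigma> that X by blast
  have b: "(\<integral>g. \<bar>pert_term x g \<sigma> e\<bar> \<partial>P) \<le> 3 * coef e" if "e \<in> X" for e
    using pert_term_moments(2)[where x=x] x \<sigma> that X by blast
  note rs = random_series[where f="\<lambda>e g. pert_term x g \<sigma> e" and M=P, OF c i b s]
  show "AE g in P. pert_term x g \<sigma> summable_on X" "integrable P (\<lambda>g. infsum (pert_term x g \<sigma>) X)"
    using rs(1,2) by simp_all
  have "infsum (\<lambda>e. 3 * coef e) X = 3 * infsum coef X"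
    by (rule infsum_cmult_right) (use coef_summable X in blast)
  then show "(\<integral>g. \<bar>infsum (pert_term x g \<sigma>) X\<bar> \<partial>P) \<le> 3 * infsum coef X"
    using rs(3) by simp
qed

end

section \<open>Replicas as a product system\<close>

lemma sum_PiE_remove:
  assumes "finite I" "l \<in> I"
  shows "(\<Sum>\<tau>\<in>PiE I (\<lambda>_. S). h \<tau>) = (\<Sum>\<sigma>\<in>S. \<Sum>\<tau>\<in>PiE (I - {l}) (\<lambda>_. S). h (\<tau>(l := \<sigma>)))"
proof -
  have "PiE I (\<lambda>_. S) = (\<lambda>(\<sigma>, \<tau>). \<tau>(l := \<sigma>)) ` (S \<times> PiE (I - {l}) (\<lambda>_. S))"
    using PiE_insert_eq[of l "I - {l}" "\<lambda>_. S"] assms(2) by (simp add: insert_absorb)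
  then show ?thesis
    using inj_combinator[of l "I - {l}" "\<lambda>_. S"]
    by (simp add: sum.reindex sum.cartesian_product case_prod_unfold)
qed

text \<open>The weight of a replica configuration is a product over replicas, so summing out replica
  \<open>l\<close>, which \<open>F\<close> does not see, factorises numerator and normalisation
  alike.\<close>

lemma gav_replica_factor:
  fixes H b :: "'c \<Rightarrow> real" and F :: "('i \<Rightarrow> 'c) \<Rightarrow> real"
  assumes I: "finite I" "l \<in> I" and S: "finite S" "S \<noteq> {}"
    and F: "\<And>\<tau> \<sigma>. F (\<tau>(l := \<sigma>)) = F \<tau>"
  defines "T \<equiv> PiE I (\<lambda>_. S)" and "HT \<equiv> (\<lambda>\<tau>. \<Sum>i\<in>I. H (\<tau> i))"
  shows "gav T HT (\<lambda>\<tau>. F \<tau> * b (\<tau> l)) = gav T HT F * gav S H b"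
proof -
  let ?T = "PiE (I - {l}) (\<lambda>_. S)" and ?E = "\<lambda>\<tau>. exp (\<Sum>i\<in>I - {l}. H (\<tau> i))"
  have HT: "HT (\<tau>(l := \<sigma>)) = H \<sigma> + (\<Sum>i\<in>I - {l}. H (\<tau> i))" for \<tau> \<sigma>
    unfolding HT_def using I by (subst sum.remove[of I l]) auto
  have num: "(\<Sum>\<tau>\<in>T. exp (HT \<tau>) * (F' \<tau> * b' (\<tau> l))) = (\<Sum>\<tau>\<in>?T. ?E \<tau> * F' \<tau>) * (\<Sum>\<sigma>\<in>S. exp (H \<sigma>) * b' \<sigma>)"
    if "\<And>\<tau> \<sigma>. F' (\<tau>(l := \<sigma>)) = F' \<tau>" for F' :: "('i \<Rightarrow> 'c) \<Rightarrow> real" and b' :: "'c \<Rightarrow> real"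
  proof -
    have "(\<Sum>\<tau>\<in>T. exp (HT \<tau>) * (F' \<tau> * b' (\<tau> l)))
      = (\<Sum>\<sigma>\<in>S. \<Sum>\<tau>\<in>?T. (exp (H \<sigma>) * b' \<sigma>) * (?E \<tau> * F' \<tau>))"
      unfolding T_def sum_PiE_remove[OF I] HT that by (simp add: exp_add mult_ac)
    then show ?thesis by (simp add: sum_product mult.commute)
  qed
  let ?Z = "\<Sum>\<sigma>\<in>S. exp (H \<sigma>)" and ?Z' = "\<Sum>\<tau>\<in>?T. ?E \<tau>"
  have Z: "?Z > 0" by (rule sum_exp_pos[OF S])
  have Z': "?Z' > 0"
    using I S by (intro sum_exp_pos finite_PiE) (auto simp: PiE_eq_empty_iff)
  show ?thesis
    unfolding gav_def
    using num[of F b] num[of F "\<lambda>_. 1"] num[of "\<lambda>_. 1" "\<lambda>_. 1"] F Z Z' by (simp add: divide_simps)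
qed

text \<open>A product of Gibbs weights is the Gibbs weight of the summed Hamiltonian. Several
  replicas thus form one finite Gibbs system, to which the derivative formula applies
  unchanged.\<close>

lemma gibbs_avg_eq_gav:
  assumes "G = (\<lambda>\<sigma>. exp (H \<sigma>) / (\<Sum>\<sigma>'\<in>cfgs N. exp (H \<sigma>')))"
  shows "gibbs_avg G N k F = gav (PiE {1..k} (\<lambda>_. cfgs N)) (\<lambda>\<tau>. \<Sum>l\<in>{1..k}. H (\<tau> l)) F"
proof -
  let ?Z = "\<Sum>\<sigma>\<in>cfgs N. exp (H \<sigma>)"
  have "(\<Sum>\<tau>\<in>PiE {1..k} (\<lambda>_. cfgs N). exp (\<Sum>l\<in>{1..k}. H (\<tau> l))) = ?Z ^ k"
    using prod_sum_PiE[of "{1..k}" "\<lambda>_. cfgs N" "\<lambda>_ \<sigma>. exp (H \<sigma>)"] finite_cfgs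
    by (simp add: exp_sum)
  then show ?thesis
    by (simp add: gibbs_avg_def gav_def assms prod_dividef exp_sum sum_divide_distrib)
qed

context perturbed_sk
begin

section \<open>The truncated Hamiltonian as a linear form, and concentration of the free
  energy\<close>

definition lin_coef where
  "lin_coef x \<sigma> k = (case k of
      Inl (i, i') \<Rightarrow> sqrt (Delta2 (lab N i) (lab N i')) * \<sigma> i * \<sigma> i' / sqrt (real N)
    | Inr (w, p, is) \<Rightarrow> sN * (coef (w, p) * x (w, p) * chain (lab N) N w p is \<sigma>))"

definition lin_bound where
  "lin_bound k = (case k of
      Inl (i, i') \<Rightarrow> sqrt (Delta2 (lab N i) (lab N i')) / sqrt (real N)
    | Inr (w, p, is) \<Rightarrow> 3 * sN * coef (w, p) / sqrt (real N) ^ p)"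

text \<open>All couplings of \<open>H_SK\<close> are kept, but only finitely many perturbation
  terms, since concentration is available for finitely many Gaussians.\<close>

definition lin_idx :: "(('s \<Rightarrow> real) \<times> nat) set \<Rightarrow> ((nat \<times> nat) + (('s \<Rightarrow> real) \<times> nat \<times> nat list)) set" where
  "lin_idx F = Inl ` ({..<N} \<times> {..<N}) \<union> (\<lambda>(e, is). Inr (fst e, snd e, is)) ` Sigma F (\<lambda>e. multi_idx N (snd e))"

lemma finite_lin_idx: "finite F \<Longrightarrow> finite (lin_idx F)"
  unfolding lin_idx_def using finite_multi_idx by auto

lemma lin_idx_subset: "F \<subseteq> Idx \<Longrightarrow> lin_idx F \<subseteq> disorder_idx W N"
  unfolding lin_idx_def using disorder_idx_memI by fastforce

lemma sum_lin_idx: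
  fixes h :: "_ \<Rightarrow> real"
  assumes "finite F"
  shows "(\<Sum>k\<in>lin_idx F. h k) = (\<Sum>i<N. \<Sum>i'<N. h (Inl (i, i'))) + (\<Sum>e\<in>F. \<Sum>is\<in>multi_idx N (snd e). h (Inr (fst e, snd e, is)))"
proof -
  let ?J1 = "Inl ` ({..<N} \<times> {..<N})" and ?J2 = "(\<lambda>(e, is). Inr (fst e, snd e, is)) ` Sigma F (\<lambda>e. multi_idx N (snd e))"
  have fin: "finite (Sigma F (\<lambda>e. multi_idx N (snd e)))" using assms finite_multi_idx by auto
  have "(\<Sum>k\<in>lin_idx F. h k) = (\<Sum>k\<in>?J1. h k) + (\<Sum>k\<in>?J2. h k)"
    unfolding lin_idx_def using fin by (intro sum.union_disjoint) auto
  also have "(\<Sum>k\<in>?J1. h k) = (\<Sum>i<N. \<Sum>i'<N. h (Inl (i, i')))"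
    by (subst sum.reindex) (auto simp: sum.cartesian_product case_prod_unfold)
  also have "(\<Sum>k\<in>?J2. h k) = (\<Sum>z\<in>Sigma F (\<lambda>e. multi_idx N (snd e)). h (Inr (fst (fst z), snd (fst z), snd z)))"
    by (subst sum.reindex) (auto simp: inj_on_def prod_eq_iff case_prod_unfold)
  also have "\<dots> = (\<Sum>e\<in>F. \<Sum>is\<in>multi_idx N (snd e). h (Inr (fst e, snd e, is)))"
    using sum.Sigma[OF assms, of "\<lambda>e. multi_idx N (snd e)" "\<lambda>e is. h (Inr (fst e, snd e, is))"] finite_multi_idx
    by (simp add: case_prod_unfold)
  finally show ?thesis .
qed

lemma truncated_hamiltonian_eq:
  assumes "finite F"
  shows "H_SK Delta2 lab N g \<sigma> + sN * (\<Sum>e\<in>F. pert_term x g \<sigma> e) = (\<Sum>k\<in>lin_idx F. lin_coef x \<sigma> k * g k)"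
proof -
  have "H_SK Delta2 lab N g \<sigma> = (\<Sum>i<N. \<Sum>i'<N. lin_coef x \<sigma> (Inl (i, i')) * g (Inl (i, i')))"
    by (simp add: H_SK_def lin_coef_def sum_distrib_left mult_ac)
  moreover have "sN * (\<Sum>e\<in>F. pert_term x g \<sigma> e) =
      (\<Sum>e\<in>F. \<Sum>is\<in>multi_idx N (snd e). lin_coef x \<sigma> (Inr (fst e, snd e, is)) * g (Inr (fst e, snd e, is)))"
    by (simp add: pert_term_def h_wp_eq lin_coef_def sum_distrib_left mult_ac)
  ultimately show ?thesis unfolding sum_lin_idx[OF assms] by simp
qed

text \<open>The \<open>N * N\<close> couplings of \<open>H_SK\<close> contribute at most
  \<open>C / N\<close> each. A perturbation term \<open>e\<close> contributes
  \<open>9 * sN\<^sup>2 * (coef e)\<^sup>2\<close>, because its \<open>N ^ p\<close> indices cancel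
  the normalisation; \<open>coef e \<le> 1\<close> removes one factor, and 36 is 9 times the total
  weight 4.\<close>

lemma sum_lin_bound_square:
  assumes F: "finite F" "F \<subseteq> Idx" and C: "\<And>s t. Delta2 s t \<le> C"
  shows "(\<Sum>k\<in>lin_idx F. (lin_bound k)\<^sup>2) \<le> (C + 36) * real N"
proof -
  have "(\<Sum>i<N. \<Sum>i'<N. (lin_bound (Inl (i, i')))\<^sup>2) \<le> (\<Sum>i<N. \<Sum>i'<N. C / real N)"
    using C Delta2_nonneg N_pos by (intro sum_mono) (simp add: lin_bound_def power_divide divide_right_mono)
  also have "\<dots> = C * real N" using N_pos by simp
  finally have 1: "(\<Sum>i<N. \<Sum>i'<N. (lin_bound (Inl (i, i')))\<^sup>2) \<le> C * real N" .
  have "(\<Sum>is\<in>multi_idx N (snd e). (lin_bound (Inr (fst e, snd e, is)))\<^sup>2) \<le> 9 * real N * coef e" for e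
  proof -
    have sq: "(sqrt (real N) ^ q)\<^sup>2 = real N ^ q" for q
      by (metis of_nat_0_le_iff power_commutes power_mult real_sqrt_pow2 mult.commute)
    have "(\<Sum>is\<in>multi_idx N (snd e). (lin_bound (Inr (fst e, snd e, is)))\<^sup>2) = 9 * sN\<^sup>2 * (coef e)\<^sup>2"
      using N_pos by (simp add: lin_bound_def card_multi_idx power_divide power_mult_distrib sq)
    also have "\<dots> \<le> 9 * real N * coef e"
      using sN_square_le coef_le_1[of e] coef_pos[of e]
      by (intro mult_mono) (auto simp: power2_eq_square mult_left_le_one_le less_imp_le)
    finally show ?thesis .
  qed
  then have "(\<Sum>e\<in>F. \<Sum>is\<in>multi_idx N (snd e). (lin_bound (Inr (fst e, snd e, is)))\<^sup>2) \<le> (\<Sum>e\<in>F. 9 * real N * coef e)"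
    by (rule sum_mono)
  also have "\<dots> = 9 * real N * sum coef F" by (simp add: sum_distrib_left)
  also have "\<dots> \<le> 9 * real N * 4" using sum_coef_le[OF F] by (intro mult_left_mono) auto
  finally have 2: "(\<Sum>e\<in>F. \<Sum>is\<in>multi_idx N (snd e). (lin_bound (Inr (fst e, snd e, is)))\<^sup>2) \<le> 9 * real N * 4" .
  show ?thesis unfolding sum_lin_idx[OF F(1)] by (rule order_trans[OF add_mono[OF 1 2]]) (simp add: algebra_simps)
qed

lemma lin_coef_abs_le:
  assumes x: "\<And>e. e \<in> Idx \<Longrightarrow> \<bar>x e\<bar> \<le> 3" and F: "F \<subseteq> Idx" and k: "k \<in> lin_idx F" and \<sigma>: "\<sigma> \<in> cfgs N"
  shows "\<bar>lin_coef x \<sigma> k\<bar> \<le> lin_bound k"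
proof (cases k)
  case (Inl ii)
  obtain i i' where ii: "ii = (i, i')" by (cases ii)
  then have "i < N" "i' < N" using k Inl by (auto simp: lin_idx_def)
  then show ?thesis
    using cfgs_abs[OF \<sigma>] Delta2_nonneg by (simp add: Inl ii lin_coef_def lin_bound_def abs_mult)
next
  case (Inr z)
  obtain w p "is" where z: "z = (w, p, is)" by (cases z)
  have e: "(w, p) \<in> Idx" and "is": "is \<in> multi_idx N p"
    using k F Inr z by (auto simp: lin_idx_def)
  have "\<bar>chain (lab N) N w p is \<sigma>\<bar> \<le> 1 / sqrt (real N) ^ p"
    using e W_sub by (intro chain_abs_le[OF \<sigma> "is"]) auto
  then have "sN * (coef (w, p) * \<bar>x (w, p)\<bar> * \<bar>chain (lab N) N w p is \<sigma>\<bar>) \<le> sN * (coef (w, p) * 3 * (1 / sqrt (real N) ^ p))"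
    using x[OF e] coef_pos[of "(w, p)"] sN_pos
    by (intro mult_left_mono mult_mono) auto
  then show ?thesis
    using coef_pos[of "(w, p)"] by (simp add: Inr z lin_coef_def lin_bound_def abs_mult mult_ac)
qed

lemma H_pert_eq: "H_pert Delta2 W j gamma lab N x g \<sigma> = H_SK Delta2 lab N g \<sigma> + sN * infsum (pert_term x g \<sigma>) Idx"
  by (simp add: H_pert_def h_pert_eq)

lemma H_pert_integrable:
  assumes "\<And>e. e \<in> Idx \<Longrightarrow> \<bar>x e\<bar> \<le> 3" "\<sigma> \<in> cfgs N"
  shows "integrable P (\<lambda>g. H_pert Delta2 W j gamma lab N x g \<sigma>)"
  unfolding H_pert_eq using H_SK_integrable pert_series(2)[where x=x and X=Idx] assms by simp

text \<open>The bound for the truncated model is uniform in the truncation \<open>F\<close>. Letting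
  \<open>F\<close> exhaust the series costs an arbitrary \<open>\<epsilon>\<close>: half for the L1
  distance of the free energies and half for the distance of their means.\<close>

lemma free_energy_concentration:
  assumes x: "\<And>e. e \<in> Idx \<Longrightarrow> \<bar>x e\<bar> \<le> 3" and C: "\<And>s t. Delta2 s t \<le> C"
  defines "\<phi> \<equiv> (\<lambda>g. lse (cfgs N) (H_pert Delta2 W j gamma lab N x g))"
  shows "(\<integral>g. \<bar>\<phi> g - (\<integral>g. \<phi> g \<partial>P)\<bar> \<partial>P) \<le> sqrt ((C + 36) * real N)"
proof (rule field_le_epsilon)
  fix \<epsilon> :: real assume \<epsilon>: "0 < \<epsilon>"
  let ?S = "cfgs N" and ?q = "sqrt ((C + 36) * real N)"
  \<comment> \<open>Chosen so that a weight tail of \<open>\<epsilon> / \<kappa>\<close> makes the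
    expected truncation error, summed over all configurations, exactly
    \<open>\<epsilon> / 2\<close>; the 3 is the bound on the couplings.\<close>
  define \<kappa> where "\<kappa> = 2 * (real (card ?S) * (sN * 3))"
  have C0: "0 \<le> C" using C Delta2_nonneg order_trans by blast
  have cardS: "0 < card ?S" using finite_cfgs cfgs_nonempty by (simp add: card_gt_0_iff)
  have \<kappa>: "0 < \<kappa>" using cardS sN_pos by (simp add: \<kappa>_def)
  have H_m [measurable]: "(\<lambda>g. H_pert Delta2 W j gamma lab N x g \<sigma>) \<in> borel_measurable P" if "\<sigma> \<in> ?S" for \<sigma>
    using H_pert_integrable[of x \<sigma>] x that by auto
  have \<phi>m [measurable]: "\<phi> \<in> borel_measurable P" unfolding \<phi>_def by measurable
  obtain F where F: "finite F" "F \<subseteq> Idx" "dist (sum coef F) (infsum coef Idx) \<le> \<epsilon> / \<kappa>"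
    using infsum_finite_approximation[OF coef_summable[of Idx], of "\<epsilon> / \<kappa>"] \<epsilon> \<kappa> by auto
  have split: "infsum f Idx = sum f F + infsum f (Idx - F)" if "f summable_on (Idx - F)" for f :: "_ \<Rightarrow> real"
    using infsum_Un_disjoint[of f F "Idx - F"] that F(1,2) by (simp add: Un_absorb1)
  have tail: "infsum coef (Idx - F) \<le> \<epsilon> / \<kappa>"
    using F(3) split[OF coef_summable] by (auto simp: dist_real_def)
  define HF where "HF g \<sigma> = (\<Sum>k\<in>lin_idx F. lin_coef x \<sigma> k * g k)" for g \<sigma>
  define \<phi>F where "\<phi>F g = lse ?S (HF g)" for g
  have q: "0 < ?q" using C0 N_pos by simp
  have FF: "integrable P \<phi>F \<and> (\<integral>g. \<bar>\<phi>F g - (\<integral>g. \<phi>F g \<partial>P)\<bar> \<partial>P) \<le> ?q"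
  proof -
    note lc = lse_linear_concentration[where J="lin_idx F" and I="disorder_idx W N" and S="?S"
        and c="\<lambda>k \<sigma>. lin_coef x \<sigma> k" and a=lin_bound and q="?q", folded P_eq]
    have "(\<Sum>k\<in>lin_idx F. (lin_bound k)\<^sup>2) \<le> ?q\<^sup>2"
      using sum_lin_bound_square[OF F(1,2) C] C0 by simp
    moreover have "\<bar>lin_coef x \<sigma> k\<bar> \<le> lin_bound k" if "k \<in> lin_idx F" "\<sigma> \<in> ?S" for k \<sigma>
      using lin_coef_abs_le[of x, OF x F(2) that] .
    ultimately show ?thesis
      unfolding \<phi>F_def HF_def
      using lc[OF finite_lin_idx[OF F(1)] lin_idx_subset[OF F(2)] finite_cfgs cfgs_nonempty _ q] by blast
  qed
  then have [measurable]: "\<phi>F \<in> borel_measurable P" by auto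
  have tl: "AE g in P. \<forall>\<sigma>\<in>?S. pert_term x g \<sigma> summable_on (Idx - F)"
    using x pert_series(1)[of x "Idx - F"] by (intro AE_finite_allI finite_cfgs) auto
  \<comment> \<open>The sum over configurations dominates the maximal tail and is visibly
    integrable.\<close>
  let ?R = "\<lambda>g. \<Sum>\<sigma>\<in>?S. sN * \<bar>infsum (pert_term x g \<sigma>) (Idx - F)\<bar>"
  have Ri: "integrable P (\<lambda>g. infsum (pert_term x g \<sigma>) (Idx - F))" if "\<sigma> \<in> ?S" for \<sigma>
    using pert_series(2)[of x "Idx - F"] x that by auto
  have Rint: "integrable P ?R"
    using Ri by (intro Bochner_Integration.integrable_sum) auto
  have diff: "AE g in P. \<bar>\<phi> g - \<phi>F g\<bar> \<le> ?R g"
    using tl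
  proof eventually_elim
    case (elim g)
    show ?case
      unfolding \<phi>_def \<phi>F_def
    proof (rule lse_Lipschitz[OF finite_cfgs cfgs_nonempty])
      fix \<sigma> assume \<sigma>: "\<sigma> \<in> ?S"
      have "H_pert Delta2 W j gamma lab N x g \<sigma> - HF g \<sigma> = sN * infsum (pert_term x g \<sigma>) (Idx - F)"
        unfolding HF_def truncated_hamiltonian_eq[OF F(1), symmetric] H_pert_eq
        using split[of "pert_term x g \<sigma>"] elim \<sigma> by (simp add: algebra_simps)
      then have "\<bar>H_pert Delta2 W j gamma lab N x g \<sigma> - HF g \<sigma>\<bar> = sN * \<bar>infsum (pert_term x g \<sigma>) (Idx - F)\<bar>"
        by (simp add: abs_mult)
      also have "\<dots> \<le> ?R g"
        using \<sigma> finite_cfgs by (intro member_le_sum[of \<sigma> ?S "\<lambda>\<sigma>. sN * \<bar>infsum (pert_term x g \<sigma>) (Idx - F)\<bar>"]) auto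
      finally show "\<bar>H_pert Delta2 W j gamma lab N x g \<sigma> - HF g \<sigma>\<bar> \<le> ?R g" .
    qed
  qed
  have "(\<integral>g. ?R g \<partial>P) = (\<Sum>\<sigma>\<in>?S. sN * (\<integral>g. \<bar>infsum (pert_term x g \<sigma>) (Idx - F)\<bar> \<partial>P))"
    using Ri by (subst Bochner_Integration.integral_sum) auto
  also have "\<dots> \<le> (\<Sum>\<sigma>\<in>?S. sN * (3 * (\<epsilon> / \<kappa>)))"
  proof (intro sum_mono mult_left_mono)
    fix \<sigma> assume "\<sigma> \<in> ?S"
    then show "(\<integral>g. \<bar>infsum (pert_term x g \<sigma>) (Idx - F)\<bar> \<partial>P) \<le> 3 * (\<epsilon> / \<kappa>)"
      using pert_series(3)[of x "Idx - F" \<sigma>] x tail by fastforce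
  qed (use sN_pos in auto)
  also have "\<dots> = \<epsilon> / 2" using \<kappa> cardS sN_pos by (simp add: \<kappa>_def)
  finally have R: "(\<integral>g. ?R g \<partial>P) \<le> \<epsilon> / 2" .
  have dint: "integrable P (\<lambda>g. \<phi> g - \<phi>F g)"
    by (rule Bochner_Integration.integrable_bound[OF Rint]) (use diff in \<open>auto elim: eventually_mono\<close>)
  have d: "(\<integral>g. \<bar>\<phi> g - \<phi>F g\<bar> \<partial>P) \<le> \<epsilon> / 2"
    using integral_mono_AE[OF _ Rint diff] dint R by auto
  have \<phi>i: "integrable P \<phi>"
    using Bochner_Integration.integrable_add[OF dint, of \<phi>F] FF by simp
  define m mF where "m = (\<integral>g. \<phi> g \<partial>P)" and "mF = (\<integral>g. \<phi>F g \<partial>P)"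
  have "m - mF = (\<integral>g. \<phi> g - \<phi>F g \<partial>P)" using \<phi>i FF by (simp add: m_def mF_def)
  then have mm: "\<bar>m - mF\<bar> \<le> \<epsilon> / 2"
    using integral_abs_bound[of P "\<lambda>g. \<phi> g - \<phi>F g"] d by linarith
  have "(\<integral>g. \<bar>\<phi> g - m\<bar> \<partial>P) \<le> (\<integral>g. \<bar>\<phi>F g - mF\<bar> + \<bar>\<phi> g - \<phi>F g\<bar> + \<bar>m - mF\<bar> \<partial>P)"
    using \<phi>i FF by (intro integral_mono) auto
  also have "\<dots> = (\<integral>g. \<bar>\<phi>F g - mF\<bar> \<partial>P) + (\<integral>g. \<bar>\<phi> g - \<phi>F g\<bar> \<partial>P) + \<bar>m - mF\<bar>"
    using \<phi>i FF by (simp add: P.prob_space)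
  also have "\<dots> \<le> ?q + \<epsilon> / 2 + \<epsilon> / 2"
    using FF d mm by (intro add_mono) (auto simp: mF_def)
  finally show "(\<integral>g. \<bar>\<phi> g - (\<integral>g. \<phi> g \<partial>P)\<bar> \<partial>P) \<le> ?q + \<epsilon>" by (simp add: m_def)
qed

end

section \<open>Gaussian integration by parts for the Gibbs measure\<close>

context perturbed_sk
begin

text \<open>For \<open>e = (w, p)\<close>, splitting off the term of \<open>h_pert\<close> with coupling \<open>u = x e\<close> leaves
  \<open>H_pert = rest_ham + u * spin_ham\<close>. This holds only almost surely: where the series of \<open>h_pert\<close>
  does not converge, \<open>infsum\<close> is \<open>0\<close>.\<close>

definition rest_ham where
  "rest_ham e x g \<sigma> = H_SK Delta2 lab N g \<sigma> + sN * infsum (pert_term x g \<sigma>) (Idx - {e})"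

definition spin_ham where
  "spin_ham e g \<sigma> = sN * coef e * h_wp lab N (fst e) (snd e) g \<sigma>"

definition spin_coef where
  "spin_coef e is \<sigma> = sN * coef e * chain (lab N) N (fst e) (snd e) is \<sigma>"

abbreviation ham where
  "ham e x u g \<sigma> \<equiv> rest_ham e x g \<sigma> + u * spin_ham e g \<sigma>"

abbreviation reps :: "nat \<Rightarrow> (nat \<Rightarrow> nat \<Rightarrow> real) set" where
  "reps n \<equiv> PiE {1..n} (\<lambda>_. cfgs N)"

abbreviation rep_ham where
  "rep_ham e x u n g \<tau> \<equiv> \<Sum>l\<in>{1..n}. ham e x u g (\<tau> l)"

definition rep_avg where
  "rep_avg e x u n F = (\<integral>g. gav (reps n) (rep_ham e x u n g) F \<partial>P)"

lemma reps_finite: "finite (reps n)"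
  by (intro finite_PiE finite_cfgs) auto

lemma reps_nonempty: "reps n \<noteq> {}"
  using cfgs_nonempty by (auto simp: PiE_eq_empty_iff)

lemma spin_ham_eq: "spin_ham e g \<sigma> = (\<Sum>is\<in>multi_idx N (snd e). spin_coef e is \<sigma> * g (Inr (fst e, snd e, is)))"
  by (simp add: spin_ham_def spin_coef_def h_wp_eq sum_distrib_left mult.assoc)

lemma rest_ham_integrable:
  assumes "\<forall>e\<in>Idx. \<bar>x e\<bar> \<le> 3" "\<sigma> \<in> cfgs N"
  shows "integrable P (\<lambda>g. rest_ham e x g \<sigma>)"
  unfolding rest_ham_def using H_SK_integrable pert_series(2)[where x=x and X="Idx - {e}"] assms by simp

lemma spin_ham_integrable:
  assumes "e \<in> Idx" "\<sigma> \<in> cfgs N"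
  shows "integrable P (\<lambda>g. spin_ham e g \<sigma>)" "integrable P (\<lambda>g. (spin_ham e g \<sigma>)\<^sup>2)"
  unfolding spin_ham_def power_mult_distrib using h_wp_moments[OF assms] by auto

text \<open>Where the series over \<open>Idx - {e}\<close> converges, \<open>infsum\<close> splits
  off the term of \<open>e\<close>. That series does not involve the coupling of \<open>e\<close>,
  so changing it to \<open>u\<close> leaves \<open>rest_ham\<close> untouched.\<close>

lemma H_pert_fun_upd:
  assumes x: "\<forall>e\<in>Idx. \<bar>x e\<bar> \<le> 3" and e: "e \<in> Idx"
  shows "AE g in P. \<forall>\<sigma>\<in>cfgs N. H_pert Delta2 W j gamma lab N (x(e := u)) g \<sigma> = ham e x u g \<sigma>"
proof (intro AE_finite_allI finite_cfgs)
  fix \<sigma> assume \<sigma>: "\<sigma> \<in> cfgs N"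
  have "AE g in P. pert_term x g \<sigma> summable_on (Idx - {e})"
    using x \<sigma> by (intro pert_series(1)) auto
  then show "AE g in P. H_pert Delta2 W j gamma lab N (x(e := u)) g \<sigma> = ham e x u g \<sigma>"
  proof eventually_elim
    case (elim g)
    let ?t = "pert_term (x(e := u)) g \<sigma>"
    have same: "?t e' = pert_term x g \<sigma> e'" if "e' \<in> Idx - {e}" for e'
      using that by (auto simp: pert_term_def)
    have s: "?t summable_on (Idx - {e})"
      by (rule iffD2[OF summable_on_cong elim]) (rule same)
    have "infsum ?t ({e} \<union> (Idx - {e})) = infsum ?t {e} + infsum ?t (Idx - {e})"
      using s by (intro infsum_Un_disjoint) auto
    moreover have "infsum ?t (Idx - {e}) = infsum (pert_term x g \<sigma>) (Idx - {e})"
      using same by (rule infsum_cong)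
    moreover have "{e} \<union> (Idx - {e}) = Idx" using e by blast
    ultimately have "infsum ?t Idx = coef e * u * h_wp lab N (fst e) (snd e) g \<sigma> + infsum (pert_term x g \<sigma>) (Idx - {e})"
      by (simp add: pert_term_def)
    then show ?case
      unfolding H_pert_eq rest_ham_def spin_ham_def by (simp add: algebra_simps)
  qed
qed

lemma rep_ham_measurable [measurable]:
  assumes "\<forall>e\<in>Idx. \<bar>x e\<bar> \<le> 3" "e \<in> Idx" "\<tau> \<in> reps n"
  shows "(\<lambda>g. rep_ham e x u n g \<tau>) \<in> borel_measurable P"
proof -
  have "(\<lambda>g. ham e x u g (\<tau> l)) \<in> borel_measurable P" if "l \<in> {1..n}" for l
  proof -
    have "\<tau> l \<in> cfgs N" using assms(3) that by (rule PiE_mem)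
    then show ?thesis
      using rest_ham_integrable[OF assms(1), where \<sigma>="\<tau> l"] spin_ham_integrable(1)[OF assms(2), of "\<tau> l"] by auto
  qed
  then show ?thesis by (rule borel_measurable_sum)
qed

lemma gav_bounded_sum: "finite T \<Longrightarrow> T \<noteq> {} \<Longrightarrow> \<bar>gav T H F\<bar> \<le> (\<Sum>\<tau>\<in>T. \<bar>F \<tau>\<bar>)"
  by (rule gav_bounded) (auto intro: member_le_sum[of _ T "\<lambda>\<tau>. \<bar>F \<tau>\<bar>"])

lemma gav_reps_measurable:
  assumes "\<forall>e\<in>Idx. \<bar>x e\<bar> \<le> 3" "e \<in> Idx"
  shows "(\<lambda>g. gav (reps n) (rep_ham e x u n g) F) \<in> borel_measurable P"
  using rep_ham_measurable[OF assms] by (intro measurable_gav) auto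

lemma gav_reps_integrable:
  assumes "\<forall>e\<in>Idx. \<bar>x e\<bar> \<le> 3" "e \<in> Idx"
  shows "integrable P (\<lambda>g. gav (reps n) (rep_ham e x u n g) F)"
  using gav_reps_measurable[OF assms] gav_bounded_sum[OF reps_finite reps_nonempty]
  by (intro P.integrable_const_bound[where B="\<Sum>\<tau>\<in>reps n. \<bar>F \<tau>\<bar>"]) auto

text \<open>Almost sure equality of the Hamiltonians suffices under the expectation. From here on
  the version that is affine at every point replaces \<open>H_pert\<close>.\<close>

lemma Egibbs_eq:
  assumes x: "\<forall>e\<in>Idx. \<bar>x e\<bar> \<le> 3" and e: "e \<in> Idx" and u: "\<bar>u\<bar> \<le> 3"
  shows "Egibbs Delta2 W j gamma lab N (x(e := u)) n F = rep_avg e x u n F"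
proof -
  let ?H = "H_pert Delta2 W j gamma lab N (x(e := u))"
  have G: "gibbs_avg (gibbs Delta2 W j gamma lab N (x(e := u)) g) N n F = gav (reps n) (\<lambda>\<tau>. \<Sum>l\<in>{1..n}. ?H g (\<tau> l)) F" for g
    by (rule gibbs_avg_eq_gav, rule ext, rule gibbs_def)
  have Hm: "(\<lambda>g. ?H g \<sigma>) \<in> borel_measurable P" if "\<sigma> \<in> cfgs N" for \<sigma>
    using H_pert_integrable[of "x(e := u)" \<sigma>] x u that by auto
  have "(\<lambda>g. \<Sum>l\<in>{1..n}. ?H g (\<tau> l)) \<in> borel_measurable P" if "\<tau> \<in> reps n" for \<tau>
    by (rule borel_measurable_sum) (use Hm that in \<open>blast dest: PiE_mem\<close>)
  then have m: "(\<lambda>g. gav (reps n) (\<lambda>\<tau>. \<Sum>l\<in>{1..n}. ?H g (\<tau> l)) F) \<in> borel_measurable P"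
    by (intro measurable_gav) auto
  show ?thesis
    unfolding Egibbs_def rep_avg_def G
  proof (rule integral_cong_AE[OF m gav_reps_measurable[OF x e]])
    show "AE g in P. gav (reps n) (\<lambda>\<tau>. \<Sum>l\<in>{1..n}. ?H g (\<tau> l)) F = gav (reps n) (rep_ham e x u n g) F"
      using H_pert_fun_upd[OF x e, of u]
    proof eventually_elim
      case (elim g)
      show ?case
      proof (rule gav_cong)
        fix \<tau> assume "\<tau> \<in> reps n"
        then have "\<tau> l \<in> cfgs N" if "l \<in> {1..n}" for l using that by (rule PiE_mem)
        then show "(\<Sum>l\<in>{1..n}. ?H g (\<tau> l)) = rep_ham e x u n g \<tau>"
          using elim by (intro sum.cong) auto
      qed simp
    qed
  qed
qed

text \<open>The Gaussian \<open>k\<close> belongs to the term \<open>e\<close>, which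
  \<open>rest_ham\<close> omits; its series is therefore unchanged, convergent or not, and the
  identity holds for every \<open>g\<close>. With base point 0 the parameter \<open>t\<close> is the
  coordinate itself.\<close>

lemma rep_ham_fun_upd:
  assumes "is \<in> multi_idx N (snd e)"
  defines "k \<equiv> Inr (fst e, snd e, is)"
  shows "rep_ham e x u n (g(k := t)) \<tau> = rep_ham e x u n (g(k := 0)) \<tau> + t * (u * (\<Sum>l\<in>{1..n}. spin_coef e is (\<tau> l)))"
proof -
  have rest_ham: "rest_ham e x (g(k := t)) \<sigma> = rest_ham e x g \<sigma>" for t \<sigma>
  proof -
    have "pert_term x (g(k := t)) \<sigma> e' = pert_term x g \<sigma> e'" if "e' \<in> Idx - {e}" for e'
    proof -
      have "fst e' \<noteq> fst e \<or> snd e' \<noteq> snd e" using that by (auto simp: prod_eq_iff)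
      then have "(Inr (fst e', snd e', is') :: (nat \<times> nat) + _) \<noteq> k" for is' by (auto simp: k_def)
      then show ?thesis by (simp add: pert_term_def h_wp_eq)
    qed
    then have "infsum (pert_term x (g(k := t)) \<sigma>) (Idx - {e}) = infsum (pert_term x g \<sigma>) (Idx - {e})"
      by (rule infsum_cong)
    moreover have "H_SK Delta2 lab N (g(k := t)) \<sigma> = H_SK Delta2 lab N g \<sigma>"
      by (simp add: H_SK_def k_def)
    ultimately show ?thesis by (simp add: rest_ham_def)
  qed
  have spin_ham: "spin_ham e (g(k := t)) \<sigma> = spin_ham e (g(k := 0)) \<sigma> + t * spin_coef e is \<sigma>" for \<sigma>
  proof -
    have "spin_coef e is' \<sigma> * (g(k := t)) (Inr (fst e, snd e, is')) =
      spin_coef e is' \<sigma> * (g(k := 0)) (Inr (fst e, snd e, is')) + (if is' = is then t * spin_coef e is \<sigma> else 0)" for is'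
      by (simp add: k_def)
    then show ?thesis
      unfolding spin_ham_eq using assms(1) finite_multi_idx by (simp only: sum.distrib sum.delta if_True)
  qed
  show ?thesis
    unfolding rest_ham spin_ham by (simp add: sum.distrib sum_distrib_left algebra_simps)
qed

text \<open>Averaging first over coordinate \<open>k\<close> reduces the claim to one Gaussian
  variable, in which the Gibbs average is a smooth function whose derivative is the covariance with
  \<open>a\<close>.\<close>

lemma reps_integration_by_parts:
  fixes u :: real and n :: nat
  assumes x: "\<forall>e\<in>Idx. \<bar>x e\<bar> \<le> 3" and e: "e \<in> Idx" and "is": "is \<in> multi_idx N (snd e)"
  defines "k \<equiv> Inr (fst e, snd e, is)" and "a \<equiv> (\<lambda>\<tau>. u * (\<Sum>l\<in>{1..n}. spin_coef e is (\<tau> l)))"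
  shows "integrable P (\<lambda>g. g k * gav (reps n) (rep_ham e x u n g) F)"
    and "(\<integral>g. g k * gav (reps n) (rep_ham e x u n g) F \<partial>P) =
      (\<integral>g. gav (reps n) (rep_ham e x u n g) (\<lambda>\<tau>. F \<tau> * a \<tau>)
          - gav (reps n) (rep_ham e x u n g) F * gav (reps n) (rep_ham e x u n g) a \<partial>P)"
proof -
  let ?G = "\<lambda>g. gav (reps n) (rep_ham e x u n g)"
  \<comment> \<open>The replica space is finite, so any \<open>F\<close> has Gibbs averages bounded
    independently of the Hamiltonian; the one-dimensional formula needs this for the function and
    its derivative.\<close>
  define C where "C F = (\<Sum>\<tau>\<in>reps n. \<bar>F \<tau>\<bar>)" for F :: "_ \<Rightarrow> real"
  have C: "\<bar>gav (reps n) H F\<bar> \<le> C F" for H F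
    unfolding C_def by (rule gav_bounded_sum[OF reps_finite reps_nonempty])
  have C0: "0 \<le> C F" for F by (simp add: C_def sum_nonneg)
  have kI: "k \<in> disorder_idx W N"
    unfolding k_def using e "is" by (intro disorder_idx_memI) auto
  have Gi: "integrable P (\<lambda>g. ?G g F)" for F by (rule gav_reps_integrable[OF x e])
  note Gm = gav_reps_measurable[OF x e, where n=n and u=u]
  show int: "integrable P (\<lambda>g. g k * ?G g F)"
  proof (rule Bochner_Integration.integrable_bound)
    show "integrable P (\<lambda>g. C F * g k)" using coordinate_integrable[OF kI] by simp
    show "AE g in P. norm (g k * ?G g F) \<le> norm (C F * g k)"
    proof (intro AE_I2)
      fix g
      have "\<bar>g k\<bar> * \<bar>?G g F\<bar> \<le> \<bar>g k\<bar> * C F" by (intro mult_left_mono C) simp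
      then show "norm (g k * ?G g F) \<le> norm (C F * g k)"
        using C0[of F] by (simp add: abs_mult mult.commute)
    qed
  qed (use Gm coordinate_measurable[OF kI] in auto)
  define \<Psi> where "\<Psi> g = ?G g (\<lambda>\<tau>. F \<tau> * a \<tau>) - ?G g F * ?G g a" for g
  have prod_le: "\<bar>gav (reps n) H F * gav (reps n) H a\<bar> \<le> C F * C a" for H
    unfolding abs_mult by (intro mult_mono C C0) auto
  have \<Psi>i: "integrable P \<Psi>"
  proof -
    have "integrable P (\<lambda>g. ?G g F * ?G g a)"
      using Gm prod_le by (intro P.integrable_const_bound[where B="C F * C a"]) auto
    then show ?thesis unfolding \<Psi>_def using Gi by auto
  qed
  have one: "(\<integral>t. t * ?G (g(k := t)) F \<partial>gauss) = (\<integral>t. \<Psi> (g(k := t)) \<partial>gauss)" for g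
  proof -
    let ?H = "rep_ham e x u n (g(k := 0))"
    have H: "rep_ham e x u n (g(k := t)) = (\<lambda>\<tau>. ?H \<tau> + t * a \<tau>)" for t
      unfolding k_def a_def using rep_ham_fun_upd[OF "is"] by blast
    note D = DERIV_gav[OF reps_finite reps_nonempty, where H="?H" and a=a]
    show ?thesis
      unfolding \<Psi>_def H
    proof (rule gauss_integration_by_parts)
      show "((\<lambda>t. gav (reps n) (\<lambda>\<tau>. ?H \<tau> + t * a \<tau>) F) has_real_derivative
        gav (reps n) (\<lambda>\<tau>. ?H \<tau> + t * a \<tau>) (\<lambda>\<tau>. F \<tau> * a \<tau>)
        - gav (reps n) (\<lambda>\<tau>. ?H \<tau> + t * a \<tau>) F * gav (reps n) (\<lambda>\<tau>. ?H \<tau> + t * a \<tau>) a) (at t)" for t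
        by (rule D)
      show "isCont (\<lambda>t. gav (reps n) (\<lambda>\<tau>. ?H \<tau> + t * a \<tau>) (\<lambda>\<tau>. F \<tau> * a \<tau>)
        - gav (reps n) (\<lambda>\<tau>. ?H \<tau> + t * a \<tau>) F * gav (reps n) (\<lambda>\<tau>. ?H \<tau> + t * a \<tau>) a) t" for t
        by (intro isCont_diff isCont_mult DERIV_isCont[OF D])
      show "\<bar>gav (reps n) (\<lambda>\<tau>. ?H \<tau> + t * a \<tau>) F\<bar> \<le> C F" for t by (rule C)
      show "\<bar>gav (reps n) (\<lambda>\<tau>. ?H \<tau> + t * a \<tau>) (\<lambda>\<tau>. F \<tau> * a \<tau>)
        - gav (reps n) (\<lambda>\<tau>. ?H \<tau> + t * a \<tau>) F * gav (reps n) (\<lambda>\<tau>. ?H \<tau> + t * a \<tau>) a\<bar>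
        \<le> C (\<lambda>\<tau>. F \<tau> * a \<tau>) + C F * C a" for t
        by (rule order_trans[OF abs_triangle_ineq4]) (intro add_mono C prod_le)
    qed
  qed
  have "(\<integral>g. g k * ?G g F \<partial>P) = (\<integral>g. \<integral>t. (g(k := t)) k * ?G (g(k := t)) F \<partial>gauss \<partial>P)"
    unfolding P_eq
    by (rule PiM_resample(2)[where \<Phi>="\<lambda>g. g k * ?G g F"]) (use kI int prob_space_gauss in \<open>auto simp: P_eq\<close>)
  also have "\<dots> = (\<integral>g. \<integral>t. \<Psi> (g(k := t)) \<partial>gauss \<partial>P)"
    using one by simp
  also have "\<dots> = (\<integral>g. \<Psi> g \<partial>P)"
    unfolding P_eq
    by (rule PiM_resample(2)[symmetric]) (use kI \<Psi>i prob_space_gauss in \<open>auto simp: P_eq\<close>)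
  finally show "(\<integral>g. g k * ?G g F \<partial>P) = (\<integral>g. ?G g (\<lambda>\<tau>. F \<tau> * a \<tau>) - ?G g F * ?G g a \<partial>P)"
    unfolding \<Psi>_def .
qed

abbreviation R where
  "R e \<sigma> \<tau> \<equiv> overlap_w lab N (fst e) \<sigma> \<tau> ^ snd e"

lemma sum_spin_coef_spin_coef:
  assumes "e \<in> Idx"
  shows "(\<Sum>is\<in>multi_idx N (snd e). spin_coef e is \<sigma> * spin_coef e is \<tau>) = (sN * coef e)\<^sup>2 * R e \<sigma> \<tau>"
proof -
  have "0 \<le> fst e s" for s using assms W_sub by auto
  from sum_chain_chain[where w="fst e", OF this]
  show ?thesis
    unfolding spin_coef_def by (simp add: sum_distrib_left[symmetric] power2_eq_square mult_ac)
qed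

lemma gav_reps_one:
  assumes "l \<in> {1..n}"
  shows "gav (reps n) (rep_ham e x u n g) (\<lambda>\<tau>. b (\<tau> l)) = gav (cfgs N) (ham e x u g) b"
  using gav_replica_factor[OF _ assms finite_cfgs cfgs_nonempty, where F="\<lambda>_. 1" and H="ham e x u g" and b=b]
    gav_const[OF reps_finite reps_nonempty, of n _ 1] by simp

text \<open>Since \<open>F\<close> ignores replica \<open>n + 1\<close>, the product of two Gibbs
  averages arising from the normalisation can be written as one average, with that replica serving
  as the independent copy.\<close>

lemma gibbs_integration_by_parts:
  assumes x: "\<forall>e\<in>Idx. \<bar>x e\<bar> \<le> 3" and e: "e \<in> Idx" and n: "1 \<le> n"
    and F: "\<And>\<tau> \<sigma>. F (\<tau>(Suc n := \<sigma>)) = F \<tau>"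
  shows "integrable P (\<lambda>g. gav (reps (Suc n)) (rep_ham e x u (Suc n) g) (\<lambda>\<tau>. F \<tau> * spin_ham e g (\<tau> 1)))"
    and "(\<integral>g. gav (reps (Suc n)) (rep_ham e x u (Suc n) g) (\<lambda>\<tau>. F \<tau> * spin_ham e g (\<tau> 1)) \<partial>P) =
    u * (sN * coef e)\<^sup>2 * rep_avg e x u (Suc n)
      (\<lambda>\<tau>. F \<tau> * ((\<Sum>l\<in>{1..n}. R e (\<tau> 1) (\<tau> l)) - real n * R e (\<tau> 1) (\<tau> (Suc n))))"
    (is "?L = ?R")
proof -
  let ?T = "reps (Suc n)" and ?M = "multi_idx N (snd e)"
  let ?G = "\<lambda>g. gav ?T (rep_ham e x u (Suc n) g)"
  let ?k = "\<lambda>is. Inr (fst e, snd e, is) :: (nat \<times> nat) + (('s \<Rightarrow> real) \<times> nat \<times> nat list)"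
  let ?Y = "\<lambda>\<tau>. (\<Sum>l\<in>{1..n}. R e (\<tau> 1) (\<tau> l)) - real n * R e (\<tau> 1) (\<tau> (Suc n))"
  define a where "a is \<tau> = u * (\<Sum>l\<in>{1..Suc n}. spin_coef e is (\<tau> l))" for "is" \<tau>
  define Fb where "Fb is \<tau> = F \<tau> * spin_coef e is (\<tau> 1)" for "is" \<tau>
  have lin: "?G g (\<lambda>\<tau>. F \<tau> * spin_ham e g (\<tau> 1)) = (\<Sum>is\<in>?M. g (?k is) * ?G g (Fb is))" for g
  proof -
    have "(\<lambda>\<tau>. F \<tau> * spin_ham e g (\<tau> 1)) = (\<lambda>\<tau>. \<Sum>is\<in>?M. g (?k is) * Fb is \<tau>)"
      by (simp add: spin_ham_eq Fb_def sum_distrib_left mult_ac)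
    then show ?thesis by (simp only: gav_sum gav_cmult)
  qed
  have pw: "(\<Sum>is\<in>?M. ?G g (\<lambda>\<tau>. Fb is \<tau> * a is \<tau>) - ?G g (Fb is) * ?G g (a is)) = u * (sN * coef e)\<^sup>2 * ?G g (\<lambda>\<tau>. F \<tau> * ?Y \<tau>)" for g
  proof -
    \<comment> \<open>The Hamiltonian contains \<open>n + 1\<close> replicas, so the normalisation
      contributes \<open>n + 1\<close> copies of the pairing of replicas 1 and \<open>n + 1\<close>.
      The direct term with \<open>l = n + 1\<close> cancels one of them, leaving
      \<open>n\<close>.\<close>
    have single: "?G g (\<lambda>\<tau>. Fb is \<tau> * a is \<tau>) - ?G g (Fb is) * ?G g (a is)
      = ?G g (\<lambda>\<tau>. u * (F \<tau> * ((\<Sum>l\<in>{1..n}. spin_coef e is (\<tau> 1) * spin_coef e is (\<tau> l)) - real n * (spin_coef e is (\<tau> 1) * spin_coef e is (\<tau> (Suc n))))))" for "is"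
    proof -
      have "?G g (a is) = u * (\<Sum>l\<in>{1..Suc n}. ?G g (\<lambda>\<tau>. spin_coef e is (\<tau> l)))"
        unfolding a_def gav_cmult gav_sum ..
      also have "\<dots> = u * (real (Suc n) * gav (cfgs N) (ham e x u g) (spin_coef e is))"
        using gav_reps_one[where n="Suc n" and b="spin_coef e is"] by simp
      finally have "?G g (Fb is) * ?G g (a is) = u * real (Suc n) * (?G g (Fb is) * gav (cfgs N) (ham e x u g) (spin_coef e is))"
        by simp
      also have "?G g (Fb is) * gav (cfgs N) (ham e x u g) (spin_coef e is) = ?G g (\<lambda>\<tau>. Fb is \<tau> * spin_coef e is (\<tau> (Suc n)))"
        using n F by (intro gav_replica_factor[symmetric] finite_cfgs cfgs_nonempty) (auto simp: Fb_def)
      finally have "?G g (\<lambda>\<tau>. Fb is \<tau> * a is \<tau>) - ?G g (Fb is) * ?G g (a is)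
        = ?G g (\<lambda>\<tau>. Fb is \<tau> * a is \<tau> - u * real (Suc n) * (Fb is \<tau> * spin_coef e is (\<tau> (Suc n))))"
        unfolding gav_diff gav_cmult by simp
      also have "(\<lambda>\<tau>. Fb is \<tau> * a is \<tau> - u * real (Suc n) * (Fb is \<tau> * spin_coef e is (\<tau> (Suc n)))) =
         (\<lambda>\<tau>. u * (F \<tau> * ((\<Sum>l\<in>{1..n}. spin_coef e is (\<tau> 1) * spin_coef e is (\<tau> l)) - real n * (spin_coef e is (\<tau> 1) * spin_coef e is (\<tau> (Suc n))))))"
        by (rule ext, simp add: Fb_def a_def sum_distrib_left[symmetric] algebra_simps)
          (simp add: sum_distrib_left mult.commute)
      finally show ?thesis .
    qed
    have "(\<Sum>is\<in>?M. u * (F \<tau> * ((\<Sum>l\<in>{1..n}. spin_coef e is (\<tau> 1) * spin_coef e is (\<tau> l)) - real n * (spin_coef e is (\<tau> 1) * spin_coef e is (\<tau> (Suc n))))))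
      = u * (sN * coef e)\<^sup>2 * (F \<tau> * ?Y \<tau>)" for \<tau>
    proof -
      have "(\<Sum>is\<in>?M. u * (F \<tau> * ((\<Sum>l\<in>{1..n}. spin_coef e is (\<tau> 1) * spin_coef e is (\<tau> l)) - real n * (spin_coef e is (\<tau> 1) * spin_coef e is (\<tau> (Suc n))))))
        = u * (F \<tau> * ((\<Sum>l\<in>{1..n}. \<Sum>is\<in>?M. spin_coef e is (\<tau> 1) * spin_coef e is (\<tau> l)) - real n * (\<Sum>is\<in>?M. spin_coef e is (\<tau> 1) * spin_coef e is (\<tau> (Suc n)))))"
      proof -
        have "(\<Sum>is\<in>?M. u * (F \<tau> * (a is - real n * b is))) = u * (F \<tau> * ((\<Sum>is\<in>?M. a is) - real n * (\<Sum>is\<in>?M. b is)))"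
          for a b :: "nat list \<Rightarrow> real"
          by (simp add: sum_distrib_left sum_subtractf right_diff_distrib)
        then show ?thesis by (simp only:) (subst sum.swap, rule refl)
      qed
      also have "\<dots> = u * (sN * coef e)\<^sup>2 * (F \<tau> * ?Y \<tau>)"
        unfolding sum_spin_coef_spin_coef[OF e] sum_distrib_left[symmetric] by (simp add: algebra_simps)
      finally show ?thesis .
    qed
    then show ?thesis unfolding single gav_sum[symmetric] by (simp only: gav_cmult)
  qed
  note ibp = reps_integration_by_parts[OF x e, where n="Suc n" and u=u, folded a_def]
  have Gi: "integrable P (\<lambda>g. ?G g F')" for F' by (rule gav_reps_integrable[OF x e])
  have i2: "integrable P (\<lambda>g. ?G g (\<lambda>\<tau>. Fb is \<tau> * a is \<tau>) - ?G g (Fb is) * ?G g (a is))" for "is"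
  proof -
    have "integrable P (\<lambda>g. ?G g (Fb is) * ?G g (a is))"
    proof (rule P.integrable_const_bound[where B="(\<Sum>\<tau>\<in>?T. \<bar>Fb is \<tau>\<bar>) * (\<Sum>\<tau>\<in>?T. \<bar>a is \<tau>\<bar>)"])
      show "AE g in P. norm (?G g (Fb is) * ?G g (a is)) \<le> (\<Sum>\<tau>\<in>?T. \<bar>Fb is \<tau>\<bar>) * (\<Sum>\<tau>\<in>?T. \<bar>a is \<tau>\<bar>)"
        unfolding real_norm_def abs_mult
        by (intro AE_I2 mult_mono gav_bounded_sum reps_finite reps_nonempty sum_nonneg) auto
    qed (intro borel_measurable_times gav_reps_measurable[OF x e])
    then show ?thesis using Gi by auto
  qed
  show "integrable P (\<lambda>g. ?G g (\<lambda>\<tau>. F \<tau> * spin_ham e g (\<tau> 1)))"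
    unfolding lin by (rule Bochner_Integration.integrable_sum) (rule ibp(1))
  have "?L = (\<Sum>is\<in>?M. \<integral>g. g (?k is) * ?G g (Fb is) \<partial>P)"
    unfolding lin by (rule Bochner_Integration.integral_sum) (rule ibp(1))
  also have "\<dots> = (\<Sum>is\<in>?M. \<integral>g. ?G g (\<lambda>\<tau>. Fb is \<tau> * a is \<tau>) - ?G g (Fb is) * ?G g (a is) \<partial>P)"
    by (rule sum.cong[OF refl]) (rule ibp(2))
  also have "\<dots> = (\<integral>g. (\<Sum>is\<in>?M. ?G g (\<lambda>\<tau>. Fb is \<tau> * a is \<tau>) - ?G g (Fb is) * ?G g (a is)) \<partial>P)"
    by (rule Bochner_Integration.integral_sum[symmetric]) (rule i2)
  also have "\<dots> = u * (sN * coef e)\<^sup>2 * rep_avg e x u (Suc n) (\<lambda>\<tau>. F \<tau> * ?Y \<tau>)"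
    unfolding pw rep_avg_def by simp
  finally show "?L = ?R" .
qed

end

section \<open>Ghirlanda--Guerra identities\<close>

context perturbed_sk
begin

lemma overlap_w_abs_le:
  assumes "\<sigma> \<in> cfgs N" "\<tau> \<in> cfgs N" "\<And>s. 0 \<le> w s \<and> w s \<le> 1"
  shows "\<bar>overlap_w lab N w \<sigma> \<tau>\<bar> \<le> 1"
proof -
  have "\<bar>\<Sum>i<N. w (lab N i) * \<sigma> i * \<tau> i\<bar> \<le> (\<Sum>i<N. \<bar>w (lab N i) * \<sigma> i * \<tau> i\<bar>)"
    by (rule sum_abs)
  also have "\<dots> \<le> (\<Sum>i<N. 1)"
    using cfgs_abs[OF assms(1)] cfgs_abs[OF assms(2)] assms(3)
    by (intro sum_mono) (simp add: abs_mult)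
  finally show ?thesis using N_pos by (simp add: overlap_w_eq)
qed

lemma R_abs_le:
  assumes "e \<in> Idx" "\<sigma> \<in> cfgs N" "\<tau> \<in> cfgs N"
  shows "\<bar>R e \<sigma> \<tau>\<bar> \<le> 1"
proof -
  have "0 \<le> fst e s \<and> fst e s \<le> 1" for s using assms(1) W_sub by auto
  then have "\<bar>overlap_w lab N (fst e) \<sigma> \<tau>\<bar> \<le> 1" by (intro overlap_w_abs_le assms)
  then show ?thesis by (simp add: power_abs power_le_one)
qed

text \<open>The overlap power of a configuration with itself: as spins square to 1 it is
  deterministic. Hence it factors out of averages and cancels in the identities.\<close>

definition self_overlap where
  "self_overlap e = ((\<Sum>i<N. fst e (lab N i)) / real N) ^ snd e"

lemma R_self: "\<sigma> \<in> cfgs N \<Longrightarrow> R e \<sigma> \<sigma> = self_overlap e"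
  unfolding overlap_w_eq self_overlap_def using cfgs_square[of \<sigma> N] by (simp add: mult.assoc)

lemma rep_avg_cong: "(\<And>\<tau>. \<tau> \<in> reps n \<Longrightarrow> F \<tau> = F' \<tau>) \<Longrightarrow> rep_avg e x u n F = rep_avg e x u n F'"
  unfolding rep_avg_def by (intro Bochner_Integration.integral_cong refl gav_cong)

lemma rep_avg_const: "rep_avg e x u n (\<lambda>_. c) = c"
  unfolding rep_avg_def gav_const[OF reps_finite reps_nonempty] by (simp add: P.prob_space)

lemma rep_avg_cmult: "rep_avg e x u n (\<lambda>\<tau>. c * F \<tau>) = c * rep_avg e x u n F"
  unfolding rep_avg_def gav_cmult by simp

lemma rep_avg_diff:
  assumes "\<forall>e\<in>Idx. \<bar>x e\<bar> \<le> 3" "e \<in> Idx"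
  shows "rep_avg e x u n (\<lambda>\<tau>. F \<tau> - F' \<tau>) = rep_avg e x u n F - rep_avg e x u n F'"
  unfolding rep_avg_def gav_diff by (intro Bochner_Integration.integral_diff gav_reps_integrable assms)

lemma rep_avg_sum:
  assumes "\<forall>e\<in>Idx. \<bar>x e\<bar> \<le> 3" "e \<in> Idx"
  shows "rep_avg e x u n (\<lambda>\<tau>. \<Sum>i\<in>I. F i \<tau>) = (\<Sum>i\<in>I. rep_avg e x u n (F i))"
  unfolding rep_avg_def gav_sum by (intro Bochner_Integration.integral_sum gav_reps_integrable assms)

lemma rep_avg_abs_le:
  assumes "\<forall>e\<in>Idx. \<bar>x e\<bar> \<le> 3" "e \<in> Idx" "\<And>\<tau>. \<tau> \<in> reps n \<Longrightarrow> \<bar>F \<tau>\<bar> \<le> C"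
  shows "\<bar>rep_avg e x u n F\<bar> \<le> C"
proof -
  have "\<bar>rep_avg e x u n F\<bar> \<le> (\<integral>g. \<bar>gav (reps n) (rep_ham e x u n g) F\<bar> \<partial>P)"
    unfolding rep_avg_def by (rule integral_abs_bound)
  also have "\<dots> \<le> (\<integral>g. C \<partial>P)"
    by (intro integral_mono Bochner_Integration.integrable_abs gav_reps_integrable[OF assms(1,2)]
        P.integrable_const gav_bounded[OF reps_finite reps_nonempty] assms(3))
  finally show ?thesis by (simp add: P.prob_space)
qed

text \<open>Exchangeability without permuting replicas: expanded over index lists, the average for
  replicas 1 and \<open>l\<close> is a sum of squared one-replica averages, in which
  \<open>l\<close> no longer occurs. The common positive factor is then cancelled.\<close>

lemma rep_avg_exchange:
  assumes e: "e \<in> Idx" and l: "l \<in> {2..n}"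
  shows "rep_avg e x u n (\<lambda>\<tau>. R e (\<tau> 1) (\<tau> l)) = rep_avg e x u n (\<lambda>\<tau>. R e (\<tau> 1) (\<tau> 2))"
proof -
  have "(sN * coef e)\<^sup>2 * gav (reps n) (rep_ham e x u n g) (\<lambda>\<tau>. R e (\<tau> 1) (\<tau> l))
      = (\<Sum>is\<in>multi_idx N (snd e). (gav (cfgs N) (ham e x u g) (spin_coef e is))\<^sup>2)" if l: "l \<in> {2..n}" for g l
  proof -
    have "gav (reps n) (rep_ham e x u n g) (\<lambda>\<tau>. spin_coef e is (\<tau> 1) * spin_coef e is (\<tau> l)) = (gav (cfgs N) (ham e x u g) (spin_coef e is))\<^sup>2" for "is"
    proof -
      have "gav (reps n) (rep_ham e x u n g) (\<lambda>\<tau>. spin_coef e is (\<tau> 1) * spin_coef e is (\<tau> l))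
        = gav (reps n) (rep_ham e x u n g) (\<lambda>\<tau>. spin_coef e is (\<tau> 1)) * gav (cfgs N) (ham e x u g) (spin_coef e is)"
        using l by (intro gav_replica_factor finite_cfgs cfgs_nonempty) auto
      also have "gav (reps n) (rep_ham e x u n g) (\<lambda>\<tau>. spin_coef e is (\<tau> 1)) = gav (cfgs N) (ham e x u g) (spin_coef e is)"
        using l by (intro gav_reps_one) auto
      finally show ?thesis by (simp add: power2_eq_square)
    qed
    then show ?thesis
      unfolding gav_cmult[symmetric] sum_spin_coef_spin_coef[OF e, symmetric] gav_sum by simp
  qed
  note * = this
  have "(sN * coef e)\<^sup>2 * gav (reps n) (rep_ham e x u n g) (\<lambda>\<tau>. R e (\<tau> 1) (\<tau> l))
    = (sN * coef e)\<^sup>2 * gav (reps n) (rep_ham e x u n g) (\<lambda>\<tau>. R e (\<tau> 1) (\<tau> 2))" for g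
    unfolding *[OF l] by (rule *[symmetric]) (use l in auto)
  moreover have "(sN * coef e)\<^sup>2 \<noteq> 0" using sN_pos coef_pos[of e] by simp
  ultimately show ?thesis unfolding rep_avg_def by simp
qed

lemma sum_atLeastAtMost_one: "1 \<le> n \<Longrightarrow> (\<Sum>l\<in>{1..n}. h l) = h 1 + (\<Sum>l\<in>{2..n}. h l :: real)" for n :: nat
  by (simp add: sum.atLeast_Suc_atMost numeral_2_eq_2)

text \<open>Integration by parts with \<open>F\<close> constantly 1: the overlaps with replicas 2 to
  \<open>n\<close> have equal averages, so \<open>n - 1\<close> of them minus \<open>n\<close> leave
  one negative copy. The system has \<open>n + 1\<close> replicas so that the same average as in
  \<open>Delta_q\<close> appears.\<close>

lemma mean_spin_ham:
  assumes x: "\<forall>e\<in>Idx. \<bar>x e\<bar> \<le> 3" and e: "e \<in> Idx" and n: "1 \<le> n"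
  shows "(\<integral>g. gav (cfgs N) (ham e x u g) (spin_ham e g) \<partial>P)
    = u * (sN * coef e)\<^sup>2 * (self_overlap e - rep_avg e x u (Suc n) (\<lambda>\<tau>. R e (\<tau> 1) (\<tau> 2)))"
proof -
  let ?r = "rep_avg e x u (Suc n) (\<lambda>\<tau>. R e (\<tau> 1) (\<tau> 2))"
  have ex: "rep_avg e x u (Suc n) (\<lambda>\<tau>. R e (\<tau> 1) (\<tau> l)) = ?r" if "l \<in> {2..Suc n}" for l
    using e that by (rule rep_avg_exchange)
  have self: "rep_avg e x u (Suc n) (\<lambda>\<tau>. R e (\<tau> 1) (\<tau> 1)) = self_overlap e"
  proof -
    have "rep_avg e x u (Suc n) (\<lambda>\<tau>. R e (\<tau> 1) (\<tau> 1)) = rep_avg e x u (Suc n) (\<lambda>_. self_overlap e)"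
      by (intro rep_avg_cong R_self) (rule PiE_mem, assumption, simp)
    then show ?thesis by (simp add: rep_avg_const)
  qed
  have "(\<integral>g. gav (cfgs N) (ham e x u g) (spin_ham e g) \<partial>P)
    = (\<integral>g. gav (reps (Suc n)) (rep_ham e x u (Suc n) g) (\<lambda>\<tau>. 1 * spin_ham e g (\<tau> 1)) \<partial>P)"
    unfolding mult_1 by (subst gav_reps_one) auto
  also have "\<dots> = u * (sN * coef e)\<^sup>2 * rep_avg e x u (Suc n)
      (\<lambda>\<tau>. 1 * ((\<Sum>l\<in>{1..n}. R e (\<tau> 1) (\<tau> l)) - real n * R e (\<tau> 1) (\<tau> (Suc n))))"
    by (rule gibbs_integration_by_parts(2)[OF x e n]) simp
  also have "rep_avg e x u (Suc n) (\<lambda>\<tau>. 1 * ((\<Sum>l\<in>{1..n}. R e (\<tau> 1) (\<tau> l)) - real n * R e (\<tau> 1) (\<tau> (Suc n))))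
     = (\<Sum>l\<in>{1..n}. rep_avg e x u (Suc n) (\<lambda>\<tau>. R e (\<tau> 1) (\<tau> l))) - real n * rep_avg e x u (Suc n) (\<lambda>\<tau>. R e (\<tau> 1) (\<tau> (Suc n)))"
    unfolding mult_1 rep_avg_diff[OF x e] rep_avg_sum[OF x e] rep_avg_cmult ..
  also have "\<dots> = self_overlap e + (\<Sum>l\<in>{2..n}. ?r) - real n * ?r"
  proof -
    have "(\<Sum>l\<in>{2..n}. rep_avg e x u (Suc n) (\<lambda>\<tau>. R e (\<tau> 1) (\<tau> l))) = (\<Sum>l\<in>{2..n}. ?r)"
      by (rule sum.cong[OF refl], rule ex) auto
    moreover have "rep_avg e x u (Suc n) (\<lambda>\<tau>. R e (\<tau> 1) (\<tau> (Suc n))) = ?r"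
      using n by (intro ex) auto
    ultimately show ?thesis unfolding sum_atLeastAtMost_one[OF n] self by (simp only:)
  qed
  also have "\<dots> = self_overlap e - ?r" using n by (simp add: algebra_simps of_nat_diff)
  finally show ?thesis .
qed

text \<open>The constant is 3 for the coupling times 2 for the difference of two quantities bounded
  by 1.\<close>

lemma mean_spin_ham_abs_le:
  assumes x: "\<forall>e\<in>Idx. \<bar>x e\<bar> \<le> 3" and e: "e \<in> Idx" and u: "0 \<le> u" "u \<le> 3"
  shows "\<bar>\<integral>g. gav (cfgs N) (ham e x u g) (spin_ham e g) \<partial>P\<bar> \<le> 6 * sN\<^sup>2"
proof -
  let ?r = "rep_avg e x u (Suc 1) (\<lambda>\<tau>. R e (\<tau> 1) (\<tau> 2))"
  obtain \<sigma> where "\<sigma> \<in> cfgs N" using cfgs_nonempty by blast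
  then have 1: "\<bar>self_overlap e\<bar> \<le> 1" using R_abs_le[OF e, of \<sigma> \<sigma>] R_self by simp
  have 2: "\<bar>?r\<bar> \<le> 1"
    by (intro rep_avg_abs_le[OF x e] R_abs_le[OF e]) (rule PiE_mem, assumption, simp)+
  have c: "(sN * coef e)\<^sup>2 \<le> sN\<^sup>2"
    using coef_le_1[of e] coef_pos[of e] sN_pos by (intro power_mono) (auto simp: mult_left_le)
  have "\<bar>u * (sN * coef e)\<^sup>2 * (self_overlap e - ?r)\<bar> \<le> 3 * sN\<^sup>2 * 2"
    unfolding abs_mult using u c 1 2 by (intro mult_mono) auto
  then show ?thesis unfolding mean_spin_ham[OF x e order_refl] by simp
qed

lemma free_energy_concentration_ham:
  assumes x: "\<forall>e\<in>Idx. \<bar>x e\<bar> \<le> 3" and e: "e \<in> Idx" and u: "\<bar>u\<bar> \<le> 3" and C: "\<And>s t. Delta2 s t \<le> C"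
  shows "(\<integral>g. \<bar>lse (cfgs N) (ham e x u g) - (\<integral>g. lse (cfgs N) (ham e x u g) \<partial>P)\<bar> \<partial>P) \<le> sqrt ((C + 36) * real N)"
proof -
  let ?\<phi> = "\<lambda>g. lse (cfgs N) (H_pert Delta2 W j gamma lab N (x(e := u)) g)"
  let ?\<phi>' = "\<lambda>g. lse (cfgs N) (ham e x u g)"
  have m: "?\<phi> \<in> borel_measurable P"
    using H_pert_integrable[of "x(e := u)"] x u by (intro measurable_lse) auto
  have "(\<lambda>g. ham e x u g \<sigma>) \<in> borel_measurable P" if "\<sigma> \<in> cfgs N" for \<sigma>
    using rest_ham_integrable[OF x that, of e] spin_ham_integrable(1)[OF e that] by auto
  then have m': "?\<phi>' \<in> borel_measurable P" by (rule measurable_lse)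
  have ae: "AE g in P. ?\<phi> g = ?\<phi>' g"
    using H_pert_fun_upd[OF x e, of u] by eventually_elim (simp add: lse_def)
  have eq: "(\<integral>g. ?\<phi> g \<partial>P) = (\<integral>g. ?\<phi>' g \<partial>P)"
    by (rule integral_cong_AE[OF m m' ae])
  have "(\<integral>g. \<bar>?\<phi>' g - (\<integral>g. ?\<phi>' g \<partial>P)\<bar> \<partial>P) = (\<integral>g. \<bar>?\<phi> g - (\<integral>g. ?\<phi> g \<partial>P)\<bar> \<partial>P)"
    unfolding eq by (rule integral_cong_AE) (use m m' ae in auto)
  also have "\<dots> \<le> sqrt ((C + 36) * real N)"
    using x u C by (intro free_energy_concentration) auto
  finally show ?thesis .
qed

text \<open>The array stops at index \<open>n\<close>, so \<open>f\<close> of it is blind to the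
  extra replica, as the integration by parts over \<open>n + 1\<close> replicas requires.\<close>

lemma overlap_array_fun_upd: "overlap_array lab N n (\<tau>(Suc n := \<sigma>)) = overlap_array lab N n \<tau>"
  unfolding overlap_array_def by (rule restrict_ext) auto

text \<open>By Gaussian integration by parts \<open>Delta_q\<close> is the covariance of \<open>f\<close> with the perturbing
  Hamiltonian, divided by the variance \<open>n u (s_N 2^{-j(w)-p})^2\<close>.\<close>

lemma Delta_q_le:
  assumes x: "\<forall>e\<in>Idx. \<bar>x e\<bar> \<le> 3" and e: "(w, p) \<in> Idx" and u: "u \<in> {1..2}" and n: "2 \<le> n"
    and f: "\<And>y. \<bar>f y\<bar> \<le> B"
  defines "e \<equiv> (w, p)"
  shows "Delta_q Delta2 W j gamma lab N f n w p (x(e := u)) \<le> B / (sN * coef e)\<^sup>2 *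
    (\<integral>g. gav (cfgs N) (ham e x u g) (\<lambda>\<sigma>. \<bar>spin_ham e g \<sigma> - (\<integral>g. gav (cfgs N) (ham e x u g) (spin_ham e g) \<partial>P)\<bar>) \<partial>P)"
proof -
  have eI: "e \<in> Idx" using e by (simp add: e_def)
  let ?G = "\<lambda>g. gav (reps (Suc n)) (rep_ham e x u (Suc n) g)"
  define E where "E = rep_avg e x u (Suc n)"
  define fR where "fR \<tau> = f (overlap_array lab N n \<tau>)" for \<tau>
  define m where "m = (\<integral>g. gav (cfgs N) (ham e x u g) (spin_ham e g) \<partial>P)"
  define D where "D = Delta_q Delta2 W j gamma lab N f n w p (x(e := u))"
  define c where "c = (sN * coef e)\<^sup>2"
  define Q where "Q = (\<integral>g. gav (cfgs N) (ham e x u g) (\<lambda>\<sigma>. \<bar>spin_ham e g \<sigma> - m\<bar>) \<partial>P)"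
  define a where "a l = E (\<lambda>\<tau>. fR \<tau> * R e (\<tau> 1) (\<tau> l))" for l
  define r where "r = E (\<lambda>\<tau>. R e (\<tau> 1) (\<tau> 2))"
  have c0: "0 < c" using sN_pos coef_pos[of e] by (simp add: c_def)
  have B0: "0 \<le> B" using f order_trans[OF abs_ge_zero] by blast
  have Eg: "Egibbs Delta2 W j gamma lab N (x(e := u)) (n + 1) = E"
    unfolding E_def using Egibbs_eq[OF x eI, of u "Suc n"] u by auto
  have D: "D = \<bar>a (Suc n) - (1 / real n) * E fR * r - (1 / real n) * (\<Sum>l\<in>{2..n}. a l)\<bar>"
    unfolding D_def Delta_q_def Eg Let_def a_def r_def fR_def by (simp add: e_def)
  \<comment> \<open>The term \<open>l = 1\<close> of the integration by parts has no counterpart in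
    \<open>Delta_q\<close>; being deterministic, it will cancel against the self-overlap in
    \<open>m\<close>.\<close>
  have a1: "a 1 = self_overlap e * E fR"
  proof -
    have "a 1 = E (\<lambda>\<tau>. self_overlap e * fR \<tau>)"
      unfolding a_def E_def
    proof (rule rep_avg_cong)
      fix \<tau> assume "\<tau> \<in> reps (Suc n)"
      then have "\<tau> 1 \<in> cfgs N" by (rule PiE_mem) simp
      from R_self[OF this] show "fR \<tau> * R e (\<tau> 1) (\<tau> 1) = self_overlap e * fR \<tau>" by simp
    qed
    then show ?thesis by (simp add: E_def rep_avg_cmult)
  qed
  have n1: "1 \<le> n" using n by simp
  have fRi: "fR (\<tau>(Suc n := \<sigma>)) = fR \<tau>" for \<tau> \<sigma>
    by (simp only: fR_def overlap_array_fun_upd)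
  note ibp = gibbs_integration_by_parts[OF x eI n1, of fR u, OF fRi]
  have "(\<integral>g. ?G g (\<lambda>\<tau>. fR \<tau> * spin_ham e g (\<tau> 1)) \<partial>P)
    = u * c * E (\<lambda>\<tau>. (\<Sum>l\<in>{1..n}. fR \<tau> * R e (\<tau> 1) (\<tau> l)) - real n * (fR \<tau> * R e (\<tau> 1) (\<tau> (Suc n))))"
    unfolding ibp(2) c_def E_def by (simp add: right_diff_distrib sum_distrib_left mult_ac)
  also have "\<dots> = u * c * ((\<Sum>l\<in>{1..n}. a l) - real n * a (Suc n))"
    unfolding E_def a_def rep_avg_diff[OF x eI] rep_avg_sum[OF x eI] rep_avg_cmult ..
  finally have X: "(\<integral>g. ?G g (\<lambda>\<tau>. fR \<tau> * spin_ham e g (\<tau> 1)) \<partial>P)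
    = u * c * (self_overlap e * E fR + (\<Sum>l\<in>{2..n}. a l) - real n * a (Suc n))"
    unfolding sum_atLeastAtMost_one[OF n1] a1 .
  have m: "m = u * c * (self_overlap e - r)"
    unfolding m_def c_def r_def E_def by (rule mean_spin_ham[OF x eI n1])
  have "(\<integral>g. ?G g (\<lambda>\<tau>. fR \<tau> * spin_ham e g (\<tau> 1)) \<partial>P) - m * E fR
    = - (u * c * real n) * (a (Suc n) - (1 / real n) * E fR * r - (1 / real n) * (\<Sum>l\<in>{2..n}. a l))"
    unfolding X m using n by (simp add: field_simps)
  then have "\<bar>(\<integral>g. ?G g (\<lambda>\<tau>. fR \<tau> * spin_ham e g (\<tau> 1)) \<partial>P) - m * E fR\<bar> = u * c * real n * D"
    unfolding D using u c0 by (simp add: abs_mult)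
  moreover have "\<bar>(\<integral>g. ?G g (\<lambda>\<tau>. fR \<tau> * spin_ham e g (\<tau> 1)) \<partial>P) - m * E fR\<bar> \<le> B * Q"
  proof -
    have Gf: "integrable P (\<lambda>g. ?G g fR)" by (rule gav_reps_integrable[OF x eI])
    have pw: "?G g (\<lambda>\<tau>. fR \<tau> * spin_ham e g (\<tau> 1)) - m * ?G g fR = ?G g (\<lambda>\<tau>. fR \<tau> * (spin_ham e g (\<tau> 1) - m))" for g
      by (simp only: gav_diff[symmetric] gav_cmult[symmetric]) (simp add: algebra_simps)
    have eq: "(\<integral>g. ?G g (\<lambda>\<tau>. fR \<tau> * spin_ham e g (\<tau> 1)) \<partial>P) - m * E fR = (\<integral>g. ?G g (\<lambda>\<tau>. fR \<tau> * (spin_ham e g (\<tau> 1) - m)) \<partial>P)"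
    proof -
      have "(\<integral>g. ?G g (\<lambda>\<tau>. fR \<tau> * spin_ham e g (\<tau> 1)) - m * ?G g fR \<partial>P)
        = (\<integral>g. ?G g (\<lambda>\<tau>. fR \<tau> * spin_ham e g (\<tau> 1)) \<partial>P) - (\<integral>g. m * ?G g fR \<partial>P)"
        by (intro Bochner_Integration.integral_diff ibp(1) integrable_mult_right Gf)
      also have "(\<integral>g. m * ?G g fR \<partial>P) = m * E fR"
        unfolding E_def rep_avg_def by (rule integral_mult_right_zero)
      finally show ?thesis by (simp only: pw)
    qed
    have "\<bar>\<integral>g. ?G g (\<lambda>\<tau>. fR \<tau> * (spin_ham e g (\<tau> 1) - m)) \<partial>P\<bar> \<le> (\<integral>g. \<bar>?G g (\<lambda>\<tau>. fR \<tau> * (spin_ham e g (\<tau> 1) - m))\<bar> \<partial>P)"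
      by (rule integral_abs_bound)
    also have "\<dots> \<le> (\<integral>g. B * gav (cfgs N) (ham e x u g) (\<lambda>\<sigma>. \<bar>spin_ham e g \<sigma> - m\<bar>) \<partial>P)"
    proof (rule integral_mono_AE'[OF _ AE_I2 AE_I2])
      have hm: "(\<lambda>g. ham e x u g \<sigma>) \<in> borel_measurable P" "(\<lambda>g. spin_ham e g \<sigma>) \<in> borel_measurable P" if "\<sigma> \<in> cfgs N" for \<sigma>
        using rest_ham_integrable[OF x that, of e] spin_ham_integrable(1)[OF eI that] by auto
      have "integrable P (\<lambda>g. gav (cfgs N) (ham e x u g) (\<lambda>\<sigma>. \<bar>spin_ham e g \<sigma> - m\<bar>))"
      proof (rule Bochner_Integration.integrable_bound)
        show "integrable P (\<lambda>g. \<Sum>\<sigma>\<in>cfgs N. \<bar>spin_ham e g \<sigma> - m\<bar>)"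
          using spin_ham_integrable(1)[OF eI] by auto
        show "(\<lambda>g. gav (cfgs N) (ham e x u g) (\<lambda>\<sigma>. \<bar>spin_ham e g \<sigma> - m\<bar>)) \<in> borel_measurable P"
          using hm by (intro measurable_gav) auto
        show "AE g in P. norm (gav (cfgs N) (ham e x u g) (\<lambda>\<sigma>. \<bar>spin_ham e g \<sigma> - m\<bar>)) \<le> norm (\<Sum>\<sigma>\<in>cfgs N. \<bar>spin_ham e g \<sigma> - m\<bar>)"
          using gav_bounded_sum[OF finite_cfgs cfgs_nonempty, where F="\<lambda>\<sigma>. \<bar>spin_ham e _ \<sigma> - m\<bar>"]
          by (intro AE_I2) (simp add: sum_nonneg)
      qed
      then show "integrable P (\<lambda>g. B * gav (cfgs N) (ham e x u g) (\<lambda>\<sigma>. \<bar>spin_ham e g \<sigma> - m\<bar>))" by simp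
      show "0 \<le> B * gav (cfgs N) (ham e x u g) (\<lambda>\<sigma>. \<bar>spin_ham e g \<sigma> - m\<bar>)" for g
        using B0 by (intro mult_nonneg_nonneg gav_nonneg) auto
      show "\<bar>?G g (\<lambda>\<tau>. fR \<tau> * (spin_ham e g (\<tau> 1) - m))\<bar> \<le> B * gav (cfgs N) (ham e x u g) (\<lambda>\<sigma>. \<bar>spin_ham e g \<sigma> - m\<bar>)" for g
      proof -
        have "\<bar>?G g (\<lambda>\<tau>. fR \<tau> * (spin_ham e g (\<tau> 1) - m))\<bar> \<le> ?G g (\<lambda>\<tau>. B * \<bar>spin_ham e g (\<tau> 1) - m\<bar>)"
          by (intro order_trans[OF gav_abs_le] gav_mono) (simp add: abs_mult fR_def f mult_right_mono)
        also have "\<dots> = B * gav (cfgs N) (ham e x u g) (\<lambda>\<sigma>. \<bar>spin_ham e g \<sigma> - m\<bar>)"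
          unfolding gav_cmult using gav_reps_one[where n="Suc n" and l=1 and b="\<lambda>\<sigma>. \<bar>spin_ham e g \<sigma> - m\<bar>"] by simp
        finally show ?thesis .
      qed
    qed
    also have "\<dots> = B * Q" unfolding Q_def by simp
    finally show ?thesis unfolding eq .
  qed
  ultimately have "u * c * real n * D \<le> B * Q" by simp
  \<comment> \<open>Both \<open>u\<close> and \<open>n\<close> are at least 1, so dropping them from
    the denominator loses only a constant.\<close>
  moreover have "c * D \<le> u * c * real n * D"
  proof -
    have "0 \<le> D" unfolding D by simp
    moreover have "1 * 1 \<le> u * real n" using u n by (intro mult_mono) auto
    ultimately have "1 * (c * D) \<le> (u * real n) * (c * D)" using c0 by (intro mult_right_mono) auto
    then show ?thesis by (simp add: mult_ac)
  qed
  ultimately have "D \<le> B / c * Q" using c0 by (simp add: field_simps)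
  then show ?thesis unfolding D_def c_def Q_def m_def .
qed

lemma integral_Delta_q_coordinate_le:
  assumes x: "\<forall>e\<in>Idx. \<bar>x e\<bar> \<le> 3" and e: "(w, p) \<in> Idx" and n: "2 \<le> n"
    and f: "\<And>y. \<bar>f y\<bar> \<le> B" and C: "\<And>s t. Delta2 s t \<le> C" and y: "0 < y" "y \<le> 1"
  shows "(\<integral>u. Delta_q Delta2 W j gamma lab N f n w p (x((w, p) := u)) \<partial>unif12) \<le>
    B / (coef (w, p))\<^sup>2 * (13 / 2 / sN + 24 * y + 3 * sqrt ((C + 36) * real N) / (sN\<^sup>2 * y))"
proof -
  let ?e = "(w, p)" and ?v = "sqrt ((C + 36) * real N)" and ?c = "B / (sN * coef (w, p))\<^sup>2"
  have B0: "0 \<le> B" using f order_trans[OF abs_ge_zero] by blast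
  have c: "0 \<le> ?c" using B0 by simp
  \<comment> \<open>The bounds are applied with \<open>K = 6 * sN\<^sup>2\<close>,
    \<open>v = ?v\<close> and \<open>r = sN\<close>. This \<open>r\<close> makes
    \<open>K / r\<close> and \<open>r / 2\<close> of the same order; together they are
    \<open>13 / 2 * sN\<close>, hence \<open>13 / 2 / sN\<close> after division by
    \<open>sN\<^sup>2\<close>.\<close>
  have "\<exists>b. integrable unif12 b \<and> (\<integral>u. b u \<partial>unif12) \<le> 6 * sN\<^sup>2 / sN + sN / 2 + 4 * y * (6 * sN\<^sup>2) + 3 * ?v / y \<and>
    (\<forall>u\<in>{1..2}. (\<integral>g. gav (cfgs N) (ham ?e x u g)
        (\<lambda>\<sigma>. \<bar>spin_ham ?e g \<sigma> - (\<integral>g. gav (cfgs N) (ham ?e x u g) (spin_ham ?e g) \<partial>P)\<bar>) \<partial>P) \<le> b u)"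
    using rest_ham_integrable[OF x] spin_ham_integrable[OF e] free_energy_concentration_ham[OF x e _ C] mean_spin_ham_abs_le[OF x e] y sN_pos
    by (intro perturbation_concentration prob_space_P finite_cfgs cfgs_nonempty) auto
  then obtain b where b: "integrable unif12 b" "(\<integral>u. b u \<partial>unif12) \<le> 6 * sN\<^sup>2 / sN + sN / 2 + 4 * y * (6 * sN\<^sup>2) + 3 * ?v / y"
    and bQ: "\<And>u. u \<in> {1..2} \<Longrightarrow> (\<integral>g. gav (cfgs N) (ham ?e x u g)
        (\<lambda>\<sigma>. \<bar>spin_ham ?e g \<sigma> - (\<integral>g. gav (cfgs N) (ham ?e x u g) (spin_ham ?e g) \<partial>P)\<bar>) \<partial>P) \<le> b u"
    by blast
  have b0: "0 \<le> b u" if "u \<in> {1..2}" for u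
    by (rule order_trans[OF _ bQ[OF that]]) (intro integral_nonneg_AE AE_I2 gav_nonneg abs_ge_zero)
  have "(\<integral>u. Delta_q Delta2 W j gamma lab N f n w p (x(?e := u)) \<partial>unif12) \<le> (\<integral>u. ?c * b u \<partial>unif12)"
  proof (rule integral_mono_AE')
    show "integrable unif12 (\<lambda>u. ?c * b u)" using b(1) by simp
    show "AE u in unif12. Delta_q Delta2 W j gamma lab N f n w p (x(?e := u)) \<le> ?c * b u"
      using AE_unif12
    proof eventually_elim
      case (elim u)
      show ?case
        by (rule order_trans[OF Delta_q_le[OF x e elim n f] mult_left_mono[OF bQ[OF elim] c]])
    qed
    show "AE u in unif12. 0 \<le> ?c * b u"
      using AE_unif12 by eventually_elim (intro mult_nonneg_nonneg b0 c)
  qed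
  also have "\<dots> \<le> ?c * (6 * sN\<^sup>2 / sN + sN / 2 + 4 * y * (6 * sN\<^sup>2) + 3 * ?v / y)"
    unfolding integral_mult_right_zero by (rule mult_left_mono[OF b(2) c])
  also have "\<dots> = B / (coef (w, p))\<^sup>2 * (13 / 2 / sN + 24 * y + 3 * ?v / (sN\<^sup>2 * y))"
    using sN_pos y coef_pos[of ?e] by (simp add: field_simps power2_eq_square)
  finally show ?thesis .
qed

lemma integral_Delta_q_le:
  assumes e: "(w, p) \<in> Idx" and n: "2 \<le> n"
    and f: "\<And>y. \<bar>f y\<bar> \<le> B" and C: "\<And>s t. Delta2 s t \<le> C" and y: "0 < y" "y \<le> 1"
  shows "(\<integral>x. Delta_q Delta2 W j gamma lab N f n w p x \<partial>x_space W) \<le>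
    B / (coef (w, p))\<^sup>2 * (13 / 2 / sN + 24 * y + 3 * sqrt ((C + 36) * real N) / (sN\<^sup>2 * y))" (is "?I \<le> ?b")
proof -
  let ?X = "PiM Idx (\<lambda>_. unif12)" and ?D = "Delta_q Delta2 W j gamma lab N f n w p"
  interpret X: prob_space ?X by (intro prob_space_PiM prob_space_unif12)
  have X: "x_space W = ?X" by (simp add: x_space_def)
  have B0: "0 \<le> B" using f order_trans[OF abs_ge_zero] by blast
  have C0: "0 \<le> C" using C Delta2_nonneg order_trans by blast
  have b0: "0 \<le> ?b" using B0 C0 sN_pos y by (intro mult_nonneg_nonneg add_nonneg_nonneg) auto
  show ?thesis
  proof (cases "integrable ?X ?D")
    case False \<comment> \<open>then the integral is \<open>0\<close>, so measurability of \<open>Delta_q\<close> in \<open>x\<close> is never needed\<close>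
    then show ?thesis using b0 unfolding X by (simp add: not_integrable_integral_eq)
  next
    case True
    \<comment> \<open>Countability of \<open>Idx\<close> yields one null set outside which all
      couplings are bounded at once.\<close>
    have AE3: "AE x in ?X. \<forall>e\<in>Idx. \<bar>x e\<bar> \<le> 3"
    proof (rule AE_ball_countable[OF countable_Idx, THEN iffD2], rule ballI)
      fix e assume "e \<in> Idx"
      then have "AE x in ?X. x e \<in> {1..2}"
        using AE_unif12 by (intro AE_PiM_component prob_space_unif12)
      then show "AE x in ?X. \<bar>x e\<bar> \<le> 3" by eventually_elim auto
    qed
    have "?I = (\<integral>x. \<integral>u. ?D (x((w, p) := u)) \<partial>unif12 \<partial>?X)"
      unfolding X by (rule PiM_resample(2)[OF prob_space_unif12 e True])
    also have "\<dots> \<le> (\<integral>x. ?b \<partial>?X)"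
    proof (rule integral_mono_AE')
      show "AE x in ?X. (\<integral>u. ?D (x((w, p) := u)) \<partial>unif12) \<le> ?b"
        using AE3 by eventually_elim (rule integral_Delta_q_coordinate_le[OF _ e n f C y])
      show "integrable ?X (\<lambda>_. ?b)" by (rule X.integrable_const)
      show "AE x in ?X. 0 \<le> ?b" using b0 by (intro AE_I2)
    qed
    also have "\<dots> = ?b"
      by (simp only: lebesgue_integral_const X.prob_space scaleR_one)
    finally show ?thesis .
  qed
qed

end

section \<open>The limit of large \<open>N\<close>\<close>

theorem theorem2:
  fixes lab :: "nat \<Rightarrow> nat \<Rightarrow> 's::finite"
    and lam :: "'s \<Rightarrow> real"
    and Delta2 :: "'s \<Rightarrow> 's \<Rightarrow> real"
    and W :: "('s \<Rightarrow> real) set"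
    and j :: "('s \<Rightarrow> real) \<Rightarrow> nat"
    and gamma :: real
    and f :: "('s \<times> nat \<times> nat \<Rightarrow> real) \<Rightarrow> real"
    and n p :: nat
    and w :: "'s \<Rightarrow> real"
  assumes lam_lim: "\<And>s. (\<lambda>N. real (card (blk lab N s)) / real N) \<longlonglongrightarrow> lam s"
    and lam_range: "\<And>s. 0 < lam s \<and> lam s < 1"
    and Delta2_sym: "\<And>s t. Delta2 s t = Delta2 t s"
    and Delta2_nonneg: "\<And>s t. 0 \<le> Delta2 s t"
    and W_countable: "countable W"
    and W_sub: "\<And>v s. v \<in> W \<Longrightarrow> 0 \<le> v s \<and> v s \<le> 1"
    and W_dense: "\<And>v e. (\<forall>s. 0 \<le> v s \<and> v s \<le> 1) \<Longrightarrow> e > 0 \<Longrightarrow> \<exists>u\<in>W. \<forall>s. \<bar>u s - v s\<bar> < e"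
    and j_inj: "inj_on j W"
    and gamma: "1/4 < gamma" "gamma < 1/2"
    and n: "2 \<le> n"
    and f_meas: "f \<in> borel_measurable (PiM (UNIV \<times> {1..n} \<times> {1..n}) (\<lambda>_. borel))"
    and f_bdd: "\<exists>B. \<forall>y. \<bar>f y\<bar> \<le> B"
    and p: "1 \<le> p"
    and w: "w \<in> W"
  shows "(\<lambda>N. \<integral>x. Delta_q Delta2 W j gamma lab N f n w p x \<partial>x_space W) \<longlonglongrightarrow> 0"
proof -
  obtain B where B: "\<And>y. \<bar>f y\<bar> \<le> B" using f_bdd by blast
  \<comment> \<open>A crude uniform bound on the variances, available because there are finitely
    many species and all entries are nonnegative.\<close>
  define C where "C = (\<Sum>s\<in>UNIV. \<Sum>t\<in>UNIV. Delta2 s t)"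
  have C: "Delta2 s t \<le> C" for s t
  proof -
    have "Delta2 s t \<le> (\<Sum>t\<in>UNIV. Delta2 s t)"
      using Delta2_nonneg by (intro member_le_sum) auto
    also have "\<dots> \<le> C"
      unfolding C_def using Delta2_nonneg
      by (intro member_le_sum[where f="\<lambda>s. \<Sum>t\<in>UNIV. Delta2 s t"]) (auto intro: sum_nonneg)
    finally show ?thesis .
  qed
  define c where "c = (2 powr (- real (j w) - real p))\<^sup>2"
  define bd where "bd N = B / c * (13 / 2 * real N powr (- gamma) + 24 * real N powr (1/4 - gamma)
      + 3 * sqrt (C + 36) * real N powr (1/4 - gamma))" for N
  have upper: "(\<integral>x. Delta_q Delta2 W j gamma lab N f n w p x \<partial>x_space W) \<le> bd N" if N: "0 < N" for N
  proof -
    interpret perturbed_sk Delta2 W j gamma lab N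
      by unfold_locales (use Delta2_nonneg W_countable W_sub j_inj gamma N in auto)
    \<comment> \<open>This step size equates \<open>y\<close> with
      \<open>sqrt N / (sN\<^sup>2 * y)\<close>, the two competing errors. It is at most 1 because
      \<open>N \<ge> 1\<close> and the exponent is negative.\<close>
    let ?y = "real N powr (1/4 - gamma)"
    have y: "0 < ?y" "?y \<le> 1"
      using N gamma powr_mono[of "1/4 - gamma" 0 "real N"] by auto
    have e: "(w, p) \<in> Idx" using w p by auto
    have "sqrt (real N) / (sN\<^sup>2 * ?y) = ?y"
    proof -
      have "sqrt (real N) = real N powr (1/2)" by (simp add: powr_half_sqrt)
      also have "\<dots> = sN * sN * ?y * ?y" by (simp flip: powr_add)
      finally show ?thesis using y sN_pos by (simp add: power2_eq_square)
    qed
    moreover have "3 * sqrt ((C + 36) * real N) / (sN\<^sup>2 * ?y) = 3 * sqrt (C + 36) * (sqrt (real N) / (sN\<^sup>2 * ?y))"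
      unfolding real_sqrt_mult by (simp only: times_divide_eq_right mult.assoc)
    ultimately have v: "3 * sqrt ((C + 36) * real N) / (sN\<^sup>2 * ?y) = 3 * sqrt (C + 36) * ?y"
      by (simp only:)
    have s: "13 / 2 / sN = 13 / 2 * real N powr (- gamma)"
      unfolding powr_minus by (rule divide_inverse)
    show ?thesis
      using integral_Delta_q_le[OF e n B C y] by (simp only: v s bd_def c_def coef_def fst_conv snd_conv)
  qed
  have lower: "0 \<le> (\<integral>x. Delta_q Delta2 W j gamma lab N f n w p x \<partial>x_space W)" for N
    by (intro integral_nonneg_AE AE_I2) (simp add: Delta_q_def Let_def)
  have powr0: "(\<lambda>N. real N powr a) \<longlonglongrightarrow> 0" if "a < 0" for a
    by (rule tendsto_neg_powr[OF that filterlim_real_sequentially])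
  have "bd \<longlonglongrightarrow> B / c * (13 / 2 * 0 + 24 * 0 + 3 * sqrt (C + 36) * 0)"
    unfolding bd_def using gamma by (intro tendsto_intros powr0) auto
  then have bd0: "bd \<longlonglongrightarrow> 0" by simp
  show ?thesis
    using upper lower
    by (intro tendsto_sandwich[OF _ _ tendsto_const bd0]) (auto intro: eventually_sequentiallyI[of 1])
qed

end
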